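(* Let $(\mathsf{X},\mathsf{Y})$ be a symmetric duality pair on an Auslander--Gruson--Jensen (AGJ) duality triple $(\mathsf{T},\mathsf{U},Q,D)$. Then there is a symmetric duality pair $(\mathsf{A},\mathsf{B})$ on $(\mathrm{Mod}(\mathsf{T}^{\mathrm{c}}),\mathrm{Mod}(\mathsf{U}^{\mathrm{c}}),\partial)$ such that $\mathsf{A}_{0}=\mathsf{X}$ and $\mathsf{B}_{0}=\mathsf{Y}$.
   Context: For a compactly generated triangulated category $\mathsf{T}$ with compact objects $\mathsf{T}^{\mathrm{c}}$, $\mathrm{Mod}(\mathsf{T}^{\mathrm{c}})$ is the category of additive functors $(\mathsf{T}^{\mathrm{c}})^{\mathrm{op}}\to\mathbf{Ab}$ and $\mathbf{y}X=\mathrm{Hom}_{\mathsf{T}}(-,X)|_{\mathsf{T}^{\mathrm{c}}}$. A morphism $X\to Y$ is a pure monomorphism if it sits in a triangle $X\to Y\to Z\to\Sigma X$ with $0\to\mathbf{y}X\to\mathbf{y}Y\to\mathbf{y}Z\to0$ exact; $X$ is pure injective if $\mathbf{y}X$ is injective. A duality triple $(\mathsf{T},\mathsf{U},Q)$ consists of two compactly generated triangulated categories $\mathsf{T},\mathsf{U}$ and exact functors $Q\colon\mathsf{T}^{\mathrm{op}}\to\mathsf{U}$ and $Q\colon\mathsf{U}^{\mathrm{op}}\to\mathsf{T}$ (both denoted $Q$) such that: (1) $Q(X)$ is pure injective for every $X$ in $\mathsf{T}$ or $\mathsf{U}$; (2) for every $X$ in $\mathsf{T}$ or $\mathsf{U}$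 there is a natural map $i_X\colon X\to Q^2(X)$ which is a pure monomorphism; (3) $Q(i_X)\circ i_{Q(X)}$ is the identity for every $X$ in $\mathsf{T}$ or $\mathsf{U}$; (4) $Q(\bigoplus_I X_i)\simeq\prod_I Q(X_i)$ for every set of objects $\{X_i\}_I$ in $\mathsf{T}$ or in $\mathsf{U}$. An AGJ duality triple $(\mathsf{T},\mathsf{U},Q,D)$ is a duality triple together with functors $D\colon(\mathsf{T}^{\mathrm{c}})^{\mathrm{op}}\to\mathsf{U}^{\mathrm{c}}$ and $D\colon(\mathsf{U}^{\mathrm{c}})^{\mathrm{op}}\to\mathsf{T}^{\mathrm{c}}$ such that: (1) they form an adjoint equivalence between $\mathsf{T}^{\mathrm{c}}$ and $(\mathsf{U}^{\mathrm{c}})^{\mathrm{op}}$; (2) for all $C\in\mathsf{T}^{\mathrm{c}}$, $X\in\mathsf{T}$, $C'\in\mathsf{U}^{\mathrm{c}}$, $Y\in\mathsf{U}$ there are isomorphisms $\mathrm{Hom}_{\mathbb{Z}}(\mathrm{Hom}_{\mathsf{T}}(C,X),\mathbb{Q}/\mathbb{Z})\cong\mathrm{Hom}_{\mathsf{U}}(DC,QX)$ and $\mathrm{Hom}_{\mathbb{Z}}(\mathrm{Hom}_{\mathsf{U}}(C',Y),\mathbb{Q}/\mathbb{Z})\cong\mathrm{Hom}_{\mathsf{T}}(DC',QY)$, natural in both variables. A duality pair on $(\mathsf{T},\mathsf{U},Q)$ is a pair of classes $\mathsf{X}\subseteq\mathsf{T}$, $\mathsf{Y}\subseteq\mathsf{U}$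 with $M\in\mathsf{X}$ iff $Q(M)\in\mathsf{Y}$ and $\mathsf{Y}$ closed under finite coproducts and retracts; it is symmetric if $(\mathsf{Y},\mathsf{X})$ is also a duality pair. The contravariant functor $\partial\colon\mathrm{Mod}(\mathsf{T}^{\mathrm{c}})\to\mathrm{Mod}(\mathsf{U}^{\mathrm{c}})$ is $\partial f=\mathrm{Hom}_{\mathbb{Z}}(f(D(-)),\mathbb{Q}/\mathbb{Z})$, and $\partial\colon\mathrm{Mod}(\mathsf{U}^{\mathrm{c}})\to\mathrm{Mod}(\mathsf{T}^{\mathrm{c}})$ is defined likewise. A duality pair on $(\mathrm{Mod}(\mathsf{T}^{\mathrm{c}}),\mathrm{Mod}(\mathsf{U}^{\mathrm{c}}),\partial)$ is a pair of classes $\mathsf{A}\subseteq\mathrm{Mod}(\mathsf{T}^{\mathrm{c}})$, $\mathsf{B}\subseteq\mathrm{Mod}(\mathsf{U}^{\mathrm{c}})$ with $f\in\mathsf{A}$ iff $\partial f\in\mathsf{B}$ and $\mathsf{B}$ closed under finite direct sums and summands; symmetric if $(\mathsf{B},\mathsf{A})$ is also a duality pair. For a class $\mathsf{A}\subseteq\mathrm{Mod}(\mathsf{T}^{\mathrm{c}})$, $\mathsf{A}_0=\{X\in\mathsf{T}:\mathbf{y}X\in\mathsf{A}\}$, and similarly for $\mathsf{U}$. *)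

theory Defs
  imports "HOL-Algebra.Product_Groups" "HOL-Algebra.FiniteProduct"
begin

unbundle cardinal_syntax

section \<open>Smallness\<close>

text \<open>
  Sets and classes are distinguished relative to a Grothendieck universe.  The universe is
  given by a type \<^typ>\<open>'v\<close> of inaccessible cardinality, and a set (over an arbitrary type) is
  small if its cardinality is strictly below that of \<^typ>\<open>'v\<close>.  Thus every small set is in
  bijection with a subset of \<^typ>\<open>'v\<close>, and it suffices to index small families by
  small subsets of \<^typ>\<open>'v\<close>.
\<close>

definition small :: "'v itself \<Rightarrow> 'a set \<Rightarrow> bool" where
  "small V A \<longleftrightarrow> |A| <o |UNIV :: 'v set|"

definition grothendieck_universe :: "'v itself \<Rightarrow> bool" where
  "grothendieck_universe V \<longleftrightarrow>
     natLeq <o |UNIV :: 'v set| \<and>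
     regularCard |UNIV :: 'v set| \<and>
     (\<forall>A :: 'v set. small V A \<longrightarrow> small V (Pow A))"


section \<open>Preadditive categories\<close>

record ('o, 'm) preadd =
  obj :: "'o set"
  arr :: "'m set"
  src :: "'m \<Rightarrow> 'o"
  tgt :: "'m \<Rightarrow> 'o"
  ident :: "'o \<Rightarrow> 'm"
  cmp :: "'m \<Rightarrow> 'm \<Rightarrow> 'm" (infixl \<open>\<cdot>\<index>\<close> 70)
  hom_add :: "'m \<Rightarrow> 'm \<Rightarrow> 'm"
  hom_zero :: "'o \<Rightarrow> 'o \<Rightarrow> 'm"

definition Homs :: "('o, 'm, 'z) preadd_scheme \<Rightarrow> 'o \<Rightarrow> 'o \<Rightarrow> 'm set" where
  "Homs C X Y = {f \<in> arr C. src C f = X \<and> tgt C f = Y}"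

text \<open>Abelian groups are commutative groups in the multiplicative notation of HOL-Algebra.\<close>

definition HomG :: "('o, 'm, 'z) preadd_scheme \<Rightarrow> 'o \<Rightarrow> 'o \<Rightarrow> 'm monoid" where
  "HomG C X Y = \<lparr>carrier = Homs C X Y, mult = hom_add C, one = hom_zero C X Y\<rparr>"

definition hom_neg :: "('o, 'm, 'z) preadd_scheme \<Rightarrow> 'm \<Rightarrow> 'm" where
  "hom_neg C f = inv\<^bsub>HomG C (src C f) (tgt C f)\<^esub> f"

locale preadditive_category =
  fixes C :: "('o, 'm, 'z) preadd_scheme" (structure)
  assumes src_obj: "f \<in> arr C \<Longrightarrow> src C f \<in> obj C"
    and tgt_obj: "f \<in> arr C \<Longrightarrow> tgt C f \<in> obj C"
    and ident_hom: "X \<in> obj C \<Longrightarrow> ident C X \<in> Homs C X X"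
    and cmp_hom: "\<lbrakk>f \<in> Homs C X Y; g \<in> Homs C Y Z\<rbrakk> \<Longrightarrow> g \<cdot> f \<in> Homs C X Z"
    and ident_left: "f \<in> Homs C X Y \<Longrightarrow> ident C Y \<cdot> f = f"
    and ident_right: "f \<in> Homs C X Y \<Longrightarrow> f \<cdot> ident C X = f"
    and cmp_assoc: "\<lbrakk>f \<in> Homs C W X; g \<in> Homs C X Y; h \<in> Homs C Y Z\<rbrakk>
                      \<Longrightarrow> h \<cdot> (g \<cdot> f) = (h \<cdot> g) \<cdot> f"
    and hom_comm_group: "\<lbrakk>X \<in> obj C; Y \<in> obj C\<rbrakk> \<Longrightarrow> comm_group (HomG C X Y)"
    and cmp_add_left: "\<lbrakk>f \<in> Homs C X Y; g \<in> Homs C Y Z; g' \<in> Homs C Y Z\<rbrakk>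
                      \<Longrightarrow> hom_add C g g' \<cdot> f = hom_add C (g \<cdot> f) (g' \<cdot> f)"
    and cmp_add_right: "\<lbrakk>f \<in> Homs C X Y; f' \<in> Homs C X Y; g \<in> Homs C Y Z\<rbrakk>
                      \<Longrightarrow> g \<cdot> hom_add C f f' = hom_add C (g \<cdot> f) (g \<cdot> f')"

definition op_cat :: "('o, 'm, 'z) preadd_scheme \<Rightarrow> ('o, 'm) preadd" where
  "op_cat C = \<lparr>obj = obj C, arr = arr C, src = tgt C, tgt = src C, ident = ident C,
     cmp = (\<lambda>g f. f \<cdot>\<^bsub>C\<^esub> g), hom_add = hom_add C, hom_zero = (\<lambda>X Y. hom_zero C Y X)\<rparr>"

definition full_sub :: "('o, 'm, 'z) preadd_scheme \<Rightarrow> 'o set \<Rightarrow> ('o, 'm) preadd" where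
  "full_sub C S = \<lparr>obj = S, arr = {f \<in> arr C. src C f \<in> S \<and> tgt C f \<in> S}, src = src C,
     tgt = tgt C, ident = ident C, cmp = cmp C, hom_add = hom_add C, hom_zero = hom_zero C\<rparr>"

definition is_iso :: "('o, 'm, 'z) preadd_scheme \<Rightarrow> 'o \<Rightarrow> 'o \<Rightarrow> 'm \<Rightarrow> bool" where
  "is_iso C X Y f \<longleftrightarrow> f \<in> Homs C X Y \<and>
     (\<exists>g \<in> Homs C Y X. g \<cdot>\<^bsub>C\<^esub> f = ident C X \<and> f \<cdot>\<^bsub>C\<^esub> g = ident C Y)"

definition is_mono :: "('o, 'm, 'z) preadd_scheme \<Rightarrow> 'm \<Rightarrow> bool" where
  "is_mono C f \<longleftrightarrow> f \<in> arr C \<and>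
     (\<forall>W. \<forall>g \<in> Homs C W (src C f). \<forall>h \<in> Homs C W (src C f). f \<cdot>\<^bsub>C\<^esub> g = f \<cdot>\<^bsub>C\<^esub> h \<longrightarrow> g = h)"

definition injective_object :: "('o, 'm, 'z) preadd_scheme \<Rightarrow> 'o \<Rightarrow> bool" where
  "injective_object C E \<longleftrightarrow> E \<in> obj C \<and>
     (\<forall>m. is_mono C m \<longrightarrow>
        (\<forall>f \<in> Homs C (src C m) E. \<exists>g \<in> Homs C (tgt C m) E. g \<cdot>\<^bsub>C\<^esub> m = f))"

definition is_zero_object :: "('o, 'm, 'z) preadd_scheme \<Rightarrow> 'o \<Rightarrow> bool" where
  "is_zero_object C Z \<longleftrightarrow> Z \<in> obj C \<and>
     (\<forall>X \<in> obj C. (\<exists>!f. f \<in> Homs C X Z) \<and> (\<exists>!f. f \<in> Homs C Z X))"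

definition is_coproduct ::
  "('o, 'm, 'z) preadd_scheme \<Rightarrow> 'i set \<Rightarrow> ('i \<Rightarrow> 'o) \<Rightarrow> 'o \<Rightarrow> ('i \<Rightarrow> 'm) \<Rightarrow> bool" where
  "is_coproduct C I X S \<iota> \<longleftrightarrow> S \<in> obj C \<and> (\<forall>i \<in> I. \<iota> i \<in> Homs C (X i) S) \<and>
     (\<forall>Y \<in> obj C. \<forall>f. (\<forall>i \<in> I. f i \<in> Homs C (X i) Y) \<longrightarrow>
        (\<exists>!h. h \<in> Homs C S Y \<and> (\<forall>i \<in> I. h \<cdot>\<^bsub>C\<^esub> \<iota> i = f i)))"

definition is_product ::
  "('o, 'm, 'z) preadd_scheme \<Rightarrow> 'i set \<Rightarrow> ('i \<Rightarrow> 'o) \<Rightarrow> 'o \<Rightarrow> ('i \<Rightarrow> 'm) \<Rightarrow> bool" where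
  "is_product C I X P \<pi> \<longleftrightarrow> is_coproduct (op_cat C) I X P \<pi>"

locale additive_category = preadditive_category C
  for C :: "('o, 'm, 'z) preadd_scheme" (structure) +
  assumes finite_coproducts: "\<lbrakk>finite (I :: nat set); \<forall>i \<in> I. X i \<in> obj C\<rbrakk>
                                \<Longrightarrow> \<exists>S \<iota>. is_coproduct C I X S \<iota>"


section \<open>Functors\<close>

record ('o, 'm, 'p, 'n) fctr =
  omap :: "'o \<Rightarrow> 'p"
  amap :: "'m \<Rightarrow> 'n"

definition id_fctr :: "('o, 'm, 'o, 'm) fctr" where
  "id_fctr = \<lparr>omap = (\<lambda>X. X), amap = (\<lambda>f. f)\<rparr>"

definition comp_fctr :: "('p, 'n, 'q, 'l) fctr \<Rightarrow> ('o, 'm, 'p, 'n) fctr \<Rightarrow> ('o, 'm, 'q, 'l) fctr"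
  where "comp_fctr G F = \<lparr>omap = omap G \<circ> omap F, amap = amap G \<circ> amap F\<rparr>"

locale category_functor = C: preadditive_category C + D: preadditive_category D
  for C :: "('o, 'm, 'z) preadd_scheme" and D :: "('p, 'n, 'w) preadd_scheme"
    and F :: "('o, 'm, 'p, 'n) fctr" +
  assumes omap_obj: "X \<in> obj C \<Longrightarrow> omap F X \<in> obj D"
    and amap_hom: "f \<in> Homs C X Y \<Longrightarrow> amap F f \<in> Homs D (omap F X) (omap F Y)"
    and amap_ident: "X \<in> obj C \<Longrightarrow> amap F (ident C X) = ident D (omap F X)"
    and amap_cmp: "\<lbrakk>f \<in> Homs C X Y; g \<in> Homs C Y Z\<rbrakk>
                     \<Longrightarrow> amap F (g \<cdot>\<^bsub>C\<^esub> f) = amap F g \<cdot>\<^bsub>D\<^esub> amap F f"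

locale additive_functor = category_functor C D F
  for C :: "('o, 'm, 'z) preadd_scheme" and D :: "('p, 'n, 'w) preadd_scheme"
    and F :: "('o, 'm, 'p, 'n) fctr" +
  assumes amap_add: "\<lbrakk>f \<in> Homs C X Y; g \<in> Homs C X Y\<rbrakk>
                     \<Longrightarrow> amap F (hom_add C f g) = hom_add D (amap F f) (amap F g)"

definition nat_trans ::
  "('o, 'm, 'z) preadd_scheme \<Rightarrow> ('p, 'n, 'w) preadd_scheme \<Rightarrow> ('o, 'm, 'p, 'n) fctr
     \<Rightarrow> ('o, 'm, 'p, 'n) fctr \<Rightarrow> ('o \<Rightarrow> 'n) \<Rightarrow> bool" where
  "nat_trans C D F G \<eta> \<longleftrightarrow>
     (\<forall>X \<in> obj C. \<eta> X \<in> Homs D (omap F X) (omap G X)) \<and>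
     (\<forall>f \<in> arr C. amap G f \<cdot>\<^bsub>D\<^esub> \<eta> (src C f) = \<eta> (tgt C f) \<cdot>\<^bsub>D\<^esub> amap F f)"

definition nat_iso ::
  "('o, 'm, 'z) preadd_scheme \<Rightarrow> ('p, 'n, 'w) preadd_scheme \<Rightarrow> ('o, 'm, 'p, 'n) fctr
     \<Rightarrow> ('o, 'm, 'p, 'n) fctr \<Rightarrow> ('o \<Rightarrow> 'n) \<Rightarrow> bool" where
  "nat_iso C D F G \<eta> \<longleftrightarrow> nat_trans C D F G \<eta> \<and>
     (\<forall>X \<in> obj C. is_iso D (omap F X) (omap G X) (\<eta> X))"

definition adjoint_equivalence ::
  "('o, 'm, 'z) preadd_scheme \<Rightarrow> ('p, 'n, 'w) preadd_scheme
     \<Rightarrow> ('o, 'm, 'p, 'n) fctr \<Rightarrow> ('p, 'n, 'o, 'm) fctr \<Rightarrow> bool" where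
  "adjoint_equivalence C D F G \<longleftrightarrow>
     category_functor C D F \<and> category_functor D C G \<and>
     (\<exists>\<eta> \<epsilon>. nat_iso C C id_fctr (comp_fctr G F) \<eta> \<and>
            nat_iso D D (comp_fctr F G) id_fctr \<epsilon> \<and>
            (\<forall>X \<in> obj C. \<epsilon> (omap F X) \<cdot>\<^bsub>D\<^esub> amap F (\<eta> X) = ident D (omap F X)) \<and>
            (\<forall>Y \<in> obj D. amap G (\<epsilon> Y) \<cdot>\<^bsub>C\<^esub> \<eta> (omap G Y) = ident C (omap G Y)))"

text \<open>
  The category of additive functors.  Arrows are triples (source, target, components), with
  the components undefined outside the objects so that equality of arrows is equality of
  natural transformations.
\<close>

type_synonym ('o, 'm, 'p, 'n) nat_arr =
  "('o, 'm, 'p, 'n) fctr \<times> ('o, 'm, 'p, 'n) fctr \<times> ('o \<Rightarrow> 'n)"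

definition additive_functor_category ::
  "('o, 'm, 'z) preadd_scheme \<Rightarrow> ('p, 'n, 'w) preadd_scheme
     \<Rightarrow> (('o, 'm, 'p, 'n) fctr, ('o, 'm, 'p, 'n) nat_arr) preadd" where
  "additive_functor_category C D =
     \<lparr>obj = {F. additive_functor C D F},
      arr = {(F, G, \<eta>). additive_functor C D F \<and> additive_functor C D G \<and>
                        \<eta> \<in> extensional (obj C) \<and> nat_trans C D F G \<eta>},
      src = (\<lambda>(F, G, \<eta>). F),
      tgt = (\<lambda>(F, G, \<eta>). G),
      ident = (\<lambda>F. (F, F, \<lambda>X \<in> obj C. ident D (omap F X))),
      cmp = (\<lambda>(G', H, \<theta>) (F, G, \<eta>). (F, H, \<lambda>X \<in> obj C. \<theta> X \<cdot>\<^bsub>D\<^esub> \<eta> X)),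
      hom_add = (\<lambda>(F, G, \<eta>) (F', G', \<theta>). (F, G, \<lambda>X \<in> obj C. hom_add D (\<eta> X) (\<theta> X))),
      hom_zero = (\<lambda>F G. (F, G, \<lambda>X \<in> obj C. hom_zero D (omap F X) (omap G X)))\<rparr>"


section \<open>Abelian groups\<close>

definition hom_group :: "('a, 'c) monoid_scheme \<Rightarrow> ('b, 'd) monoid_scheme \<Rightarrow> ('a \<Rightarrow> 'b) monoid" where
  "hom_group G H =
     \<lparr>carrier = hom G H \<inter> extensional (carrier G),
      mult = (\<lambda>\<phi> \<psi>. \<lambda>x \<in> carrier G. \<phi> x \<otimes>\<^bsub>H\<^esub> \<psi> x),
      one = (\<lambda>x \<in> carrier G. \<one>\<^bsub>H\<^esub>)\<rparr>"

definition QZ :: "rat set monoid" where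
  "QZ = \<lparr>carrier = UNIV, mult = (+), one = 0\<rparr> Mod \<int>"

type_synonym 'v ab_arr = "'v monoid \<times> 'v monoid \<times> ('v \<Rightarrow> 'v)"

text \<open>The category of small abelian groups with underlying set inside \<^typ>\<open>'v\<close>.\<close>

definition Ab :: "('v monoid, 'v ab_arr) preadd" where
  "Ab =
     \<lparr>obj = {G. comm_group G \<and> small TYPE('v) (carrier G)},
      arr = {(G, H, \<phi>). comm_group G \<and> small TYPE('v) (carrier G) \<and>
                        comm_group H \<and> small TYPE('v) (carrier H) \<and>
                        \<phi> \<in> carrier (hom_group G H)},
      src = (\<lambda>(G, H, \<phi>). G),
      tgt = (\<lambda>(G, H, \<phi>). H),
      ident = (\<lambda>G. (G, G, \<lambda>x \<in> carrier G. x)),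
      cmp = (\<lambda>(H', K, \<psi>) (G, H, \<phi>). (G, K, compose (carrier G) \<psi> \<phi>)),
      hom_add = (\<lambda>(G, H, \<phi>) (G', H', \<psi>). (G, H, \<phi> \<otimes>\<^bsub>hom_group G H\<^esub> \<psi>)),
      hom_zero = (\<lambda>G H. (G, H, \<one>\<^bsub>hom_group G H\<^esub>))\<rparr>"

text \<open>
  A small abelian group over an arbitrary type is replaced by an isomorphic object of
  \<^const>\<open>Ab\<close>, by transport of structure along a chosen injection of its underlying set
  into \<^typ>\<open>'v\<close>; homomorphisms are transported accordingly.
\<close>

definition label :: "'a set \<Rightarrow> 'a \<Rightarrow> 'v" where
  "label A = (SOME e. inj_on e A)"

definition unlabel :: "'a set \<Rightarrow> 'v \<Rightarrow> 'a" where
  "unlabel A = inv_into A (label A)"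

definition ab_copy :: "('a, 'c) monoid_scheme \<Rightarrow> 'v monoid" where
  "ab_copy G =
     \<lparr>carrier = label (carrier G) ` carrier G,
      mult = (\<lambda>x y. label (carrier G) (unlabel (carrier G) x \<otimes>\<^bsub>G\<^esub> unlabel (carrier G) y)),
      one = label (carrier G) \<one>\<^bsub>G\<^esub>\<rparr>"

definition ab_copy_hom ::
  "('a, 'c) monoid_scheme \<Rightarrow> ('b, 'd) monoid_scheme \<Rightarrow> ('a \<Rightarrow> 'b) \<Rightarrow> 'v ab_arr" where
  "ab_copy_hom G H \<phi> =
     (ab_copy G, ab_copy H,
      \<lambda>x \<in> carrier (ab_copy G). label (carrier H) (\<phi> (unlabel (carrier G) x)))"


section \<open>Modules over a preadditive category\<close>

type_synonym ('o, 'm, 'v) abmod = "('o, 'm, 'v monoid, 'v ab_arr) fctr"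
type_synonym ('o, 'm, 'v) abmod_arr = "('o, 'm, 'v monoid, 'v ab_arr) nat_arr"

definition Mod_cat ::
  "'v itself \<Rightarrow> ('o, 'm, 'z) preadd_scheme \<Rightarrow> (('o, 'm, 'v) abmod, ('o, 'm, 'v) abmod_arr) preadd" where
  "Mod_cat V C = additive_functor_category (op_cat C) Ab"

definition ab_short_exact :: "'v ab_arr \<Rightarrow> 'v ab_arr \<Rightarrow> bool" where
  "ab_short_exact a b \<longleftrightarrow>
     (case (a, b) of ((G, H, \<phi>), (H', K, \<psi>)) \<Rightarrow>
        H = H' \<and> inj_on \<phi> (carrier G) \<and> \<phi> ` carrier G = kernel H K \<psi> \<and> \<psi> ` carrier H = carrier K)"

text \<open>Exactness in the category of modules is computed objectwise.\<close>

definition mod_short_exact ::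
  "('o, 'm, 'z) preadd_scheme \<Rightarrow> ('o, 'm, 'v) abmod_arr \<Rightarrow> ('o, 'm, 'v) abmod_arr \<Rightarrow> bool" where
  "mod_short_exact C \<alpha> \<beta> \<longleftrightarrow>
     \<alpha> \<in> arr (Mod_cat TYPE('v) C) \<and> \<beta> \<in> arr (Mod_cat TYPE('v) C) \<and>
     (case (\<alpha>, \<beta>) of ((F, G, \<eta>), (G', H, \<theta>)) \<Rightarrow>
        G = G' \<and> (\<forall>X \<in> obj C. ab_short_exact (\<eta> X) (\<theta> X)))"


section \<open>Triangulated categories\<close>

text \<open>
  A triangle \<open>X \<rightarrow> Y \<rightarrow> Z \<rightarrow> \<Sigma>X\<close> is recorded as the triple of its morphisms.  The suspension is
  only required to be an autoequivalence.
\<close>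

record ('o, 'm) triang = "('o, 'm) preadd" +
  susp :: "('o, 'm, 'o, 'm) fctr"
  tri :: "('m \<times> 'm \<times> 'm) set"

locale triangulated_category = additive_category T
  for T :: "('o, 'm, 'z) triang_scheme" (structure) +
  assumes susp_additive: "additive_functor T T (susp T)"
    and susp_fully_faithful: "\<lbrakk>X \<in> obj T; Y \<in> obj T\<rbrakk> \<Longrightarrow>
          bij_betw (amap (susp T)) (Homs T X Y) (Homs T (omap (susp T) X) (omap (susp T) Y))"
    and susp_ess_surj: "Y \<in> obj T \<Longrightarrow> \<exists>X \<in> obj T. \<exists>f. is_iso T (omap (susp T) X) Y f"
    and tri_arrows: "(f, g, h) \<in> tri T \<Longrightarrow>
          f \<in> arr T \<and> g \<in> Homs T (tgt T f) (src T h) \<and> h \<in> Homs T (tgt T g) (omap (susp T) (src T f))"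
    and TR1_ident: "\<lbrakk>X \<in> obj T; is_zero_object T Z\<rbrakk> \<Longrightarrow>
          (ident T X, hom_zero T X Z, hom_zero T Z (omap (susp T) X)) \<in> tri T"
    and TR1_cone: "f \<in> arr T \<Longrightarrow> \<exists>g h. (f, g, h) \<in> tri T"
    and TR1_iso: "\<lbrakk>(f, g, h) \<in> tri T;
          f' \<in> Homs T X' Y'; g' \<in> Homs T Y' Z'; h' \<in> Homs T Z' (omap (susp T) X');
          is_iso T (src T f) X' u; is_iso T (src T g) Y' v; is_iso T (src T h) Z' w;
          v \<cdot> f = f' \<cdot> u; w \<cdot> g = g' \<cdot> v; amap (susp T) u \<cdot> h = h' \<cdot> w\<rbrakk>
          \<Longrightarrow> (f', g', h') \<in> tri T"
    and TR2: "\<lbrakk>f \<in> Homs T X Y; g \<in> Homs T Y Z; h \<in> Homs T Z (omap (susp T) X)\<rbrakk> \<Longrightarrow>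
          (f, g, h) \<in> tri T \<longleftrightarrow> (g, h, hom_neg T (amap (susp T) f)) \<in> tri T"
    and TR3: "\<lbrakk>(f, g, h) \<in> tri T; (f', g', h') \<in> tri T;
          u \<in> Homs T (src T f) (src T f'); v \<in> Homs T (src T g) (src T g'); v \<cdot> f = f' \<cdot> u\<rbrakk> \<Longrightarrow>
          \<exists>w \<in> Homs T (src T h) (src T h'). w \<cdot> g = g' \<cdot> v \<and> amap (susp T) u \<cdot> h = h' \<cdot> w"
    and TR4: "\<lbrakk>f \<in> Homs T X Y; g \<in> Homs T Y Z;
          (f, f', f'') \<in> tri T; (g, g', g'') \<in> tri T; (g \<cdot> f, h', h'') \<in> tri T\<rbrakk> \<Longrightarrow>
          \<exists>u \<in> Homs T (tgt T f') (tgt T h'). \<exists>v \<in> Homs T (tgt T h') (tgt T g').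
            (u, v, amap (susp T) f' \<cdot> g'') \<in> tri T \<and>
            u \<cdot> f' = h' \<cdot> g \<and> h'' \<cdot> u = f'' \<and> v \<cdot> h' = g' \<and> g'' \<cdot> v = amap (susp T) f \<cdot> h''"

text \<open>
  An object \<open>C\<close> is compact if for every small family the canonical map
  \<open>\<Oplus>\<^sub>i Hom(C, X\<^sub>i) \<rightarrow> Hom(C, \<Oplus>\<^sub>i X\<^sub>i)\<close>, sending \<open>(x\<^sub>i)\<^sub>i\<close> to the sum of the \<open>\<iota>\<^sub>i \<circ> x\<^sub>i\<close> over the
  support, is an isomorphism.
\<close>

definition compact_object :: "'v itself \<Rightarrow> ('o, 'm, 'z) preadd_scheme \<Rightarrow> 'o \<Rightarrow> bool" where
  "compact_object V T C \<longleftrightarrow> C \<in> obj T \<and>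
     (\<forall>(I :: 'v set) X S \<iota>. small V I \<longrightarrow> (\<forall>i \<in> I. X i \<in> obj T) \<longrightarrow> is_coproduct T I X S \<iota> \<longrightarrow>
        (\<lambda>x. finprod (HomG T C S) (\<lambda>i. \<iota> i \<cdot>\<^bsub>T\<^esub> x i) {i \<in> I. x i \<noteq> hom_zero T C (X i)})
          \<in> Group.iso (sum_group I (\<lambda>i. HomG T C (X i))) (HomG T C S))"

definition compacts :: "'v itself \<Rightarrow> ('o, 'm, 'z) preadd_scheme \<Rightarrow> ('o, 'm) preadd" where
  "compacts V T = full_sub T {C. compact_object V T C}"

text \<open>As usual for large categories, hom-sets are sets, i.e. small.\<close>

locale compactly_generated = triangulated_category T
  for V :: "'v itself" and T :: "('o, 'm, 'z) triang_scheme" (structure) +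
  assumes small_homs: "\<lbrakk>X \<in> obj T; Y \<in> obj T\<rbrakk> \<Longrightarrow> small V (Homs T X Y)"
    and small_coproducts: "\<lbrakk>small V (I :: 'v set); \<forall>i \<in> I. A i \<in> obj T\<rbrakk>
                             \<Longrightarrow> \<exists>S \<iota>. is_coproduct T I A S \<iota>"
    and compact_generators: "\<exists>\<G>. small V \<G> \<and> (\<forall>C \<in> \<G>. compact_object V T C) \<and>
          (\<forall>X \<in> obj T. (\<forall>C \<in> \<G>. Homs T C X = {hom_zero T C X}) \<longrightarrow> is_zero_object T X)"


section \<open>Purity\<close>

text \<open>The restricted Yoneda functor \<open>X \<mapsto> Hom(-, X)\<close> restricted to compact objects.\<close>

definition yon :: "('o, 'm, 'z) preadd_scheme \<Rightarrow> 'o \<Rightarrow> ('o, 'm, 'v) abmod" where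
  "yon T X =
     \<lparr>omap = (\<lambda>C. ab_copy (HomG T C X)),
      amap = (\<lambda>c. ab_copy_hom (HomG T (tgt T c) X) (HomG T (src T c) X) (\<lambda>f. f \<cdot>\<^bsub>T\<^esub> c))\<rparr>"

definition yon_arr :: "('o, 'm, 'z) preadd_scheme \<Rightarrow> 'm \<Rightarrow> ('o, 'm, 'v) abmod_arr" where
  "yon_arr T f =
     (yon T (src T f), yon T (tgt T f),
      \<lambda>C \<in> obj (compacts TYPE('v) T).
        ab_copy_hom (HomG T C (src T f)) (HomG T C (tgt T f)) (\<lambda>g. f \<cdot>\<^bsub>T\<^esub> g))"

definition pure_mono :: "'v itself \<Rightarrow> ('o, 'm, 'z) triang_scheme \<Rightarrow> 'm \<Rightarrow> bool" where
  "pure_mono V T f \<longleftrightarrow>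
     (\<exists>g h. (f, g, h) \<in> tri T \<and>
        mod_short_exact (compacts V T) (yon_arr T f :: ('o, 'm, 'v) abmod_arr) (yon_arr T g))"

definition pure_injective :: "'v itself \<Rightarrow> ('o, 'm, 'z) preadd_scheme \<Rightarrow> 'o \<Rightarrow> bool" where
  "pure_injective V T X \<longleftrightarrow> X \<in> obj T \<and> injective_object (Mod_cat V (compacts V T)) (yon T X)"


section \<open>Duality triples\<close>

text \<open>
  The opposite of a triangulated category has suspension \<open>\<Sigma>\<^sup>-\<^sup>1\<close>.  To avoid choosing an inverse
  of \<open>\<Sigma>\<close>, the natural isomorphism \<open>Q\<Sigma>\<^sup>-\<^sup>1 \<cong> \<Sigma>Q\<close> that is part of exactness is given as
  \<open>\<phi>\<^sub>X : QX \<cong> \<Sigma>Q\<Sigma>X\<close>.  The triangle \<open>X \<rightarrow> Y \<rightarrow> Z \<rightarrow> \<Sigma>X\<close> is then sent to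
  \<open>QZ \<rightarrow> QY \<rightarrow> QX \<rightarrow> \<Sigma>QZ\<close>; the sign convention for the opposite triangulation is immaterial,
  because it can be absorbed in \<open>\<phi>\<close>.
\<close>

definition exact_contravariant ::
  "('o, 'm, 'z) triang_scheme \<Rightarrow> ('p, 'n, 'w) triang_scheme \<Rightarrow> ('o, 'm, 'p, 'n) fctr \<Rightarrow> bool" where
  "exact_contravariant T U Q \<longleftrightarrow> additive_functor (op_cat T) U Q \<and>
     (\<exists>\<phi>. nat_iso (op_cat T) U Q (comp_fctr (susp U) (comp_fctr Q (susp T))) \<phi> \<and>
        (\<forall>f g h. (f, g, h) \<in> tri T \<longrightarrow>
           (amap Q g, amap Q f, amap (susp U) (amap Q h) \<cdot>\<^bsub>U\<^esub> \<phi> (src T f)) \<in> tri U))"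

definition coproducts_to_products ::
  "'v itself \<Rightarrow> ('o, 'm, 'z) preadd_scheme \<Rightarrow> ('p, 'n, 'w) preadd_scheme
     \<Rightarrow> ('o, 'm, 'p, 'n) fctr \<Rightarrow> bool" where
  "coproducts_to_products V T U Q \<longleftrightarrow>
     (\<forall>(I :: 'v set) X S \<iota>. small V I \<longrightarrow> (\<forall>i \<in> I. X i \<in> obj T) \<longrightarrow> is_coproduct T I X S \<iota> \<longrightarrow>
        (\<exists>\<pi>. is_product U I (\<lambda>i. omap Q (X i)) (omap Q S) \<pi>))"

text \<open>The two contravariant functors denoted by the same letter in the literature are
  \<open>Q\<close> and \<open>Q'\<close>; likewise for \<open>D\<close> and \<open>D'\<close> below.\<close>

definition duality_triple ::
  "'v itself \<Rightarrow> ('o1, 'm1, 'z1) triang_scheme \<Rightarrow> ('o2, 'm2, 'z2) triang_scheme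
     \<Rightarrow> ('o1, 'm1, 'o2, 'm2) fctr \<Rightarrow> ('o2, 'm2, 'o1, 'm1) fctr \<Rightarrow> bool" where
  "duality_triple V T U Q Q' \<longleftrightarrow>
     compactly_generated V T \<and> compactly_generated V U \<and>
     exact_contravariant T U Q \<and> exact_contravariant U T Q' \<and>
     (\<forall>X \<in> obj T. pure_injective V U (omap Q X)) \<and>
     (\<forall>Y \<in> obj U. pure_injective V T (omap Q' Y)) \<and>
     (\<exists>i j. nat_trans T T id_fctr (comp_fctr Q' Q) i \<and> (\<forall>X \<in> obj T. pure_mono V T (i X)) \<and>
            nat_trans U U id_fctr (comp_fctr Q Q') j \<and> (\<forall>Y \<in> obj U. pure_mono V U (j Y)) \<and>
            (\<forall>X \<in> obj T. amap Q (i X) \<cdot>\<^bsub>U\<^esub> j (omap Q X) = ident U (omap Q X)) \<and>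
            (\<forall>Y \<in> obj U. amap Q' (j Y) \<cdot>\<^bsub>T\<^esub> i (omap Q' Y) = ident T (omap Q' Y))) \<and>
     coproducts_to_products V T U Q \<and> coproducts_to_products V U T Q'"

text \<open>
  The isomorphisms \<open>Hom\<^sub>\<int>(Hom\<^sub>T(C, X), \<rat>/\<int>) \<cong> Hom\<^sub>U(DC, QX)\<close> for compact \<open>C\<close> and arbitrary \<open>X\<close>, natural
  in both variables.
\<close>

definition AGJ_formula ::
  "'v itself \<Rightarrow> ('o, 'm, 'z) preadd_scheme \<Rightarrow> ('p, 'n, 'w) preadd_scheme
     \<Rightarrow> ('o, 'm, 'p, 'n) fctr \<Rightarrow> ('o, 'm, 'p, 'n) fctr \<Rightarrow> bool" where
  "AGJ_formula V T U Q D \<longleftrightarrow>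
     (\<exists>\<theta>. (\<forall>C \<in> obj (compacts V T). \<forall>X \<in> obj T.
             \<theta> C X \<in> Group.iso (hom_group (HomG T C X) QZ) (HomG U (omap D C) (omap Q X))) \<and>
          (\<forall>c \<in> arr (compacts V T). \<forall>X \<in> obj T.
             \<forall>\<xi> \<in> carrier (hom_group (HomG T (src T c) X) QZ).
               \<theta> (tgt T c) X (\<lambda>g \<in> Homs T (tgt T c) X. \<xi> (g \<cdot>\<^bsub>T\<^esub> c))
                 = \<theta> (src T c) X \<xi> \<cdot>\<^bsub>U\<^esub> amap D c) \<and>
          (\<forall>C \<in> obj (compacts V T). \<forall>x \<in> arr T.
             \<forall>\<xi> \<in> carrier (hom_group (HomG T C (tgt T x)) QZ).
               \<theta> C (src T x) (\<lambda>g \<in> Homs T C (src T x). \<xi> (x \<cdot>\<^bsub>T\<^esub> g))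
                 = amap Q x \<cdot>\<^bsub>U\<^esub> \<theta> C (tgt T x) \<xi>))"

text \<open>\<open>D\<close> is regarded as a covariant functor from the compacts of \<open>T\<close> to the opposite of those
  of \<open>U\<close>, and \<open>D'\<close> as one in the other direction.\<close>

definition AGJ_duality_triple ::
  "'v itself \<Rightarrow> ('o1, 'm1, 'z1) triang_scheme \<Rightarrow> ('o2, 'm2, 'z2) triang_scheme
     \<Rightarrow> ('o1, 'm1, 'o2, 'm2) fctr \<Rightarrow> ('o2, 'm2, 'o1, 'm1) fctr
     \<Rightarrow> ('o1, 'm1, 'o2, 'm2) fctr \<Rightarrow> ('o2, 'm2, 'o1, 'm1) fctr \<Rightarrow> bool" where
  "AGJ_duality_triple V T U Q Q' D D' \<longleftrightarrow>
     duality_triple V T U Q Q' \<and>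
     adjoint_equivalence (compacts V T) (op_cat (compacts V U)) D D' \<and>
     AGJ_formula V T U Q D \<and> AGJ_formula V U T Q' D'"

text \<open>
  The object part of the contravariant functor \<open>\<partial>\<close>, \<open>\<partial>f = Hom\<^sub>\<int>(f(D(-)), \<rat>/\<int>)\<close>.  The compact
  objects at which \<open>\<partial>f\<close> is evaluated are those of \<open>U\<close>, and \<open>D\<close> sends them to compacts of \<open>T\<close>.
\<close>

definition dual_mod ::
  "('p, 'n, 'w) preadd_scheme \<Rightarrow> ('p, 'n, 'o, 'm) fctr \<Rightarrow> ('o, 'm, 'v) abmod \<Rightarrow> ('p, 'n, 'v) abmod" where
  "dual_mod U D f =
     \<lparr>omap = (\<lambda>C. ab_copy (hom_group (omap f (omap D C)) QZ)),
      amap = (\<lambda>c. ab_copy_hom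
                (hom_group (omap f (omap D (tgt U c))) QZ)
                (hom_group (omap f (omap D (src U c))) QZ)
                (\<lambda>\<xi>. compose (carrier (omap f (omap D (src U c)))) \<xi> (snd (snd (amap f (amap D c))))))\<rparr>"


section \<open>Duality pairs\<close>

definition closed_finite_coproducts :: "('o, 'm, 'z) preadd_scheme \<Rightarrow> 'o set \<Rightarrow> bool" where
  "closed_finite_coproducts C \<Y> \<longleftrightarrow>
     (\<forall>(I :: nat set) X S \<iota>. finite I \<and> (\<forall>i \<in> I. X i \<in> \<Y>) \<and> is_coproduct C I X S \<iota> \<longrightarrow> S \<in> \<Y>)"

definition closed_retracts :: "('o, 'm, 'z) preadd_scheme \<Rightarrow> 'o set \<Rightarrow> bool" where
  "closed_retracts C \<Y> \<longleftrightarrow>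
     (\<forall>Y \<in> \<Y>. \<forall>M \<in> obj C. \<forall>s \<in> Homs C M Y. \<forall>r \<in> Homs C Y M. r \<cdot>\<^bsub>C\<^esub> s = ident C M \<longrightarrow> M \<in> \<Y>)"

text \<open>
  Only the action on objects of the duality functor matters.  The notion is used both for
  \<open>(T, U, Q)\<close> and for \<open>(Mod(T\<^sup>c), Mod(U\<^sup>c), \<partial>)\<close>; in the module categories finite coproducts are
  the finite direct sums and retracts are the direct summands.
\<close>

definition duality_pair ::
  "('o, 'm, 'z) preadd_scheme \<Rightarrow> ('p, 'n, 'w) preadd_scheme \<Rightarrow> ('o \<Rightarrow> 'p)
     \<Rightarrow> 'o set \<Rightarrow> 'p set \<Rightarrow> bool" where
  "duality_pair C D q \<X> \<Y> \<longleftrightarrow> \<X> \<subseteq> obj C \<and> \<Y> \<subseteq> obj D \<and>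
     (\<forall>M \<in> obj C. M \<in> \<X> \<longleftrightarrow> q M \<in> \<Y>) \<and> closed_finite_coproducts D \<Y> \<and> closed_retracts D \<Y>"

definition symmetric_duality_pair ::
  "('o, 'm, 'z) preadd_scheme \<Rightarrow> ('p, 'n, 'w) preadd_scheme \<Rightarrow> ('o \<Rightarrow> 'p) \<Rightarrow> ('p \<Rightarrow> 'o)
     \<Rightarrow> 'o set \<Rightarrow> 'p set \<Rightarrow> bool" where
  "symmetric_duality_pair C D q q' \<X> \<Y> \<longleftrightarrow> duality_pair C D q \<X> \<Y> \<and> duality_pair D C q' \<Y> \<X>"

definition represented_part :: "('o, 'm, 'z) preadd_scheme \<Rightarrow> ('o, 'm, 'v) abmod set \<Rightarrow> 'o set" where
  "represented_part T \<A> = {X \<in> obj T. yon T X \<in> \<A>}"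

end

theory Submission
  imports Defs "HOL-Algebra.Free_Abelian_Groups" "HOL-Library.Countable_Set_Type"
begin

text \<open>Write y for the restricted Yoneda functor and \<partial> for the dual of modules. Let
  \<A> consist of the modules f on the compacts of T such that \<partial>f is a retract of yY for
  some Y in \<Y>, and let \<B> be its mirror image (\<open>modules\<close>,
  \<open>pair_swap\<close>). Two facts about duals drive the proof. First, \<partial>(yX) is
  isomorphic to y(QX) (\<open>dual_represented\<close>): at a compact K of U the left side is
  Hom(Hom(D'K, X), Q/Z), the AGJ isomorphism turns it into Hom(DD'K, QX), and DD'K is isomorphic to
  K. Second, \<partial>f is a retract of \<partial>\<partial>\<partial>f, by a triangle identity for
  evaluation (\<open>triple_dual\<close>).

  If \<partial>f is a retract of yY, then \<partial>\<partial>f is a retract of y(Q'Y), and Q'Y is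
  in \<X>. If \<partial>\<partial>f is a retract of yX, then \<partial>f, being a retract of
  \<partial>\<partial>\<partial>f, is a retract of y(QX), and QX is in \<Y>. So f is in \<A> iff
  \<partial>f is in \<B> (\<open>modules_iff_dual\<close>). Closure under retracts is functoriality.
  For finite direct sums, endomorphisms of a dual that factor through yY with Y in \<Y> are closed
  under addition, because \<Y> has finite coproducts, and the identity of the dual of a direct sum
  is a finite sum of such endomorphisms (\<open>modules_closed_finite_coproducts\<close>).

  That X in \<X> puts yX in \<A> is the first fact. Conversely, let y(QX) be a retract of yY with Y
  in \<Y>. The unit Y -> QQ'Y is a pure monomorphism, so injectivity of y(QX) extends the retraction
  to y(QQ'Y), and QQ'Y is again in \<Y>. As QX and QQ'Y are pure injective, section and retraction
  are induced by morphisms of U (\<open>yon_full_on_pure_injectives\<close>). Their composite acts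
  as the identity on generators and is therefore invertible
  (\<open>is_iso_if_identity_on_generators\<close>), so QX is a retract of QQ'Y
  (\<open>retract_lift\<close>). Hence QX is in \<Y> and X is in \<X>
  (\<open>represented_modules\<close>).

  It remains that every \<phi> : yK -> yE with E pure injective is induced by a morphism. Cover K by
  p : S -> K, with S a coproduct of generators, and let c : K -> K' be the cone. On S, \<phi> is
  induced by a morphism, by Yoneda on the summands. It descends to some a : K -> E, because on the
  fibre of p it is phantom, and phantoms into pure injectives vanish. Now \<phi> - ya kills the
  kernel of yc and extends to \<phi>' on yK' (\<open>lift_step\<close>). Iteration yields a sequence
  of objects whose transition maps vanish on generators. On the coproduct of the sequence, 1 - shift
  fixes all morphisms from generators, so it is invertible (\<open>telescope\<close>), and its
  inverse sums the corrections a to one morphism (\<open>telescope_lift\<close>). Phantoms vanish by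
  the same device, applied to a compatible family of phantoms along such a sequence
  (\<open>phantom_step\<close>, \<open>telescope_vanishing\<close>).\<close>

section \<open>Smallness\<close>

lemma small_subset: "small V B \<Longrightarrow> A \<subseteq> B \<Longrightarrow> small V A"
  unfolding small_def using card_of_mono1 ordLeq_ordLess_trans by blast

lemma small_image: "small V A \<Longrightarrow> small V (f ` A)"
  unfolding small_def using card_of_image ordLeq_ordLess_trans by blast

lemma small_inj_on: "small V B \<Longrightarrow> inj_on f A \<Longrightarrow> f ` A \<subseteq> B \<Longrightarrow> small V A"
  unfolding small_def using card_of_ordLeq[of A B] by (meson ordLeq_ordLess_trans)

lemma inj_on_label:
  assumes "small (V :: 'v itself) A"
  shows "inj_on (label A :: 'a \<Rightarrow> 'v) A"
proof -
  have "|A| \<le>o |UNIV :: 'v set|"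
    using assms unfolding small_def by (rule ordLess_imp_ordLeq)
  then have "\<exists>e :: 'a \<Rightarrow> 'v. inj_on e A"
    using card_of_ordLeq[of A "UNIV :: 'v set"] by blast
  then show ?thesis
    unfolding label_def by (rule someI_ex)
qed

lemma unlabel_label [simp]:
  "small TYPE('v) A \<Longrightarrow> x \<in> A \<Longrightarrow> unlabel A (label A x :: 'v) = x"
  unfolding unlabel_def by (simp add: inj_on_label)

lemma small_countable:
  assumes "grothendieck_universe V" "countable A"
  shows "small V A"
  using assms countable_card_le_natLeq ordLeq_ordLess_trans
  unfolding small_def grothendieck_universe_def by blast

text \<open>An infinite regular cardinal is stable: fewer than that many sets of smaller cardinality
  have a union of smaller cardinality.\<close>

lemma small_UNION:
  assumes "grothendieck_universe (V :: 'v itself)" "small V I" "\<And>i. i \<in> I \<Longrightarrow> small V (A i)"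
  shows "small V (\<Union>i\<in>I. A i)"
proof -
  have "infinite (UNIV :: 'v set)"
  proof
    assume "finite (UNIV :: 'v set)"
    then have "|UNIV :: 'v set| <o natLeq"
      using finite_iff_ordLess_natLeq by blast
    moreover have "natLeq <o |UNIV :: 'v set|"
      using assms(1) unfolding grothendieck_universe_def by blast
    ultimately show False
      using not_ordLess_ordLeq ordLess_imp_ordLeq by blast
  qed
  then have "stable |UNIV :: 'v set|"
    using assms(1) regularCard_stable[of "|UNIV :: 'v set|"]
    unfolding grothendieck_universe_def by (auto simp: Field_card_of card_of_Card_order)
  then show ?thesis
    using assms stable_UNION unfolding small_def by blast
qed

lemma small_Times:
  assumes "grothendieck_universe V" "small V A" "small V B"
  shows "small V (A \<times> B)"
proof -
  have eq: "A \<times> B = (\<Union>a\<in>A. Pair a ` B)" by auto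
  show ?thesis
    unfolding eq by (rule small_UNION[OF assms(1,2)]) (rule small_image[OF assms(3)])
qed

text \<open>The universe controls power sets only over \<open>'v\<close>. A small set over another
  type is first copied into \<open>'v\<close>, and taking images along the injective label is
  injective on subsets.\<close>

lemma small_Pow:
  assumes "grothendieck_universe (V :: 'v itself)" "small V A"
  shows "small V (Pow A)"
proof -
  let ?e = "label A :: 'a \<Rightarrow> 'v"
  have inj: "inj_on ?e A" using inj_on_label assms(2) by blast
  have "small V (Pow (?e ` A))"
    using assms small_image[of V A ?e] unfolding grothendieck_universe_def small_def by blast
  moreover have "inj_on ((`) ?e) (Pow A)"
    using inj by (rule inj_on_image_Pow)
  ultimately show ?thesis
    by (rule small_inj_on) auto
qed

text \<open>Functions embed into the power set of the product by their graphs; extensionality makes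
  the graph over A determine the function. This keeps character groups small.\<close>

lemma small_extensional_funcset:
  assumes "grothendieck_universe V" "small V A" "small V B"
    and F: "F \<subseteq> (A \<rightarrow> B) \<inter> extensional A"
  shows "small V F"
proof (rule small_inj_on)
  show "small V (Pow (A \<times> B))"
    using assms by (intro small_Pow small_Times)
  let ?gr = "\<lambda>f. {(x, f x) | x. x \<in> A}"
  show "inj_on ?gr F"
  proof (rule inj_onI)
    fix f g assume fg: "f \<in> F" "g \<in> F" "?gr f = ?gr g"
    show "f = g"
    proof (rule extensionalityI)
      show "f \<in> extensional A" "g \<in> extensional A" using F fg by auto
      fix x assume "x \<in> A"
      then have "(x, f x) \<in> ?gr g" using fg(3) by blast
      then show "f x = g x" by auto
    qed
  qed
  show "?gr ` F \<subseteq> Pow (A \<times> B)" using F by auto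
qed


section \<open>Arithmetic of morphisms, zero objects and coproducts in preadditive
  categories\<close>

section \<open>Preadditive categories\<close>

lemma HomG_simps [simp]:
  "carrier (HomG C X Y) = Homs C X Y" "mult (HomG C X Y) = hom_add C"
  "one (HomG C X Y) = hom_zero C X Y"
  by (simp_all add: HomG_def)

lemma full_sub_simps [simp]:
  "obj (full_sub C S) = S" "src (full_sub C S) = src C" "tgt (full_sub C S) = tgt C"
  "ident (full_sub C S) = ident C" "cmp (full_sub C S) = cmp C"
  "hom_add (full_sub C S) = hom_add C" "hom_zero (full_sub C S) = hom_zero C"
  by (simp_all add: full_sub_def)

lemma arr_full_sub: "arr (full_sub C S) = {f \<in> arr C. src C f \<in> S \<and> tgt C f \<in> S}"
  by (simp add: full_sub_def)

lemma Homs_full_sub: "Homs (full_sub C S) X Y = (if X \<in> S \<and> Y \<in> S then Homs C X Y else {})"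
  by (auto simp: Homs_def full_sub_def)

lemma op_cat_simps [simp]:
  "obj (op_cat C) = obj C" "arr (op_cat C) = arr C" "src (op_cat C) = tgt C"
  "tgt (op_cat C) = src C" "ident (op_cat C) = ident C" "cmp (op_cat C) g f = cmp C f g"
  "hom_add (op_cat C) = hom_add C" "hom_zero (op_cat C) X Y = hom_zero C Y X"
  by (simp_all add: op_cat_def)

lemma Homs_op_cat [simp]: "Homs (op_cat C) X Y = Homs C Y X"
  by (auto simp: Homs_def)

lemma HomG_op_cat: "HomG (op_cat C) X Y = HomG C Y X"
  by (simp add: HomG_def)

lemma op_cat_op_cat [simp]: "op_cat (op_cat (C :: ('o, 'm) preadd)) = C"
  by (simp add: op_cat_def)

lemma arr_in_Homs: "f \<in> arr C \<Longrightarrow> f \<in> Homs C (src C f) (tgt C f)"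
  by (simp add: Homs_def)

lemma HomsD: "f \<in> Homs C X Y \<Longrightarrow> f \<in> arr C \<and> src C f = X \<and> tgt C f = Y"
  by (simp add: Homs_def)

notation hom_add (infixl \<open>\<uplus>\<index>\<close> 65)

lemma preadditive_category_op_cat:
  assumes "preadditive_category C"
  shows "preadditive_category (op_cat C)"
proof -
  interpret preadditive_category C by fact
  show ?thesis
    by (rule preadditive_category.intro)
      (auto simp: src_obj tgt_obj ident_hom cmp_hom ident_left ident_right cmp_assoc HomG_op_cat
        hom_comm_group cmp_add_left cmp_add_right)
qed

lemma preadditive_category_full_sub:
  assumes "preadditive_category C" "S \<subseteq> obj C"
  shows "preadditive_category (full_sub C S)"
proof -
  interpret preadditive_category C by fact
  have "HomG (full_sub C S) X Y = HomG C X Y" if "X \<in> S" "Y \<in> S" for X Y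
    using that by (simp add: HomG_def Homs_full_sub)
  then have "comm_group (HomG (full_sub C S) X Y)" if "X \<in> S" "Y \<in> S" for X Y
    using that hom_comm_group assms(2) by (simp add: subset_iff)
  then show ?thesis
    using assms(2)
    by (intro preadditive_category.intro)
      (auto simp: arr_full_sub Homs_full_sub src_obj tgt_obj
        ident_hom cmp_hom ident_left ident_right cmp_assoc cmp_add_left cmp_add_right subset_iff split: if_splits)
qed

context preadditive_category
begin

text \<open>
  Take \<open>\<A>\<close> to be the class of all modules \<open>f\<close> such that \<open>\<partial>f\<close> is a retract of \<open>\<^bold>yY\<close> for some \<open>Y \<in> \<Y>\<close>, and
  \<open>\<B>\<close> the class obtained by exchanging the two sides.  The AGJ isomorphism gives \<open>\<partial>\<^bold>yX \<cong> \<^bold>yQX\<close>, and \<open>\<partial>f\<close> is a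
  retract of \<open>\<partial>\<partial>\<partial>f\<close> by a triangle identity; this yields \<open>f \<in> \<A>\<close> iff \<open>\<partial>f \<in> \<B>\<close>, and \<open>X \<in> \<X>\<close> implies
  \<open>\<^bold>yX \<in> \<A>\<close>.  Conversely, if \<open>\<^bold>yX \<in> \<A>\<close>, then \<open>\<^bold>yQX\<close> is a retract of \<open>\<^bold>yY\<close> with \<open>Y \<in> \<Y>\<close>, and the retraction must be
  lifted to the triangulated category.

  This is possible because every map \<open>\<phi> : \<^bold>yK \<rightarrow> \<^bold>yE\<close> with \<open>E\<close> pure injective is induced by a morphism, which
  is shown without Brown representability.  Let \<open>p : \<Oplus>G\<^sub>i \<rightarrow> K\<close> be a cover by a set of generators closed under
  desuspension, with cone \<open>c : K \<rightarrow> K'\<close>.  Then \<open>\<phi> = \<^bold>ya + \<phi>' \<^bold>yc\<close> for some \<open>a : K \<rightarrow> E\<close> and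
  \<open>\<phi>' : \<^bold>yK' \<rightarrow> \<^bold>yE\<close>, and \<open>c\<close> vanishes on generators.  Iteration gives a sequence \<open>K\<^sub>0 \<rightarrow> K\<^sub>1 \<rightarrow> \<dots>\<close> on which
  \<open>1 - shift\<close> is an automorphism of \<open>\<Oplus>K\<^sub>n\<close>, because it is the identity on morphisms from generators;
  its inverse assembles the \<open>a\<^sub>n\<close> to a morphism inducing \<open>\<phi>\<close>.  The same device shows that phantom maps
  into \<open>E\<close> vanish, which is needed to produce \<open>a\<close>.
\<close>

lemma Homs_obj: "f \<in> Homs C X Y \<Longrightarrow> X \<in> obj C \<and> Y \<in> obj C"
  using src_obj tgt_obj by (auto simp: Homs_def)

lemma HomG_comm_group: "f \<in> Homs C X Y \<Longrightarrow> comm_group (HomG C X Y)"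
  using Homs_obj hom_comm_group by blast

lemma zero_hom: "X \<in> obj C \<Longrightarrow> Y \<in> obj C \<Longrightarrow> hom_zero C X Y \<in> Homs C X Y"
  using monoid.one_closed[of "HomG C X Y"] comm_group.axioms(2) group.is_monoid hom_comm_group
  by fastforce

lemma add_hom: "f \<in> Homs C X Y \<Longrightarrow> g \<in> Homs C X Y \<Longrightarrow> f \<uplus> g \<in> Homs C X Y"
  using monoid.m_closed[of "HomG C X Y"] comm_group.axioms(2) group.is_monoid HomG_comm_group
  by fastforce

lemma neg_hom:
  assumes "f \<in> Homs C X Y"
  shows "hom_neg C f \<in> Homs C X Y"
proof -
  interpret comm_group "HomG C X Y" using assms by (rule HomG_comm_group)
  show ?thesis using assms inv_closed by (auto simp: hom_neg_def dest: HomsD)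
qed

lemma add_assoc:
  assumes "f \<in> Homs C X Y" "g \<in> Homs C X Y" "h \<in> Homs C X Y"
  shows "f \<uplus> g \<uplus> h = f \<uplus> (g \<uplus> h)"
proof -
  interpret comm_group "HomG C X Y" using assms(1) by (rule HomG_comm_group)
  show ?thesis using assms m_assoc by simp
qed

lemma add_commute:
  assumes "f \<in> Homs C X Y" "g \<in> Homs C X Y"
  shows "f \<uplus> g = g \<uplus> f"
proof -
  interpret comm_group "HomG C X Y" using assms(1) by (rule HomG_comm_group)
  show ?thesis using assms m_comm by simp
qed

lemma add_zero:
  assumes "f \<in> Homs C X Y"
  shows "f \<uplus> hom_zero C X Y = f" "hom_zero C X Y \<uplus> f = f"
proof -
  interpret comm_group "HomG C X Y" using assms(1) by (rule HomG_comm_group)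
  show "f \<uplus> hom_zero C X Y = f" "hom_zero C X Y \<uplus> f = f" using assms r_one l_one by simp_all
qed

lemma add_neg:
  assumes "f \<in> Homs C X Y"
  shows "f \<uplus> hom_neg C f = hom_zero C X Y" "hom_neg C f \<uplus> f = hom_zero C X Y"
proof -
  interpret comm_group "HomG C X Y" using assms(1) by (rule HomG_comm_group)
  show "f \<uplus> hom_neg C f = hom_zero C X Y" "hom_neg C f \<uplus> f = hom_zero C X Y"
    using assms r_inv[of f] l_inv[of f] by (auto simp: hom_neg_def dest: HomsD)
qed

lemma add_left_cancel:
  assumes "f \<in> Homs C X Y" "g \<in> Homs C X Y" "h \<in> Homs C X Y" "f \<uplus> g = f \<uplus> h"
  shows "g = h"
proof -
  interpret comm_group "HomG C X Y" using assms(1) by (rule HomG_comm_group)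
  show ?thesis using assms Units_l_cancel[of f g h] Units_eq by simp
qed

lemma add_eq_zero_iff:
  assumes "f \<in> Homs C X Y" "g \<in> Homs C X Y"
  shows "f \<uplus> g = hom_zero C X Y \<longleftrightarrow> g = hom_neg C f"
  using assms add_left_cancel[OF assms(1) assms(2) neg_hom[OF assms(1)]] add_neg by auto

lemma neg_neg:
  assumes "f \<in> Homs C X Y"
  shows "hom_neg C (hom_neg C f) = f"
  using add_eq_zero_iff[OF neg_hom[OF assms] assms] add_neg(2)[OF assms] by simp

lemma diff_eq_zero_iff:
  assumes "f \<in> Homs C X Y" "g \<in> Homs C X Y"
  shows "f \<uplus> hom_neg C g = hom_zero C X Y \<longleftrightarrow> f = g"
  using add_eq_zero_iff[OF neg_hom[OF assms(2)] assms(1)] add_commute[OF assms(1) neg_hom[OF assms(2)]]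
    neg_neg[OF assms(2)] by simp

lemma add_diff_cancel:
  assumes "f \<in> Homs C X Y" "g \<in> Homs C X Y"
  shows "g \<uplus> (f \<uplus> hom_neg C g) = f"
  using add_commute[OF assms(1) neg_hom[OF assms(2)]] add_neg(1)[OF assms(2)] add_zero(2)[OF assms(1)]
    add_assoc[OF assms(2) neg_hom[OF assms(2)] assms(1)] by simp

lemma cmp_zero_left:
  assumes "f \<in> Homs C X Y" "Z \<in> obj C"
  shows "hom_zero C Y Z \<cdot> f = hom_zero C X Z"
proof -
  have z: "hom_zero C Y Z \<in> Homs C Y Z" using assms Homs_obj zero_hom by blast
  then have zf: "hom_zero C Y Z \<cdot> f \<in> Homs C X Z" using assms cmp_hom by blast
  have "hom_zero C Y Z \<cdot> f \<uplus> hom_zero C Y Z \<cdot> f = hom_zero C Y Z \<cdot> f \<uplus> hom_zero C X Z"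
    using cmp_add_left[OF assms(1) z z] add_zero(1)[OF z] add_zero(1)[OF zf] by simp
  then show ?thesis using add_left_cancel zf zero_hom Homs_obj[OF zf] by blast
qed

lemma cmp_zero_right:
  assumes "g \<in> Homs C Y Z" "X \<in> obj C"
  shows "g \<cdot> hom_zero C X Y = hom_zero C X Z"
proof -
  have z: "hom_zero C X Y \<in> Homs C X Y" using assms Homs_obj zero_hom by blast
  then have gz: "g \<cdot> hom_zero C X Y \<in> Homs C X Z" using assms cmp_hom by blast
  have "g \<cdot> hom_zero C X Y \<uplus> g \<cdot> hom_zero C X Y = g \<cdot> hom_zero C X Y \<uplus> hom_zero C X Z"
    using cmp_add_right[OF z z assms(1)] add_zero(1)[OF z] add_zero(1)[OF gz] by simp
  then show ?thesis using add_left_cancel gz zero_hom Homs_obj[OF gz] by blast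
qed

lemma cmp_neg_left:
  assumes "f \<in> Homs C X Y" "g \<in> Homs C Y Z"
  shows "hom_neg C g \<cdot> f = hom_neg C (g \<cdot> f)"
proof -
  have "g \<cdot> f \<uplus> hom_neg C g \<cdot> f = hom_zero C X Z"
    using cmp_add_left[OF assms neg_hom[OF assms(2)]] add_neg(1)[OF assms(2)]
      cmp_zero_left[OF assms(1)] Homs_obj[OF assms(2)] by simp
  then show ?thesis
    using add_eq_zero_iff cmp_hom[OF assms] cmp_hom[OF assms(1) neg_hom[OF assms(2)]] by blast
qed

lemma cmp_neg_right:
  assumes "f \<in> Homs C X Y" "g \<in> Homs C Y Z"
  shows "g \<cdot> hom_neg C f = hom_neg C (g \<cdot> f)"
proof -
  have "g \<cdot> f \<uplus> g \<cdot> hom_neg C f = hom_zero C X Z"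
    using cmp_add_right[OF assms(1) neg_hom[OF assms(1)] assms(2)] add_neg(1)[OF assms(1)]
      cmp_zero_right[OF assms(2)] Homs_obj[OF assms(1)] by simp
  then show ?thesis
    using add_eq_zero_iff cmp_hom[OF assms] cmp_hom[OF neg_hom[OF assms(1)] assms(2)] by blast
qed

lemma Homs_to_zero: "is_zero_object C Z \<Longrightarrow> f \<in> Homs C X Z \<Longrightarrow> f = hom_zero C X Z"
  using Homs_obj zero_hom unfolding is_zero_object_def by metis

lemma Homs_from_zero: "is_zero_object C Z \<Longrightarrow> f \<in> Homs C Z X \<Longrightarrow> f = hom_zero C Z X"
  using Homs_obj zero_hom unfolding is_zero_object_def by metis

lemma is_zero_objectI:
  assumes "Z \<in> obj C" "ident C Z = hom_zero C Z Z"
  shows "is_zero_object C Z"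
proof -
  have to: "f = hom_zero C X Z" if "f \<in> Homs C X Z" for f X
    using ident_left[OF that] cmp_zero_left[OF that assms(1)] assms(2) by simp
  have fro: "f = hom_zero C Z X" if "f \<in> Homs C Z X" for f X
    using ident_right[OF that] cmp_zero_right[OF that assms(1)] assms(2) by simp
  show ?thesis
    unfolding is_zero_object_def using to fro zero_hom assms(1) by metis
qed

lemma is_isoE:
  assumes "is_iso C X Y f"
  obtains g where "f \<in> Homs C X Y" "g \<in> Homs C Y X" "g \<cdot> f = ident C X" "f \<cdot> g = ident C Y"
  using assms unfolding is_iso_def by blast

lemma is_isoI:
  "f \<in> Homs C X Y \<Longrightarrow> g \<in> Homs C Y X \<Longrightarrow> g \<cdot> f = ident C X \<Longrightarrow> f \<cdot> g = ident C Y \<Longrightarrow> is_iso C X Y f"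
  unfolding is_iso_def by blast

lemma coproductD:
  assumes "is_coproduct C I X S \<iota>"
  shows "S \<in> obj C" "i \<in> I \<Longrightarrow> \<iota> i \<in> Homs C (X i) S"
  using assms unfolding is_coproduct_def by blast+

lemma coproduct_induced:
  assumes "is_coproduct C I X S \<iota>" "Y \<in> obj C" "\<And>i. i \<in> I \<Longrightarrow> f i \<in> Homs C (X i) Y"
  shows "\<exists>h \<in> Homs C S Y. \<forall>i \<in> I. h \<cdot> \<iota> i = f i"
  using assms unfolding is_coproduct_def by metis

lemma coproduct_eqI:
  assumes "is_coproduct C I X S \<iota>" "g \<in> Homs C S Y" "h \<in> Homs C S Y"
    and "\<And>i. i \<in> I \<Longrightarrow> g \<cdot> \<iota> i = h \<cdot> \<iota> i"
  shows "g = h"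
proof -
  have "\<forall>i\<in>I. h \<cdot> \<iota> i \<in> Homs C (X i) Y"
    using coproductD(2)[OF assms(1)] cmp_hom[OF _ assms(3)] by blast
  then have "\<exists>!k. k \<in> Homs C S Y \<and> (\<forall>i\<in>I. k \<cdot> \<iota> i = h \<cdot> \<iota> i)"
    using assms(1) Homs_obj[OF assms(3)] unfolding is_coproduct_def by simp
  then show ?thesis using assms(2-4) by (auto elim!: ex1E)
qed

text \<open>Zero morphisms split every coproduct: the Kronecker delta family at j induces a map out
  of S that reads off the j-th coordinate. Infinite index sets are covered too, which compactness
  and the telescopes rely on.\<close>

lemma coproduct_projections:
  assumes cop: "is_coproduct C I X S \<iota>" and X: "\<And>i. i \<in> I \<Longrightarrow> X i \<in> obj C"
  obtains \<pi> where "\<And>j. j \<in> I \<Longrightarrow> \<pi> j \<in> Homs C S (X j)"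
    "\<And>j. j \<in> I \<Longrightarrow> \<pi> j \<cdot> \<iota> j = ident C (X j)"
    "\<And>i j. i \<in> I \<Longrightarrow> j \<in> I \<Longrightarrow> i \<noteq> j \<Longrightarrow> \<pi> j \<cdot> \<iota> i = hom_zero C (X i) (X j)"
proof -
  let ?d = "\<lambda>j i. if i = j then ident C (X j) else hom_zero C (X i) (X j)"
  define \<pi> where "\<pi> j = (SOME p. p \<in> Homs C S (X j) \<and> (\<forall>i\<in>I. p \<cdot> \<iota> i = ?d j i))" for j
  have "\<pi> j \<in> Homs C S (X j) \<and> (\<forall>i\<in>I. \<pi> j \<cdot> \<iota> i = ?d j i)" if "j \<in> I" for j
  proof -
    have "?d j i \<in> Homs C (X i) (X j)" if "i \<in> I" for i
      using that \<open>j \<in> I\<close> X ident_hom zero_hom by simp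
    then obtain p where "p \<in> Homs C S (X j) \<and> (\<forall>i\<in>I. p \<cdot> \<iota> i = ?d j i)"
      using coproduct_induced[OF cop X[OF \<open>j \<in> I\<close>], of "?d j"] by blast
    then show ?thesis unfolding \<pi>_def by (rule someI)
  qed
  then show ?thesis using that[of \<pi>] by simp
qed

end


section \<open>Exact sequences, fibres and vanishing cones in triangulated categories\<close>

section \<open>Triangulated categories\<close>

context additive_functor
begin

lemma amap_zero:
  assumes "X \<in> obj C" "Y \<in> obj C"
  shows "amap F (hom_zero C X Y) = hom_zero D (omap F X) (omap F Y)"
proof -
  have z: "hom_zero C X Y \<in> Homs C X Y" using assms C.zero_hom by blast
  have d: "amap F (hom_zero C X Y) \<in> Homs D (omap F X) (omap F Y)" using z by (rule amap_hom)
  have o: "hom_zero D (omap F X) (omap F Y) \<in> Homs D (omap F X) (omap F Y)"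
    using D.zero_hom D.Homs_obj[OF d] by blast
  show ?thesis
    using amap_add[OF z z] C.add_zero(1)[OF z] D.add_zero(1)[OF d] D.add_left_cancel[OF d d o] by simp
qed

lemma amap_neg:
  assumes "f \<in> Homs C X Y"
  shows "amap F (hom_neg C f) = hom_neg D (amap F f)"
  using amap_add[OF assms C.neg_hom[OF assms]] C.add_neg(1)[OF assms] C.Homs_obj[OF assms] amap_zero
    D.add_eq_zero_iff[OF amap_hom[OF assms] amap_hom[OF C.neg_hom[OF assms]]] by simp

end

context triangulated_category
begin

abbreviation susp_obj (\<open>\<Sigma>\<^sub>o\<close>) where "\<Sigma>\<^sub>o \<equiv> omap (susp T)"
abbreviation susp_arr (\<open>\<Sigma>\<^sub>a\<close>) where "\<Sigma>\<^sub>a \<equiv> amap (susp T)"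

sublocale susp: additive_functor T T "susp T"
  by (rule susp_additive)

lemma susp_inj:
  assumes "f \<in> Homs T X Y" "g \<in> Homs T X Y" "\<Sigma>\<^sub>a f = \<Sigma>\<^sub>a g"
  shows "f = g"
  using inj_onD[OF bij_betw_imp_inj_on[OF susp_fully_faithful] assms(3,1,2)] Homs_obj[OF assms(1)]
  by simp

lemma susp_full:
  assumes "f \<in> Homs T (\<Sigma>\<^sub>o X) (\<Sigma>\<^sub>o Y)" "X \<in> obj T" "Y \<in> obj T"
  obtains g where "g \<in> Homs T X Y" "\<Sigma>\<^sub>a g = f"
  using bij_betw_imp_surj_on[OF susp_fully_faithful[OF assms(2,3)]] assms(1) by (metis imageE)

lemma zero_object_exists: obtains Z where "is_zero_object T Z"
proof -
  obtain S \<iota> where S: "is_coproduct T {} (\<lambda>_ :: nat. undefined) S \<iota>"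
    using finite_coproducts[of "{}" "\<lambda>_. undefined"] by blast
  then have "S \<in> obj T" by (rule coproductD)
  then have "ident T S = hom_zero T S S"
    using coproduct_eqI[OF S ident_hom zero_hom] by blast
  then show ?thesis using that is_zero_objectI \<open>S \<in> obj T\<close> by blast
qed

lemma is_zero_object_susp:
  assumes "is_zero_object T Z"
  shows "is_zero_object T (\<Sigma>\<^sub>o Z)"
proof (rule is_zero_objectI)
  have Z: "Z \<in> obj T" using assms unfolding is_zero_object_def by blast
  then show "\<Sigma>\<^sub>o Z \<in> obj T" by (rule susp.omap_obj)
  show "ident T (\<Sigma>\<^sub>o Z) = hom_zero T (\<Sigma>\<^sub>o Z) (\<Sigma>\<^sub>o Z)"
    using Homs_to_zero[OF assms ident_hom[OF Z]] susp.amap_ident[OF Z] susp.amap_zero[OF Z Z] by simp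
qed

lemma zero_objectD: "is_zero_object T Z \<Longrightarrow> Z \<in> obj T"
  unfolding is_zero_object_def by blast

lemma triE:
  assumes "(f, g, h) \<in> tri T" "f \<in> Homs T X Y"
  obtains Z where "g \<in> Homs T Y Z" "h \<in> Homs T Z (\<Sigma>\<^sub>o X)"
proof (rule that)
  have XY: "src T f = X" "tgt T f = Y" using assms(2) by (simp_all add: Homs_def)
  have gh: "g \<in> Homs T Y (src T h)" "h \<in> Homs T (tgt T g) (\<Sigma>\<^sub>o X)"
    using tri_arrows[OF assms(1)] unfolding XY by blast+
  then show "h \<in> Homs T (tgt T g) (\<Sigma>\<^sub>o X)" by blast
  show "g \<in> Homs T Y (tgt T g)" using gh(1) HomsD[OF gh(1)] by simp
qed

lemma tri_third:
  assumes "(f, g, h) \<in> tri T" "f \<in> Homs T X Y" "g \<in> Homs T Y Z"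
  shows "h \<in> Homs T Z (\<Sigma>\<^sub>o X)"
proof (rule triE[OF assms(1,2)])
  fix Z' assume "g \<in> Homs T Y Z'" "h \<in> Homs T Z' (\<Sigma>\<^sub>o X)"
  then show ?thesis using HomsD[OF assms(3)] by (simp add: Homs_def)
qed

lemma coneE:
  assumes "f \<in> Homs T X Y"
  obtains Z g h where "(f, g, h) \<in> tri T" "g \<in> Homs T Y Z" "h \<in> Homs T Z (\<Sigma>\<^sub>o X)"
proof -
  obtain g h where tri: "(f, g, h) \<in> tri T"
    using TR1_cone[of f] HomsD[OF assms] by auto
  show ?thesis by (rule triE[OF tri assms]) (rule that[OF tri])
qed

text \<open>\<open>TR3\<close> maps the triangle of the identity of X to the given one by the
  identity and f. The third component starts at a zero object, and g f factors through it.\<close>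

lemma tri_cmp_zero:
  assumes tri: "(f, g, h) \<in> tri T" and f: "f \<in> Homs T X Y" and g: "g \<in> Homs T Y Z"
  shows "g \<cdot> f = hom_zero T X Z"
proof -
  have h: "h \<in> Homs T Z (\<Sigma>\<^sub>o X)"
    using tri_third[OF tri f g] .
  obtain O' where O': "is_zero_object T O'" by (rule zero_object_exists)
  note X = Homs_obj[OF f]
  have z: "hom_zero T X O' \<in> Homs T X O'" using zero_objectD[OF O'] X zero_hom by blast
  have z': "hom_zero T O' (\<Sigma>\<^sub>o X) \<in> Homs T O' (\<Sigma>\<^sub>o X)"
    using zero_objectD[OF O'] X susp.omap_obj zero_hom by blast
  have "\<exists>w \<in> Homs T (src T (hom_zero T O' (\<Sigma>\<^sub>o X))) (src T h).
      w \<cdot> hom_zero T X O' = g \<cdot> f \<and> \<Sigma>\<^sub>a (ident T X) \<cdot> hom_zero T O' (\<Sigma>\<^sub>o X) = h \<cdot> w"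
    using X ident_hom[of X] ident_right[OF f] f HomsD[OF f] HomsD[OF ident_hom[of X]] HomsD[OF z]
      HomsD[OF g]
    by (intro TR3[OF TR1_ident[OF _ O'] tri]) auto
  then obtain w where "w \<in> Homs T O' Z" "w \<cdot> hom_zero T X O' = g \<cdot> f"
    using HomsD[OF z'] HomsD[OF h] by auto
  then show ?thesis using cmp_zero_right X by metis
qed

lemma tri_rotate:
  assumes "(f, g, h) \<in> tri T" "f \<in> Homs T X Y"
  shows "(g, h, hom_neg T (\<Sigma>\<^sub>a f)) \<in> tri T"
  by (rule triE[OF assms]) (use TR2[OF assms(2)] assms(1) in blast)

text \<open>\<open>TR3\<close> produces only the third component of a morphism of triangles, so the
  identity triangle of A and the given triangle are both rotated once. The component obtained goes
  from \<Sigma>A to \<Sigma>X; fullness of \<Sigma> brings it back to b, and faithfulness gives f b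
  = a.\<close>

lemma hom_exact_covariant:
  assumes tri: "(f, g, h) \<in> tri T" and f: "f \<in> Homs T X Y" and g: "g \<in> Homs T Y Z"
    and a: "a \<in> Homs T A Y" and ga: "g \<cdot> a = hom_zero T A Z"
  obtains b where "b \<in> Homs T A X" "f \<cdot> b = a"
proof -
  obtain O' where O': "is_zero_object T O'" by (rule zero_object_exists)
  note o = zero_objectD[OF O']
  note A = Homs_obj[OF a] and X = Homs_obj[OF f] and Z = Homs_obj[OF g]
  have SA: "\<Sigma>\<^sub>o A \<in> obj T" using A susp.omap_obj by blast
  have h: "h \<in> Homs T Z (\<Sigma>\<^sub>o X)"
    using tri_third[OF tri f g] .
  have iA: "ident T A \<in> Homs T A A" using A ident_hom by blast
  have z1: "hom_zero T A O' \<in> Homs T A O'" and z2: "hom_zero T O' (\<Sigma>\<^sub>o A) \<in> Homs T O' (\<Sigma>\<^sub>o A)"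
    and z3: "hom_zero T O' Z \<in> Homs T O' Z"
    using A Z o SA zero_hom by blast+
  have n: "hom_neg T (\<Sigma>\<^sub>a (ident T A)) \<in> Homs T (\<Sigma>\<^sub>o A) (\<Sigma>\<^sub>o A)"
    using iA susp.amap_hom neg_hom by blast
  have n': "hom_neg T (\<Sigma>\<^sub>a f) \<in> Homs T (\<Sigma>\<^sub>o X) (\<Sigma>\<^sub>o Y)"
    using f susp.amap_hom neg_hom by blast
  have "(hom_zero T A O', hom_zero T O' (\<Sigma>\<^sub>o A), hom_neg T (\<Sigma>\<^sub>a (ident T A))) \<in> tri T"
    using tri_rotate[OF TR1_ident[OF _ O'] iA] A by blast
  then have "\<exists>w \<in> Homs T (src T (hom_neg T (\<Sigma>\<^sub>a (ident T A)))) (src T (hom_neg T (\<Sigma>\<^sub>a f))).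
      w \<cdot> hom_zero T O' (\<Sigma>\<^sub>o A) = h \<cdot> hom_zero T O' Z \<and>
      \<Sigma>\<^sub>a a \<cdot> hom_neg T (\<Sigma>\<^sub>a (ident T A)) = hom_neg T (\<Sigma>\<^sub>a f) \<cdot> w"
    using HomsD[OF z1] HomsD[OF z2] HomsD[OF g] HomsD[OF h] a z3 cmp_zero_left[OF z1] A Z ga
    by (intro TR3[OF _ tri_rotate[OF tri f]]) auto
  then obtain w where w: "w \<in> Homs T (\<Sigma>\<^sub>o A) (\<Sigma>\<^sub>o X)"
    and eq: "\<Sigma>\<^sub>a a \<cdot> hom_neg T (\<Sigma>\<^sub>a (ident T A)) = hom_neg T (\<Sigma>\<^sub>a f) \<cdot> w"
    using HomsD[OF n] HomsD[OF n'] by auto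
  obtain b where b: "b \<in> Homs T A X" "\<Sigma>\<^sub>a b = w" using susp_full[OF w] A X by blast
  have fb: "f \<cdot> b \<in> Homs T A Y" using b f cmp_hom by blast
  have Sa: "\<Sigma>\<^sub>a a \<in> Homs T (\<Sigma>\<^sub>o A) (\<Sigma>\<^sub>o Y)" using a susp.amap_hom by blast
  have "hom_neg T (\<Sigma>\<^sub>a a) = hom_neg T (\<Sigma>\<^sub>a f \<cdot> w)"
    using eq cmp_neg_right[OF ident_hom[OF SA] Sa] cmp_neg_left[OF w susp.amap_hom[OF f]]
      susp.amap_ident A ident_right[OF Sa] by simp
  then have "hom_neg T (\<Sigma>\<^sub>a a) = hom_neg T (\<Sigma>\<^sub>a (f \<cdot> b))"
    using susp.amap_cmp[OF b(1) f] b(2) by simp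
  then have "\<Sigma>\<^sub>a a = \<Sigma>\<^sub>a (f \<cdot> b)"
    using neg_neg[OF Sa] neg_neg[OF susp.amap_hom[OF fb]] by metis
  then show ?thesis using that b susp_inj[OF a fb] by blast
qed

text \<open>The factorization is the third component of a morphism, with a in the middle, from the
  given triangle to a triangle that starts at a zero object and continues with the identity of
  A.\<close>

lemma hom_exact_contravariant:
  assumes tri: "(f, g, h) \<in> tri T" and f: "f \<in> Homs T X Y" and g: "g \<in> Homs T Y Z"
    and a: "a \<in> Homs T Y A" and af: "a \<cdot> f = hom_zero T X A"
  obtains b where "b \<in> Homs T Z A" "b \<cdot> g = a"
proof -
  obtain O' where O': "is_zero_object T O'" by (rule zero_object_exists)
  note SO = is_zero_object_susp[OF O']
  note A = Homs_obj[OF a] and X = Homs_obj[OF f]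
  have SA: "\<Sigma>\<^sub>o A \<in> obj T" using A susp.omap_obj by blast
  have h: "h \<in> Homs T Z (\<Sigma>\<^sub>o X)"
    using tri_third[OF tri f g] .
  have iA: "ident T A \<in> Homs T A A" using A ident_hom by blast
  have z1: "hom_zero T O' A \<in> Homs T O' A" and z2: "hom_zero T A (\<Sigma>\<^sub>o O') \<in> Homs T A (\<Sigma>\<^sub>o O')"
    and z3: "hom_zero T X O' \<in> Homs T X O'" 
    using A X zero_objectD[OF O'] zero_objectD[OF SO] zero_hom by blast+
  \<comment> \<open>The identity triangle of A with zero object \<open>\<Sigma>\<^sub>o O'\<close>
    is rotated backwards by \<open>TR2\<close>, which requires the sign-changed suspended zero map
    to be the zero map again.\<close>
  have "hom_neg T (\<Sigma>\<^sub>a (hom_zero T O' A)) = hom_zero T (\<Sigma>\<^sub>o O') (\<Sigma>\<^sub>o A)"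
    using Homs_from_zero[OF SO] neg_hom susp.amap_hom z1 by blast
  then have "(hom_zero T O' A, ident T A, hom_zero T A (\<Sigma>\<^sub>o O')) \<in> tri T"
    using TR2[OF z1 iA z2] TR1_ident[OF _ SO] A by simp
  then have "\<exists>w \<in> Homs T (src T h) (src T (hom_zero T A (\<Sigma>\<^sub>o O'))).
      w \<cdot> g = ident T A \<cdot> a \<and> \<Sigma>\<^sub>a (hom_zero T X O') \<cdot> h = hom_zero T A (\<Sigma>\<^sub>o O') \<cdot> w"
    using HomsD[OF z1] HomsD[OF f] HomsD[OF iA] HomsD[OF g] a z3 af cmp_zero_left[OF z3] A
    by (intro TR3[OF tri]) auto
  then obtain w where "w \<in> Homs T Z A" "w \<cdot> g = a"
    using HomsD[OF h] HomsD[OF z2] ident_left[OF a] by auto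
  then show ?thesis using that by blast
qed

lemma desuspension:
  assumes "X \<in> obj T"
  obtains X' u v where "X' \<in> obj T" "u \<in> Homs T (\<Sigma>\<^sub>o X') X" "v \<in> Homs T X (\<Sigma>\<^sub>o X')"
    "v \<cdot> u = ident T (\<Sigma>\<^sub>o X')" "u \<cdot> v = ident T X"
proof -
  obtain X' u where X': "X' \<in> obj T" and u: "is_iso T (\<Sigma>\<^sub>o X') X u"
    using susp_ess_surj[OF assms] by blast
  show ?thesis by (rule is_isoE[OF u]) (rule that[OF X'])
qed

text \<open>The axioms provide cones only. The cone of p is replaced by an isomorphic suspension
  \<Sigma>F, the connecting map to \<Sigma>X is desuspended to k, and the triangle is rotated back.
  Rotation introduces a sign, so the fibre map is the negative of k.\<close>

lemma fibreE:
  assumes p: "p \<in> Homs T X Y"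
  obtains F k h where "k \<in> Homs T F X" "(k, p, h) \<in> tri T"
proof -
  obtain Z c d where tri: "(p, c, d) \<in> tri T" and c: "c \<in> Homs T Y Z" and d: "d \<in> Homs T Z (\<Sigma>\<^sub>o X)"
    using coneE[OF p] by blast
  obtain F u v where F: "F \<in> obj T" and u: "u \<in> Homs T (\<Sigma>\<^sub>o F) Z" and v: "v \<in> Homs T Z (\<Sigma>\<^sub>o F)"
    and vu: "v \<cdot> u = ident T (\<Sigma>\<^sub>o F)" and uv: "u \<cdot> v = ident T Z"
    using desuspension[of Z] Homs_obj[OF c] by blast
  note X = Homs_obj[OF p]
  have du: "d \<cdot> u \<in> Homs T (\<Sigma>\<^sub>o F) (\<Sigma>\<^sub>o X)" using d u cmp_hom by blast
  obtain k where k: "k \<in> Homs T F X" "\<Sigma>\<^sub>a k = d \<cdot> u"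
    using susp_full[OF du F] X by blast
  have nk: "hom_neg T k \<in> Homs T F X" using k neg_hom by blast
  have sn: "hom_neg T (\<Sigma>\<^sub>a (hom_neg T k)) = d \<cdot> u"
    using susp.amap_neg[OF k(1)] k neg_neg[OF du] by simp
  have vc: "v \<cdot> c \<in> Homs T Y (\<Sigma>\<^sub>o F)" using v c cmp_hom by blast
  have iso: "is_iso T Z (\<Sigma>\<^sub>o F) v" using u v vu uv is_isoI by blast
  have isoid: "is_iso T A A (ident T A)" if "A \<in> obj T" for A
    using that ident_hom ident_left by (intro is_isoI) blast+
  have e1: "ident T Y \<cdot> p = p \<cdot> ident T X" using p ident_left ident_right by simp
  have e2: "v \<cdot> c = v \<cdot> c \<cdot> ident T Y" using vc ident_right by simp
  have "d \<cdot> u \<cdot> v = d" using cmp_assoc[OF v u d] uv ident_right[OF d] by simp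
  then have e3: "\<Sigma>\<^sub>a (ident T X) \<cdot> d = d \<cdot> u \<cdot> v"
    using ident_left[OF d] susp.amap_ident X by simp
  have "(p, v \<cdot> c, d \<cdot> u) \<in> tri T"
    by (rule TR1_iso[OF tri p vc du _ _ _ e1 e2 e3])
      (use HomsD[OF p] HomsD[OF c] HomsD[OF d] isoid X iso in auto)
  then have "(hom_neg T k, p, v \<cdot> c) \<in> tri T"
    using TR2[OF nk p vc] sn by simp
  then show ?thesis using that nk by blast
qed

text \<open>As g is zero, exactness gives a section s of f. The error s f - 1 is killed by f, so by
  the triangle rotated twice its suspension factors through Z and vanishes; faithfulness of \<Sigma>
  finishes.\<close>

lemma is_iso_if_cone_zero:
  assumes tri: "(f, g, h) \<in> tri T" and f: "f \<in> Homs T X Y" and g: "g \<in> Homs T Y Z"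
    and Z: "is_zero_object T Z"
  shows "is_iso T X Y f"
proof -
  note X = Homs_obj[OF f]
  have iY: "ident T Y \<in> Homs T Y Y" and iX: "ident T X \<in> Homs T X X" using X ident_hom by blast+
  have "g \<cdot> ident T Y = hom_zero T Y Z"
    using Homs_to_zero[OF Z g] ident_right[OF g] by simp
  then obtain s where s: "s \<in> Homs T Y X" "f \<cdot> s = ident T Y"
    using hom_exact_covariant[OF tri f g iY] by blast
  have h: "h \<in> Homs T Z (\<Sigma>\<^sub>o X)"
    using tri_third[OF tri f g] .
  have sf: "s \<cdot> f \<in> Homs T X X" using s f cmp_hom by blast
  let ?e = "s \<cdot> f \<uplus> hom_neg T (ident T X)"
  have e: "?e \<in> Homs T X X" using add_hom[OF sf neg_hom[OF iX]] .
  have "f \<cdot> (s \<cdot> f) = f"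
    using cmp_assoc[OF f s(1) f] s(2) ident_left[OF f] by simp
  then have fe: "f \<cdot> ?e = hom_zero T X Y"
    using cmp_add_right[OF sf neg_hom[OF iX] f] cmp_neg_right[OF iX f] ident_right[OF f] add_neg(1)[OF f]
    by simp
  have Se: "\<Sigma>\<^sub>a ?e \<in> Homs T (\<Sigma>\<^sub>o X) (\<Sigma>\<^sub>o X)" using e susp.amap_hom by blast
  have "\<Sigma>\<^sub>a f \<cdot> \<Sigma>\<^sub>a ?e = hom_zero T (\<Sigma>\<^sub>o X) (\<Sigma>\<^sub>o Y)"
    using susp.amap_cmp[OF e f] fe susp.amap_zero X by simp
  then have nz: "hom_neg T (\<Sigma>\<^sub>a f) \<cdot> \<Sigma>\<^sub>a ?e = hom_zero T (\<Sigma>\<^sub>o X) (\<Sigma>\<^sub>o Y)"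
    using cmp_neg_left[OF Se susp.amap_hom[OF f]] add_eq_zero_iff add_zero(1) zero_hom susp.omap_obj X
    by metis
  obtain w where w: "w \<in> Homs T (\<Sigma>\<^sub>o X) Z" "h \<cdot> w = \<Sigma>\<^sub>a ?e"
    using hom_exact_covariant[OF tri_rotate[OF tri_rotate[OF tri f] g] h neg_hom[OF susp.amap_hom[OF f]] Se nz]
    by blast
  then have "\<Sigma>\<^sub>a ?e = \<Sigma>\<^sub>a (hom_zero T X X)"
    using Homs_to_zero[OF Z w(1)] cmp_zero_right[OF h] susp.amap_zero X susp.omap_obj by simp
  then have "?e = hom_zero T X X" using susp_inj[OF e] zero_hom X by blast
  then have "s \<cdot> f = ident T X" using diff_eq_zero_iff[OF sf iX] by simp
  then show ?thesis using is_isoI f s by blast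
qed

end


section \<open>Compactness as a sum criterion, and its stability under suspension and
  desuspension\<close>

section \<open>Compact objects\<close>

lemma (in comm_group) finprod_closed_under:
  assumes "finite F" "\<And>i. i \<in> F \<Longrightarrow> f i \<in> carrier G \<and> P (f i)" "P \<one>"
    and "\<And>a b. a \<in> carrier G \<Longrightarrow> b \<in> carrier G \<Longrightarrow> P a \<Longrightarrow> P b \<Longrightarrow> P (a \<otimes> b)"
  shows "P (finprod G f F)"
  using assms(1,2)
proof (induction F)
  case empty
  then show ?case using assms(3) by simp
next
  case (insert i F)
  then have "f i \<in> carrier G" "finprod G f F \<in> carrier G" "P (f i)" "P (finprod G f F)"
    by (auto intro!: finprod_closed)
  then show ?case using insert assms(4) by (subst finprod_insert) auto
qed

lemma obj_compacts [simp]: "obj (compacts V T) = {C. compact_object V T C}"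
  by (simp add: compacts_def)

lemma compacts_simps [simp]:
  "src (compacts V T) = src T" "tgt (compacts V T) = tgt T"
  "ident (compacts V T) = ident T" "cmp (compacts V T) = cmp T"
  "hom_add (compacts V T) = hom_add T" "hom_zero (compacts V T) = hom_zero T"
  by (simp_all add: compacts_def)

lemma compact_objectD: "compact_object V T C \<Longrightarrow> C \<in> obj T"
  by (simp add: compact_object_def)

lemma Homs_compacts:
  "Homs (compacts V T) X Y =
    (if compact_object V T X \<and> compact_object V T Y then Homs T X Y else {})"
  by (simp add: compacts_def Homs_full_sub)

lemma preadditive_category_compacts:
  "preadditive_category T \<Longrightarrow> preadditive_category (compacts V T)"
  unfolding compacts_def by (rule preadditive_category_full_sub) (auto dest: compact_objectD)

text \<open>
  Every morphism from \<open>C\<close> into the coproduct is a finite sum of morphisms through the summands.  The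
  formulation as an induction principle avoids explicit finite sums; injectivity of the comparison
  map in the definition of compactness is automatic.
\<close>

definition sums_from_summands ::
  "('o, 'm, 'z) preadd_scheme \<Rightarrow> 'i set \<Rightarrow> ('i \<Rightarrow> 'o) \<Rightarrow> 'o \<Rightarrow> ('i \<Rightarrow> 'm) \<Rightarrow> 'o \<Rightarrow> bool" where
  "sums_from_summands T I X S \<iota> C \<longleftrightarrow>
    (\<forall>H. hom_zero T C S \<in> H \<longrightarrow>
      (\<forall>a \<in> Homs T C S. \<forall>b \<in> Homs T C S. a \<in> H \<longrightarrow> b \<in> H \<longrightarrow> hom_add T a b \<in> H) \<longrightarrow>
      (\<forall>i \<in> I. \<forall>x \<in> Homs T C (X i). \<iota> i \<cdot>\<^bsub>T\<^esub> x \<in> H) \<longrightarrow> Homs T C S \<subseteq> H)"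

lemma sums_from_summands_induct [consumes 2, case_names zero add summand]:
  assumes "sums_from_summands T I X S \<iota> C" "y \<in> Homs T C S"
    and "P (hom_zero T C S)"
    and "\<And>a b. a \<in> Homs T C S \<Longrightarrow> b \<in> Homs T C S \<Longrightarrow> P a \<Longrightarrow> P b \<Longrightarrow> P (hom_add T a b)"
    and "\<And>i x. i \<in> I \<Longrightarrow> x \<in> Homs T C (X i) \<Longrightarrow> P (\<iota> i \<cdot>\<^bsub>T\<^esub> x)"
  shows "P y"
proof -
  have "Homs T C S \<subseteq> {a. P a}"
    by (rule assms(1)[unfolded sums_from_summands_def, rule_format]) (simp_all add: assms(3-5))
  then show ?thesis using assms(2) by blast
qed

context preadditive_category
begin

text \<open>By surjectivity of the comparison map every y is a finite sum of maps \<iota> i x i, and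
  H contains such sums.\<close>

lemma compact_object_sums:
  assumes comp: "compact_object (V :: 'v itself) C K" and "small V (I :: 'v set)" "\<And>i. i \<in> I \<Longrightarrow> X i \<in> obj C"
    and cop: "is_coproduct C I X S \<iota>"
  shows "sums_from_summands C I X S \<iota> K"
  unfolding sums_from_summands_def
proof (intro allI impI subsetI)
  fix H y
  assume z: "hom_zero C K S \<in> H"
    and add: "\<forall>a\<in>Homs C K S. \<forall>b\<in>Homs C K S. a \<in> H \<longrightarrow> b \<in> H \<longrightarrow> a \<uplus> b \<in> H"
    and sm: "\<forall>i\<in>I. \<forall>x\<in>Homs C K (X i). \<iota> i \<cdot> x \<in> H" and y: "y \<in> Homs C K S"
  interpret G: comm_group "HomG C K S" using y by (rule HomG_comm_group)
  let ?h = "\<lambda>x. finprod (HomG C K S) (\<lambda>i. \<iota> i \<cdot> x i) {i \<in> I. x i \<noteq> hom_zero C K (X i)}"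
  have "?h \<in> Group.iso (sum_group I (\<lambda>i. HomG C K (X i))) (HomG C K S)"
    by (rule comp[unfolded compact_object_def, THEN conjunct2, rule_format]) (use assms in auto)
  then have "?h ` carrier (sum_group I (\<lambda>i. HomG C K (X i))) = Homs C K S"
    by (auto simp: Group.iso_def bij_betw_def)
  then obtain x where x: "x \<in> carrier (sum_group I (\<lambda>i. HomG C K (X i)))" and yx: "y = ?h x"
    using y by blast
  have "\<And>i. i \<in> I \<Longrightarrow> group (HomG C K (X i))"
    using compact_objectD[OF comp] assms(3) hom_comm_group comm_group.axioms(2) by blast
  then have fin: "finite {i \<in> I. x i \<noteq> hom_zero C K (X i)}" and xi: "\<And>i. i \<in> I \<Longrightarrow> x i \<in> Homs C K (X i)"
    using x by (auto simp: carrier_sum_group)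
  have "\<And>i. i \<in> I \<Longrightarrow> \<iota> i \<cdot> x i \<in> Homs C K S"
    using cmp_hom[OF xi coproductD(2)[OF cop]] .
  then show "y \<in> H"
    unfolding yx
    by (intro G.finprod_closed_under[where P = "\<lambda>a. a \<in> H"])
      (use fin z add sm xi in auto)
qed

text \<open>The comparison map is injective because projections of the coproduct recover all
  coordinates. Its image contains zero, is closed under addition and contains all maps through a
  summand, so the sum criterion makes it surjective.\<close>

lemma compact_objectI:
  assumes K: "K \<in> obj C"
    and sums: "\<And>(I :: 'v set) X S \<iota>. small V I \<Longrightarrow> (\<And>i. i \<in> I \<Longrightarrow> X i \<in> obj C) \<Longrightarrow>
      is_coproduct C I X S \<iota> \<Longrightarrow> sums_from_summands C I X S \<iota> K"
  shows "compact_object (V :: 'v itself) C K"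
  unfolding compact_object_def
proof (intro conjI allI impI K)
  fix I :: "'v set" and X S \<iota>
  assume sm: "small V I" and X: "\<forall>i\<in>I. X i \<in> obj C" and cop: "is_coproduct C I X S \<iota>"
  note S = coproductD(1)[OF cop] and \<iota> = coproductD(2)[OF cop]
  interpret G: comm_group "HomG C K S" using hom_comm_group K S by blast
  let ?SG = "sum_group I (\<lambda>i. HomG C K (X i))"
  let ?h = "\<lambda>x. finprod (HomG C K S) (\<lambda>i. \<iota> i \<cdot> x i) {i \<in> I. x i \<noteq> hom_zero C K (X i)}"
  have gr: "\<And>i. i \<in> I \<Longrightarrow> comm_group (HomG C K (X i))"
    using X K hom_comm_group by blast
  then have gr': "\<And>i. i \<in> I \<Longrightarrow> group (HomG C K (X i))"
    using comm_group.axioms(2) by blast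
  have xi: "x i \<in> Homs C K (X i)" if "x \<in> carrier ?SG" "i \<in> I" for x i
    using that gr' by (auto simp: carrier_sum_group)
  have fin: "finite {i \<in> I. x i \<noteq> hom_zero C K (X i)}" if "x \<in> carrier ?SG" for x
    using that gr' by (auto simp: carrier_sum_group)
  have \<iota>x: "\<iota> i \<cdot> x i \<in> Homs C K S" if "x \<in> carrier ?SG" "i \<in> I" for x i
    using cmp_hom[OF xi[OF that] \<iota>[OF that(2)]] .
  \<comment> \<open>The index set of the product depends on the support of x. Rewriting it as a
    product over all of I makes additivity in x available.\<close>
  have h_eq: "?h x = gfinprod (HomG C K S) (\<lambda>i. \<iota> i \<cdot> x i) I" if x: "x \<in> carrier ?SG" for x
  proof -
    have supp: "{i \<in> I. \<iota> i \<cdot> x i \<noteq> \<one>\<^bsub>HomG C K S\<^esub>} \<subseteq> {i \<in> I. x i \<noteq> hom_zero C K (X i)}"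
      using cmp_zero_right[OF \<iota> K] by auto
    have "gfinprod (HomG C K S) (\<lambda>i. \<iota> i \<cdot> x i) I =
        finprod (HomG C K S) (\<lambda>i. \<iota> i \<cdot> x i) {i \<in> I. \<iota> i \<cdot> x i \<noteq> \<one>\<^bsub>HomG C K S\<^esub>}"
      using finite_subset[OF supp fin[OF x]] by (simp add: gfinprod_def)
    also have "\<dots> = ?h x"
      using supp fin[OF x] \<iota>x[OF x]
      by (intro G.finprod_mono_neutral_cong_left) auto
    finally show ?thesis by simp
  qed
  have comp_hom: "(\<lambda>x. \<iota> i \<cdot> x) \<in> hom (HomG C K (X i)) (HomG C K S)" if "i \<in> I" for i
    using cmp_hom[OF _ \<iota>[OF that]] cmp_add_right[OF _ _ \<iota>[OF that]] by (auto simp: hom_def)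
  have "(\<lambda>x. gfinprod (HomG C K S) (\<lambda>i. \<iota> i \<cdot> x i) I) \<in> hom ?SG (HomG C K S)"
    by (rule G.hom_group_sum[OF comp_hom gr'])
  then have gh: "gfinprod (HomG C K S) (\<lambda>i. \<iota> i \<cdot> (x \<otimes>\<^bsub>?SG\<^esub> y) i) I =
      gfinprod (HomG C K S) (\<lambda>i. \<iota> i \<cdot> x i) I \<uplus> gfinprod (HomG C K S) (\<lambda>i. \<iota> i \<cdot> y i) I"
    if "x \<in> carrier ?SG" "y \<in> carrier ?SG" for x y
    using that by (auto simp: hom_def)
  interpret SG: group ?SG using gr' by simp
  have h_in: "?h x \<in> Homs C K S" if "x \<in> carrier ?SG" for x
    using G.finprod_closed[of "\<lambda>i. \<iota> i \<cdot> x i"] \<iota>x[OF that] by auto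
  have h_mult: "?h (x \<otimes>\<^bsub>?SG\<^esub> y) = ?h x \<uplus> ?h y" if "x \<in> carrier ?SG" "y \<in> carrier ?SG" for x y
    using gh[OF that] h_eq[OF that(1)] h_eq[OF that(2)] h_eq[OF SG.m_closed[OF that]] by simp
  then have h_hom: "?h \<in> hom ?SG (HomG C K S)"
    using h_in by (intro homI) auto
  obtain \<pi> where \<pi>: "\<And>j. j \<in> I \<Longrightarrow> \<pi> j \<in> Homs C S (X j)"
    and \<pi>1: "\<And>j. j \<in> I \<Longrightarrow> \<pi> j \<cdot> \<iota> j = ident C (X j)"
    and \<pi>0: "\<And>i j. i \<in> I \<Longrightarrow> j \<in> I \<Longrightarrow> i \<noteq> j \<Longrightarrow> \<pi> j \<cdot> \<iota> i = hom_zero C (X i) (X j)"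
    using coproduct_projections[OF cop] X by blast
  have proj: "\<pi> j \<cdot> finprod (HomG C K S) (\<lambda>i. \<iota> i \<cdot> x i) F =
      (if j \<in> F then x j else hom_zero C K (X j))"
    if "finite F" "F \<subseteq> I" "j \<in> I" and x: "x \<in> carrier ?SG" for F j x
    using that(1,2)
  proof (induction F)
    case empty
    then show ?case using cmp_zero_right[OF \<pi>[OF \<open>j \<in> I\<close>] K] by simp
  next
    case (insert i F)
    have i: "i \<in> I" using insert by blast
    have F: "finprod (HomG C K S) (\<lambda>i. \<iota> i \<cdot> x i) F \<in> Homs C K S"
      using G.finprod_closed[of "\<lambda>i. \<iota> i \<cdot> x i" F] \<iota>x[OF x] insert.prems by auto
    have 1: "finprod (HomG C K S) (\<lambda>i. \<iota> i \<cdot> x i) (insert i F) =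
        \<iota> i \<cdot> x i \<uplus> finprod (HomG C K S) (\<lambda>i. \<iota> i \<cdot> x i) F"
      using insert \<iota>x[OF x] by (subst G.finprod_insert) auto
    have 2: "\<pi> j \<cdot> (\<iota> i \<cdot> x i) = (if i = j then x j else hom_zero C K (X j))"
      using cmp_assoc[OF xi[OF x i] \<iota>[OF i] \<pi>[OF \<open>j \<in> I\<close>]] \<pi>1[OF \<open>j \<in> I\<close>] \<pi>0[OF i \<open>j \<in> I\<close>]
        ident_left[OF xi[OF x \<open>j \<in> I\<close>]] cmp_zero_left[OF xi[OF x i]] X \<open>j \<in> I\<close> by auto
    have 3: "\<pi> j \<cdot> finprod (HomG C K S) (\<lambda>i. \<iota> i \<cdot> x i) F =
        (if j \<in> F then x j else hom_zero C K (X j))"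
      using insert by blast
    show ?case
      unfolding 1 cmp_add_right[OF \<iota>x[OF x i] F \<pi>[OF \<open>j \<in> I\<close>]] 2 3
      using add_zero[OF xi[OF x \<open>j \<in> I\<close>]] add_zero[OF zero_hom[OF K]] X \<open>j \<in> I\<close> insert.hyps by auto
  qed
  have proj_h: "\<pi> j \<cdot> ?h x = x j" if "j \<in> I" "x \<in> carrier ?SG" for j x
    using proj[OF fin[OF that(2)] _ that] that(1) by auto
  have inj: "inj_on ?h (carrier ?SG)"
  proof (rule inj_onI)
    fix x y assume xy: "x \<in> carrier ?SG" "y \<in> carrier ?SG" "?h x = ?h y"
    have "x j = y j" if "j \<in> I" for j
      using proj_h[OF that xy(1)] proj_h[OF that xy(2)] xy(3) by simp
    moreover have "x \<in> extensional I" "y \<in> extensional I"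
      using xy gr' by (auto simp: carrier_sum_group PiE_def)
    ultimately show "x = y" by (rule extensionalityI[rotated 2])
  qed
  have "Homs C K S \<subseteq> ?h ` carrier ?SG"
  proof (rule sums[OF sm _ cop, unfolded sums_from_summands_def, rule_format])
    show "\<And>i. i \<in> I \<Longrightarrow> X i \<in> obj C" using X by blast
    have "?h \<one>\<^bsub>?SG\<^esub> = hom_zero C K S"
    proof -
      have e: "{i \<in> I. \<one>\<^bsub>?SG\<^esub> i \<noteq> hom_zero C K (X i)} = {}" by auto
      show ?thesis unfolding e by simp
    qed
    from image_eqI[of _ ?h, OF this[symmetric] SG.one_closed]
    show "hom_zero C K S \<in> ?h ` carrier ?SG" .
  next
    fix a b assume "a \<in> ?h ` carrier ?SG" "b \<in> ?h ` carrier ?SG"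
    then obtain x y where xy: "x \<in> carrier ?SG" "y \<in> carrier ?SG" "a = ?h x" "b = ?h y" by blast
    have "a \<uplus> b = ?h (x \<otimes>\<^bsub>?SG\<^esub> y)" using h_mult[OF xy(1,2)] xy(3,4) by simp
    from image_eqI[of _ ?h, OF this SG.m_closed[OF xy(1,2)]]
    show "a \<uplus> b \<in> ?h ` carrier ?SG" .
  next
    fix i x assume ix: "i \<in> I" "x \<in> Homs C K (X i)"
    let ?x = "\<lambda>j\<in>I. if j = i then x else hom_zero C K (X j)"
    have "finite {j \<in> I. ?x j \<noteq> hom_zero C K (X j)}"
      by (rule finite_subset[of _ "{i}"]) auto
    then have x: "?x \<in> carrier ?SG"
      using ix gr' X K zero_hom by (auto simp: carrier_sum_group)
    have "?h ?x = \<iota> i \<cdot> x"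
    proof (cases "x = hom_zero C K (X i)")
      case True
      then have "{j \<in> I. ?x j \<noteq> hom_zero C K (X j)} = {}" by auto
      then show ?thesis using cmp_zero_right[OF \<iota>[OF ix(1)] K] True by simp
    next
      case False
      then have e: "{j \<in> I. ?x j \<noteq> hom_zero C K (X j)} = {i}" using ix by auto
      show ?thesis unfolding e using \<iota>x[OF x ix(1)] ix add_zero(1) by (subst G.finprod_insert) auto
    qed
    from image_eqI[of _ ?h, OF this[symmetric] x]
    show "\<iota> i \<cdot> x \<in> ?h ` carrier ?SG" .
  qed
  then have "?h ` carrier ?SG = Homs C K S" using h_in by blast
  then show "?h \<in> Group.iso ?SG (HomG C K S)"
    using h_hom inj by (simp add: Group.iso_def bij_betw_def)
qed

text \<open>Infinite coproducts are provided only over subsets of \<open>'v\<close>; reindexing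
  along a label yields those over the natural numbers that the telescopes need.\<close>

lemma coproduct_reindex:
  assumes cop: "is_coproduct C I X S \<iota>" and e: "bij_betw e J I"
  shows "is_coproduct C J (\<lambda>j. X (e j)) S (\<lambda>j. \<iota> (e j))"
  unfolding is_coproduct_def
proof (intro conjI ballI allI impI)
  show "S \<in> obj C" using coproductD(1)[OF cop] .
  show "\<iota> (e j) \<in> Homs C (X (e j)) S" if "j \<in> J" for j
    using coproductD(2)[OF cop] bij_betwE[OF e] that by blast
  fix Y f assume Y: "Y \<in> obj C" and f: "\<forall>j\<in>J. f j \<in> Homs C (X (e j)) Y"
  let ?f = "\<lambda>i. f (inv_into J e i)"
  have "?f i \<in> Homs C (X i) Y" if "i \<in> I" for i
    using f that bij_betw_inv_into_right[OF e that] bij_betwE[OF bij_betw_inv_into[OF e]] by metis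
  then obtain h where h: "h \<in> Homs C S Y" "\<forall>i\<in>I. h \<cdot> \<iota> i = ?f i"
    using coproduct_induced[OF cop Y, of ?f] by blast
  have hj: "h \<cdot> \<iota> (e j) = f j" if "j \<in> J" for j
    using h(2)[rule_format, of "e j"] bij_betwE[OF e] bij_betw_inv_into_left[OF e that] that by simp
  have uniq: "h' = h" if "h' \<in> Homs C S Y" "\<forall>j\<in>J. h' \<cdot> \<iota> (e j) = f j" for h'
  proof (rule coproduct_eqI[OF cop that(1) h(1)])
    fix i assume "i \<in> I"
    then obtain j where "j \<in> J" "i = e j" using e by (auto simp: bij_betw_def)
    then show "h' \<cdot> \<iota> i = h \<cdot> \<iota> i" using that(2) hj by simp
  qed
  show "\<exists>!h. h \<in> Homs C S Y \<and> (\<forall>j\<in>J. h \<cdot> \<iota> (e j) = f j)"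
    by (rule ex1I[of _ h]) (use h(1) hj uniq in \<open>blast+\<close>)
qed

lemma sums_from_summands_reindex:
  assumes "sums_from_summands C I X S \<iota> K" "e ` J = I"
  shows "sums_from_summands C J (\<lambda>j. X (e j)) S (\<lambda>j. \<iota> (e j)) K"
  using assms(1) unfolding sums_from_summands_def assms(2)[symmetric] by simp

end

context triangulated_category
begin

text \<open>An equivalence preserves coproducts: once Y is replaced by an isomorphic suspension
  \<Sigma>Y', maps from \<Sigma>S to Y correspond to maps from S to Y'.\<close>

lemma coproduct_susp:
  assumes cop: "is_coproduct T I X S \<iota>" and X: "\<And>i. i \<in> I \<Longrightarrow> X i \<in> obj T"
  shows "is_coproduct T I (\<lambda>i. \<Sigma>\<^sub>o (X i)) (\<Sigma>\<^sub>o S) (\<lambda>i. \<Sigma>\<^sub>a (\<iota> i))"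
  unfolding is_coproduct_def
proof (intro conjI ballI allI impI)
  note S = coproductD(1)[OF cop] and \<iota> = coproductD(2)[OF cop]
  show "\<Sigma>\<^sub>o S \<in> obj T" using S by (rule susp.omap_obj)
  show S\<iota>: "\<Sigma>\<^sub>a (\<iota> i) \<in> Homs T (\<Sigma>\<^sub>o (X i)) (\<Sigma>\<^sub>o S)" if "i \<in> I" for i
    using \<iota>[OF that] by (rule susp.amap_hom)
  fix Y f assume Y: "Y \<in> obj T" and f: "\<forall>i\<in>I. f i \<in> Homs T (\<Sigma>\<^sub>o (X i)) Y"
  obtain Y' u v where Y': "Y' \<in> obj T" and u: "u \<in> Homs T (\<Sigma>\<^sub>o Y') Y" and v: "v \<in> Homs T Y (\<Sigma>\<^sub>o Y')"
    and uv: "u \<cdot> v = ident T Y"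
    using desuspension[OF Y] by metis
  define f' where "f' i = (SOME g. g \<in> Homs T (X i) Y' \<and> \<Sigma>\<^sub>a g = v \<cdot> f i)" for i
  have f': "f' i \<in> Homs T (X i) Y' \<and> \<Sigma>\<^sub>a (f' i) = v \<cdot> f i" if "i \<in> I" for i
    unfolding f'_def
    by (rule someI_ex, rule susp_full[OF cmp_hom[OF _ v] X[OF that] Y', of "f i"]) (use f that in auto)
  obtain h where h: "h \<in> Homs T S Y'" "\<And>i. i \<in> I \<Longrightarrow> h \<cdot> \<iota> i = f' i"
    using coproduct_induced[OF cop Y', of f'] f' by blast
  note Sh = susp.amap_hom[OF h(1)]
  have k: "u \<cdot> \<Sigma>\<^sub>a h \<in> Homs T (\<Sigma>\<^sub>o S) Y" using cmp_hom[OF Sh u] .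
  have k\<iota>: "(u \<cdot> \<Sigma>\<^sub>a h) \<cdot> \<Sigma>\<^sub>a (\<iota> i) = f i" if i: "i \<in> I" for i
  proof -
    have fi: "f i \<in> Homs T (\<Sigma>\<^sub>o (X i)) Y" using f i by blast
    have "(u \<cdot> \<Sigma>\<^sub>a h) \<cdot> \<Sigma>\<^sub>a (\<iota> i) = u \<cdot> \<Sigma>\<^sub>a (h \<cdot> \<iota> i)"
      using cmp_assoc[OF S\<iota>[OF i] Sh u] susp.amap_cmp[OF \<iota>[OF i] h(1)] by simp
    also have "\<dots> = u \<cdot> (v \<cdot> f i)" using h(2)[OF i] f'[OF i] by simp
    also have "\<dots> = f i" using cmp_assoc[OF fi v u] uv ident_left[OF fi] by simp
    finally show ?thesis .
  qed
  have uniq: "h' = u \<cdot> \<Sigma>\<^sub>a h" if h': "h' \<in> Homs T (\<Sigma>\<^sub>o S) Y" "\<forall>i\<in>I. h' \<cdot> \<Sigma>\<^sub>a (\<iota> i) = f i" for h'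
  proof -
    obtain k' where k': "k' \<in> Homs T S Y'" "\<Sigma>\<^sub>a k' = v \<cdot> h'"
      using susp_full[OF cmp_hom[OF h'(1) v] S Y'] by blast
    have "k' = h"
    proof (rule coproduct_eqI[OF cop k'(1) h(1)])
      fix i assume i: "i \<in> I"
      have "\<Sigma>\<^sub>a (k' \<cdot> \<iota> i) = v \<cdot> h' \<cdot> \<Sigma>\<^sub>a (\<iota> i)" using susp.amap_cmp[OF \<iota>[OF i] k'(1)] k'(2) by simp
      also have "\<dots> = \<Sigma>\<^sub>a (f' i)" using cmp_assoc[OF S\<iota>[OF i] h'(1) v] h'(2) f'[OF i] i by simp
      finally have "k' \<cdot> \<iota> i = f' i"
        using susp_inj[OF cmp_hom[OF \<iota>[OF i] k'(1)]] f'[OF i] by blast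
      then show "k' \<cdot> \<iota> i = h \<cdot> \<iota> i" using h(2)[OF i] by simp
    qed
    then have "u \<cdot> \<Sigma>\<^sub>a h = u \<cdot> (v \<cdot> h')" using k'(2) by simp
    also have "\<dots> = h'" using cmp_assoc[OF h'(1) v u] uv ident_left[OF h'(1)] by simp
    finally show ?thesis by simp
  qed
  show "\<exists>!h. h \<in> Homs T (\<Sigma>\<^sub>o S) Y \<and> (\<forall>i\<in>I. h \<cdot> \<Sigma>\<^sub>a (\<iota> i) = f i)"
    by (rule ex1I[of _ "u \<cdot> \<Sigma>\<^sub>a h"]) (use k k\<iota> uniq in \<open>blast+\<close>)
qed

text \<open>A map y from K is suspended and precomposed with v, which gives a map from C to
  \<Sigma>S. The sum criterion holds for that map, and each piece returns to K by precomposing with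
  u and desuspending.\<close>

lemma compact_desuspension:
  assumes C: "compact_object (V :: 'v itself) T C" and K: "K \<in> obj T"
    and u: "u \<in> Homs T (\<Sigma>\<^sub>o K) C" and v: "v \<in> Homs T C (\<Sigma>\<^sub>o K)" and vu: "v \<cdot> u = ident T (\<Sigma>\<^sub>o K)"
  shows "compact_object V T K"
proof (rule compact_objectI[OF K])
  fix I :: "'v set" and X S \<iota>
  assume I: "small V I" and X: "\<And>i. i \<in> I \<Longrightarrow> X i \<in> obj T" and cop: "is_coproduct T I X S \<iota>"
  note S = coproductD(1)[OF cop] and \<iota> = coproductD(2)[OF cop]
  have "sums_from_summands T I (\<lambda>i. \<Sigma>\<^sub>o (X i)) (\<Sigma>\<^sub>o S) (\<lambda>i. \<Sigma>\<^sub>a (\<iota> i)) C"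
    using compact_object_sums[OF C I _ coproduct_susp[OF cop X]] X susp.omap_obj by blast
  note ind = sums_from_summands_induct[OF this]
  show "sums_from_summands T I X S \<iota> K"
    unfolding sums_from_summands_def
  proof (intro allI impI subsetI)
    fix H y
    assume z: "hom_zero T K S \<in> H"
      and add: "\<forall>a\<in>Homs T K S. \<forall>b\<in>Homs T K S. a \<in> H \<longrightarrow> b \<in> H \<longrightarrow> a \<uplus> b \<in> H"
      and sm: "\<forall>i\<in>I. \<forall>x\<in>Homs T K (X i). \<iota> i \<cdot> x \<in> H" and y: "y \<in> Homs T K S"
    note Sy = susp.amap_hom[OF y]
    have "\<exists>h\<in>H. h \<in> Homs T K S \<and> \<Sigma>\<^sub>a h = \<Sigma>\<^sub>a y \<cdot> v \<cdot> u"
    proof (rule ind[OF cmp_hom[OF v Sy]])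
      show "\<exists>h\<in>H. h \<in> Homs T K S \<and> \<Sigma>\<^sub>a h = hom_zero T C (\<Sigma>\<^sub>o S) \<cdot> u"
        using z cmp_zero_left[OF u] susp.amap_zero K S zero_hom susp.omap_obj by metis
    next
      fix a b assume a: "a \<in> Homs T C (\<Sigma>\<^sub>o S)" "\<exists>h\<in>H. h \<in> Homs T K S \<and> \<Sigma>\<^sub>a h = a \<cdot> u"
        and b: "b \<in> Homs T C (\<Sigma>\<^sub>o S)" "\<exists>h\<in>H. h \<in> Homs T K S \<and> \<Sigma>\<^sub>a h = b \<cdot> u"
      then obtain h k where h: "h \<in> H" "h \<in> Homs T K S" "\<Sigma>\<^sub>a h = a \<cdot> u"
        and k: "k \<in> H" "k \<in> Homs T K S" "\<Sigma>\<^sub>a k = b \<cdot> u" by blast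
      have "\<Sigma>\<^sub>a (h \<uplus> k) = (a \<uplus> b) \<cdot> u"
        using susp.amap_add[OF h(2) k(2)] h(3) k(3) cmp_add_left[OF u a(1) b(1)] by simp
      then show "\<exists>h\<in>H. h \<in> Homs T K S \<and> \<Sigma>\<^sub>a h = (a \<uplus> b) \<cdot> u"
        using add h k add_hom[OF h(2) k(2)] by blast
    next
      fix i x assume i: "i \<in> I" and x: "x \<in> Homs T C (\<Sigma>\<^sub>o (X i))"
      obtain x' where x': "x' \<in> Homs T K (X i)" "\<Sigma>\<^sub>a x' = x \<cdot> u"
        using susp_full[OF cmp_hom[OF u x] K X[OF i]] by blast
      have "\<Sigma>\<^sub>a (\<iota> i \<cdot> x') = \<Sigma>\<^sub>a (\<iota> i) \<cdot> x \<cdot> u"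
        using susp.amap_cmp[OF x'(1) \<iota>[OF i]] x'(2) cmp_assoc[OF u x susp.amap_hom[OF \<iota>[OF i]]] by simp
      then show "\<exists>h\<in>H. h \<in> Homs T K S \<and> \<Sigma>\<^sub>a h = \<Sigma>\<^sub>a (\<iota> i) \<cdot> x \<cdot> u"
        using sm i x' cmp_hom[OF x'(1) \<iota>[OF i]] by blast
    qed
    moreover have "\<Sigma>\<^sub>a y \<cdot> v \<cdot> u = \<Sigma>\<^sub>a y"
      using cmp_assoc[OF u v Sy] vu ident_right[OF Sy] by simp
    ultimately show "y \<in> H" using susp_inj[OF _ y] by metis
  qed
qed

end

context compactly_generated
begin

text \<open>A map from \<Sigma>C to S can be desuspended only if S is a suspension. So the summands
  are desuspended, their coproduct S' is formed, and S becomes a retract of \<Sigma>S' by h g = 1;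
  then g y is desuspended to a map from C to S'.\<close>

lemma compact_susp:
  assumes C: "compact_object V T C"
  shows "compact_object V T (\<Sigma>\<^sub>o C)"
proof (rule compact_objectI)
  note C' = compact_objectD[OF C]
  show "\<Sigma>\<^sub>o C \<in> obj T" using C' by (rule susp.omap_obj)
  fix I :: "'v set" and X S \<iota>
  assume I: "small V I" and X: "\<And>i. i \<in> I \<Longrightarrow> X i \<in> obj T" and cop: "is_coproduct T I X S \<iota>"
  note S = coproductD(1)[OF cop] and \<iota> = coproductD(2)[OF cop]
  define P where "P i w \<longleftrightarrow> fst w \<in> obj T \<and> fst (snd w) \<in> Homs T (\<Sigma>\<^sub>o (fst w)) (X i) \<and>
      snd (snd w) \<in> Homs T (X i) (\<Sigma>\<^sub>o (fst w)) \<and> fst (snd w) \<cdot> snd (snd w) = ident T (X i)" for i w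
  define X' u v where "X' i = fst (SOME w. P i w)" and "u i = fst (snd (SOME w. P i w))"
    and "v i = snd (snd (SOME w. P i w))" for i
  have "P i (SOME w. P i w)" if "i \<in> I" for i
  proof (rule desuspension[OF X[OF that]])
    fix X' u v assume "X' \<in> obj T" "u \<in> Homs T (\<Sigma>\<^sub>o X') (X i)" "v \<in> Homs T (X i) (\<Sigma>\<^sub>o X')"
      "u \<cdot> v = ident T (X i)"
    then have "P i (X', u, v)" by (simp add: P_def)
    then show ?thesis by (rule someI)
  qed
  then have X': "X' i \<in> obj T" and u: "u i \<in> Homs T (\<Sigma>\<^sub>o (X' i)) (X i)"
    and v: "v i \<in> Homs T (X i) (\<Sigma>\<^sub>o (X' i))" and uv: "u i \<cdot> v i = ident T (X i)" if "i \<in> I" for i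
    using that unfolding P_def X'_def u_def v_def by blast+
  obtain S' \<iota>' where cop': "is_coproduct T I X' S' \<iota>'"
    using small_coproducts[OF I, of X'] X' by blast
  note S' = coproductD(1)[OF cop'] and \<iota>' = coproductD(2)[OF cop']
  note S\<iota>' = susp.amap_hom[OF \<iota>']
  obtain h where h: "h \<in> Homs T (\<Sigma>\<^sub>o S') S" "\<And>i. i \<in> I \<Longrightarrow> h \<cdot> \<Sigma>\<^sub>a (\<iota>' i) = \<iota> i \<cdot> u i"
    using coproduct_induced[OF coproduct_susp[OF cop' X'] S, of "\<lambda>i. \<iota> i \<cdot> u i"] cmp_hom[OF u \<iota>] by blast
  obtain g where g: "g \<in> Homs T S (\<Sigma>\<^sub>o S')" "\<And>i. i \<in> I \<Longrightarrow> g \<cdot> \<iota> i = \<Sigma>\<^sub>a (\<iota>' i) \<cdot> v i"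
    using coproduct_induced[OF cop susp.omap_obj[OF S'], of "\<lambda>i. \<Sigma>\<^sub>a (\<iota>' i) \<cdot> v i"] cmp_hom[OF v S\<iota>'] by blast
  have hg: "h \<cdot> g = ident T S"
  proof (rule coproduct_eqI[OF cop cmp_hom[OF g(1) h(1)] ident_hom[OF S]])
    fix i assume i: "i \<in> I"
    have "h \<cdot> g \<cdot> \<iota> i = h \<cdot> (\<Sigma>\<^sub>a (\<iota>' i) \<cdot> v i)" using cmp_assoc[OF \<iota>[OF i] g(1) h(1)] g(2)[OF i] by simp
    also have "\<dots> = \<iota> i \<cdot> (u i \<cdot> v i)"
      using cmp_assoc[OF v[OF i] S\<iota>'[OF i] h(1)] h(2)[OF i] cmp_assoc[OF v[OF i] u[OF i] \<iota>[OF i]] by simp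
    finally show "h \<cdot> g \<cdot> \<iota> i = ident T S \<cdot> \<iota> i"
      using uv[OF i] ident_right[OF \<iota>[OF i]] ident_left[OF \<iota>[OF i]] by simp
  qed
  note ind = sums_from_summands_induct[OF compact_object_sums[OF C I X' cop']]
  show "sums_from_summands T I X S \<iota> (\<Sigma>\<^sub>o C)"
    unfolding sums_from_summands_def
  proof (intro allI impI subsetI)
    fix H y
    assume z: "hom_zero T (\<Sigma>\<^sub>o C) S \<in> H"
      and add: "\<forall>a\<in>Homs T (\<Sigma>\<^sub>o C) S. \<forall>b\<in>Homs T (\<Sigma>\<^sub>o C) S. a \<in> H \<longrightarrow> b \<in> H \<longrightarrow> a \<uplus> b \<in> H"
      and sm: "\<forall>i\<in>I. \<forall>x\<in>Homs T (\<Sigma>\<^sub>o C) (X i). \<iota> i \<cdot> x \<in> H" and y: "y \<in> Homs T (\<Sigma>\<^sub>o C) S"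
    obtain y' where y': "y' \<in> Homs T C S'" "\<Sigma>\<^sub>a y' = g \<cdot> y"
      using susp_full[OF cmp_hom[OF y g(1)] C' S'] by blast
    have "h \<cdot> \<Sigma>\<^sub>a y' \<in> H"
    proof (rule ind[OF _ y'(1)])
      show "\<And>i. i \<in> I \<Longrightarrow> i \<in> I" .
      show "h \<cdot> \<Sigma>\<^sub>a (hom_zero T C S') \<in> H"
        using z susp.amap_zero[OF C' S'] cmp_zero_right[OF h(1) susp.omap_obj[OF C']] by simp
    next
      fix a b assume a: "a \<in> Homs T C S'" "h \<cdot> \<Sigma>\<^sub>a a \<in> H" and b: "b \<in> Homs T C S'" "h \<cdot> \<Sigma>\<^sub>a b \<in> H"
      show "h \<cdot> \<Sigma>\<^sub>a (a \<uplus> b) \<in> H"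
        using susp.amap_add[OF a(1) b(1)] add a b cmp_hom[OF susp.amap_hom[OF a(1)] h(1)]
          cmp_hom[OF susp.amap_hom[OF b(1)] h(1)]
          cmp_add_right[OF susp.amap_hom[OF a(1)] susp.amap_hom[OF b(1)] h(1)] by simp
    next
      fix i x assume i: "i \<in> I" and x: "x \<in> Homs T C (X' i)"
      note Sx = susp.amap_hom[OF x]
      have "h \<cdot> \<Sigma>\<^sub>a (\<iota>' i \<cdot> x) = \<iota> i \<cdot> (u i \<cdot> \<Sigma>\<^sub>a x)"
        using susp.amap_cmp[OF x \<iota>'[OF i]] cmp_assoc[OF Sx S\<iota>'[OF i] h(1)] h(2)[OF i]
          cmp_assoc[OF Sx u[OF i] \<iota>[OF i]] by simp
      then show "h \<cdot> \<Sigma>\<^sub>a (\<iota>' i \<cdot> x) \<in> H" using sm i cmp_hom[OF Sx u[OF i]] by simp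
    qed
    then show "y \<in> H"
      using y'(2) cmp_assoc[OF y g(1) h(1)] hg ident_left[OF y] by simp
  qed
qed

end


section \<open>Groups of homomorphisms, and characters with values in Q/Z\<close>

section \<open>Groups of homomorphisms\<close>

lemma hom_group_simps [simp]:
  "carrier (hom_group G H) = hom G H \<inter> extensional (carrier G)"
  "mult (hom_group G H) = (\<lambda>\<phi> \<psi>. \<lambda>x \<in> carrier G. \<phi> x \<otimes>\<^bsub>H\<^esub> \<psi> x)"
  "one (hom_group G H) = (\<lambda>x \<in> carrier G. \<one>\<^bsub>H\<^esub>)"
  by (simp_all add: hom_group_def)

lemma comm_group_hom_group:
  assumes "group G" "comm_group H"
  shows "comm_group (hom_group G H)"
proof -
  interpret G: group G by fact
  interpret H: comm_group H by fact
  have cl: "\<phi> x \<in> carrier H" if "\<phi> \<in> hom G H" "x \<in> carrier G" for \<phi> x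
    using that by (rule hom_in_carrier)
  show ?thesis
  proof (rule comm_groupI)
    fix \<phi> \<psi> assume "\<phi> \<in> carrier (hom_group G H)" "\<psi> \<in> carrier (hom_group G H)"
    then have \<phi>: "\<phi> \<in> hom G H" and \<psi>: "\<psi> \<in> hom G H" by auto
    have "(\<lambda>x\<in>carrier G. \<phi> x \<otimes>\<^bsub>H\<^esub> \<psi> x) \<in> hom G H"
      by (rule homI)
        (auto simp: cl[OF \<phi>] cl[OF \<psi>] hom_mult[OF \<phi>] hom_mult[OF \<psi>] H.m_ac)
    then show "\<phi> \<otimes>\<^bsub>hom_group G H\<^esub> \<psi> \<in> carrier (hom_group G H)" by simp
    show "\<phi> \<otimes>\<^bsub>hom_group G H\<^esub> \<psi> = \<psi> \<otimes>\<^bsub>hom_group G H\<^esub> \<phi>"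
      by (auto simp: cl[OF \<phi>] cl[OF \<psi>] H.m_comm intro!: restrict_ext)
  next
    show "\<one>\<^bsub>hom_group G H\<^esub> \<in> carrier (hom_group G H)"
      by (auto intro!: homI)
  next
    fix \<phi> \<psi> \<chi>
    assume "\<phi> \<in> carrier (hom_group G H)" "\<psi> \<in> carrier (hom_group G H)" "\<chi> \<in> carrier (hom_group G H)"
    then have "\<phi> \<in> hom G H" "\<psi> \<in> hom G H" "\<chi> \<in> hom G H" by auto
    then show "\<phi> \<otimes>\<^bsub>hom_group G H\<^esub> \<psi> \<otimes>\<^bsub>hom_group G H\<^esub> \<chi> = \<phi> \<otimes>\<^bsub>hom_group G H\<^esub> (\<psi> \<otimes>\<^bsub>hom_group G H\<^esub> \<chi>)"
      by (auto simp: cl H.m_assoc intro!: restrict_ext)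
  next
    fix \<phi> assume \<phi>: "\<phi> \<in> carrier (hom_group G H)"
    then have h: "\<phi> \<in> hom G H" and e: "\<phi> \<in> extensional (carrier G)" by auto
    show "\<one>\<^bsub>hom_group G H\<^esub> \<otimes>\<^bsub>hom_group G H\<^esub> \<phi> = \<phi>"
      by (rule extensionalityI[OF _ e]) (auto simp: cl[OF h])
    let ?\<psi> = "\<lambda>x\<in>carrier G. inv\<^bsub>H\<^esub> (\<phi> x)"
    have "?\<psi> \<in> hom G H"
      by (rule homI) (auto simp: cl[OF h] hom_mult[OF h] H.inv_mult)
    moreover have "?\<psi> \<otimes>\<^bsub>hom_group G H\<^esub> \<phi> = \<one>\<^bsub>hom_group G H\<^esub>"
      by (auto simp: cl[OF h] intro!: restrict_ext)
    ultimately show "\<exists>\<psi>\<in>carrier (hom_group G H). \<psi> \<otimes>\<^bsub>hom_group G H\<^esub> \<phi> = \<one>\<^bsub>hom_group G H\<^esub>"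
      by (intro bexI[of _ ?\<psi>]) auto
  qed
qed

lemma comm_group_QZ: "comm_group QZ"
proof -
  let ?Q = "\<lparr>carrier = UNIV, mult = (+), one = 0\<rparr> :: rat monoid"
  have Q: "comm_group ?Q"
    by (rule comm_groupI) (auto intro: exI[of _ "- _"] simp: add.commute)
  interpret Q: comm_group ?Q by (rule Q)
  have inv: "inv\<^bsub>?Q\<^esub> x = - x" for x
    by (rule Q.inv_equality) auto
  have "subgroup \<int> ?Q"
    by (rule Q.subgroupI) (auto simp: inv)
  then show ?thesis
    unfolding QZ_def by (rule Q.abelian_FactGroup)
qed

lemma countable_QZ: "countable (carrier QZ)"
proof -
  have "carrier QZ = range (\<lambda>a. \<int> #>\<^bsub>\<lparr>carrier = UNIV, mult = (+), one = 0\<rparr>\<^esub> (a :: rat))"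
    by (auto simp: QZ_def FactGroup_def RCOSETS_def)
  then show ?thesis by simp
qed

lemma small_hom_group_QZ:
  assumes "grothendieck_universe V" "small V (carrier G)"
  shows "small V (carrier (hom_group G QZ))"
  by (rule small_extensional_funcset[OF assms small_countable[OF assms(1) countable_QZ]])
    (auto simp: hom_def)


section \<open>Small abelian groups over \<open>'v\<close> as a preadditive category\<close>

section \<open>The category of abelian groups\<close>

lemma Homs_Ab:
  "Homs Ab G H = {(G, H, \<phi>) | \<phi>. comm_group G \<and> small TYPE('v) (carrier G) \<and>
     comm_group H \<and> small TYPE('v) (carrier H) \<and> \<phi> \<in> hom G H \<and> \<phi> \<in> extensional (carrier G)}"
  for G H :: "'v monoid"
  by (auto simp: Homs_def Ab_def)

lemma Ab_simps [simp]:
  "obj (Ab :: ('v monoid, 'v ab_arr) preadd) = {G. comm_group G \<and> small TYPE('v) (carrier G)}"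
  "src (Ab :: ('v monoid, 'v ab_arr) preadd) (G, H, \<phi>) = G"
  "tgt (Ab :: ('v monoid, 'v ab_arr) preadd) (G, H, \<phi>) = H"
  "ident (Ab :: ('v monoid, 'v ab_arr) preadd) G = (G, G, \<lambda>x \<in> carrier G. x)"
  "cmp (Ab :: ('v monoid, 'v ab_arr) preadd) (H', K, \<psi>) (G, H, \<phi>) = (G, K, compose (carrier G) \<psi> \<phi>)"
  "hom_add (Ab :: ('v monoid, 'v ab_arr) preadd) (G, H, \<phi>) (G', H', \<psi>) = (G, H, \<lambda>x\<in>carrier G. \<phi> x \<otimes>\<^bsub>H\<^esub> \<psi> x)"
  "hom_zero (Ab :: ('v monoid, 'v ab_arr) preadd) G H = (G, H, \<lambda>x \<in> carrier G. \<one>\<^bsub>H\<^esub>)"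
  by (simp_all add: Ab_def)

lemma preadditive_category_Ab: "preadditive_category (Ab :: ('v monoid, 'v ab_arr) preadd)"
proof (rule preadditive_category.intro)
  let ?A = "Ab :: ('v monoid, 'v ab_arr) preadd"
  show "src ?A f \<in> obj ?A" "tgt ?A f \<in> obj ?A" if "f \<in> arr ?A" for f
    using that by (auto simp: Ab_def)
  show "ident ?A G \<in> Homs ?A G G" if "G \<in> obj ?A" for G
  proof -
    interpret comm_group G using that by simp
    show ?thesis using that by (auto simp: Homs_Ab intro!: homI)
  qed
  show "g \<cdot>\<^bsub>?A\<^esub> f \<in> Homs ?A X Z" if "f \<in> Homs ?A X Y" "g \<in> Homs ?A Y Z" for f g X Y Z
    using that by (auto simp: Homs_Ab compose_def hom_def Pi_iff monoid.m_closed
        group.is_monoid[OF comm_group.axioms(2)])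
  show "ident ?A Y \<cdot>\<^bsub>?A\<^esub> f = f" if "f \<in> Homs ?A X Y" for f X Y
    using that by (auto simp: Homs_Ab compose_def fun_eq_iff extensional_def hom_in_carrier)
  show "f \<cdot>\<^bsub>?A\<^esub> ident ?A X = f" if "f \<in> Homs ?A X Y" for f X Y
    using that by (auto simp: Homs_Ab compose_def fun_eq_iff extensional_def)
  show "h \<cdot>\<^bsub>?A\<^esub> (g \<cdot>\<^bsub>?A\<^esub> f) = h \<cdot>\<^bsub>?A\<^esub> g \<cdot>\<^bsub>?A\<^esub> f"
    if "f \<in> Homs ?A W X" "g \<in> Homs ?A X Y" "h \<in> Homs ?A Y Z" for f g h W X Y Z
    using that by (auto simp: Homs_Ab compose_def fun_eq_iff extensional_def hom_in_carrier)
  show "comm_group (HomG ?A X Y)" if XY: "X \<in> obj ?A" "Y \<in> obj ?A" for X Y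
  proof -
    interpret H: comm_group "hom_group X Y"
      using XY comm_group_hom_group[of X Y] comm_group.axioms(2) by auto
    \<comment> \<open>Up to the tags X and Y, the hom-group in \<open>Ab\<close> is
      \<open>hom_group X Y\<close>; the group axioms are carried through the tags.\<close>
    have cH: "f \<in> carrier (HomG ?A X Y) \<longleftrightarrow> (\<exists>\<phi>\<in>carrier (hom_group X Y). f = (X, Y, \<phi>))" for f
      using XY by (auto simp: Homs_Ab)
    have mH: "(X, Y, \<phi>) \<otimes>\<^bsub>HomG ?A X Y\<^esub> (X, Y, \<psi>) = (X, Y, \<phi> \<otimes>\<^bsub>hom_group X Y\<^esub> \<psi>)" for \<phi> \<psi>
      by simp
    have oH: "\<one>\<^bsub>HomG ?A X Y\<^esub> = (X, Y, \<one>\<^bsub>hom_group X Y\<^esub>)" by simp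
    show ?thesis
    proof (rule comm_groupI, unfold cH oH)
      fix f g h assume "\<exists>\<phi>\<in>carrier (hom_group X Y). f = (X, Y, \<phi>)"
        "\<exists>\<phi>\<in>carrier (hom_group X Y). g = (X, Y, \<phi>)" "\<exists>\<phi>\<in>carrier (hom_group X Y). h = (X, Y, \<phi>)"
      then obtain \<phi> \<psi> \<chi> where fgh: "\<phi> \<in> carrier (hom_group X Y)" "\<psi> \<in> carrier (hom_group X Y)"
        "\<chi> \<in> carrier (hom_group X Y)" "f = (X, Y, \<phi>)" "g = (X, Y, \<psi>)" "h = (X, Y, \<chi>)" by blast
      show "f \<otimes>\<^bsub>HomG ?A X Y\<^esub> g \<otimes>\<^bsub>HomG ?A X Y\<^esub> h = f \<otimes>\<^bsub>HomG ?A X Y\<^esub> (g \<otimes>\<^bsub>HomG ?A X Y\<^esub> h)"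
        unfolding fgh(4-6) mH by (rule arg_cong[where f = "\<lambda>a. (X, Y, a)", OF H.m_assoc[OF fgh(1-3)]])
    next
      fix f g assume "\<exists>\<phi>\<in>carrier (hom_group X Y). f = (X, Y, \<phi>)"
        "\<exists>\<phi>\<in>carrier (hom_group X Y). g = (X, Y, \<phi>)"
      then obtain \<phi> \<psi> where fg: "\<phi> \<in> carrier (hom_group X Y)" "\<psi> \<in> carrier (hom_group X Y)"
        "f = (X, Y, \<phi>)" "g = (X, Y, \<psi>)" by blast
      show "f \<otimes>\<^bsub>HomG ?A X Y\<^esub> g = g \<otimes>\<^bsub>HomG ?A X Y\<^esub> f"
        unfolding fg(3,4) mH by (rule arg_cong[where f = "\<lambda>a. (X, Y, a)", OF H.m_comm[OF fg(1,2)]])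
      show "\<exists>\<phi>\<in>carrier (hom_group X Y). f \<otimes>\<^bsub>HomG ?A X Y\<^esub> g = (X, Y, \<phi>)"
        unfolding fg(3,4) mH using H.m_closed[OF fg(1,2)] by blast
    next
      show "\<exists>\<phi>\<in>carrier (hom_group X Y). (X, Y, \<one>\<^bsub>hom_group X Y\<^esub>) = (X, Y, \<phi>)"
        using H.one_closed by blast
    next
      fix f assume "\<exists>\<phi>\<in>carrier (hom_group X Y). f = (X, Y, \<phi>)"
      then obtain \<phi> where f: "\<phi> \<in> carrier (hom_group X Y)" "f = (X, Y, \<phi>)" by blast
      show "(X, Y, \<one>\<^bsub>hom_group X Y\<^esub>) \<otimes>\<^bsub>HomG ?A X Y\<^esub> f = f"
        unfolding f(2) mH by (rule arg_cong[where f = "\<lambda>a. (X, Y, a)", OF H.l_one[OF f(1)]])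
      show "\<exists>g\<in>carrier (HomG ?A X Y). g \<otimes>\<^bsub>HomG ?A X Y\<^esub> f = (X, Y, \<one>\<^bsub>hom_group X Y\<^esub>)"
        unfolding f(2)
        by (rule bexI[of _ "(X, Y, inv\<^bsub>hom_group X Y\<^esub> \<phi>)"])
          (use H.l_inv[OF f(1)] H.inv_closed[OF f(1)] in \<open>unfold mH cH, blast+\<close>)
    qed
  qed
  show "hom_add ?A g g' \<cdot>\<^bsub>?A\<^esub> f = hom_add ?A (g \<cdot>\<^bsub>?A\<^esub> f) (g' \<cdot>\<^bsub>?A\<^esub> f)"
    if "f \<in> Homs ?A X Y" "g \<in> Homs ?A Y Z" "g' \<in> Homs ?A Y Z" for f g g' X Y Z
    using that by (auto simp: Homs_Ab compose_def fun_eq_iff hom_in_carrier)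
  show "g \<cdot>\<^bsub>?A\<^esub> hom_add ?A f f' = hom_add ?A (g \<cdot>\<^bsub>?A\<^esub> f) (g \<cdot>\<^bsub>?A\<^esub> f')"
    if "f \<in> Homs ?A X Y" "f' \<in> Homs ?A X Y" "g \<in> Homs ?A Y Z" for f f' g X Y Z
    using that by (auto simp: Homs_Ab compose_def fun_eq_iff hom_in_carrier hom_mult)
qed

lemma ab_copy_simps [simp]:
  assumes "small TYPE('v) (carrier G)"
  shows "carrier (ab_copy G :: 'v monoid) = label (carrier G) ` carrier G"
    "x \<in> carrier G \<Longrightarrow> y \<in> carrier G \<Longrightarrow>
      label (carrier G) x \<otimes>\<^bsub>(ab_copy G :: 'v monoid)\<^esub> label (carrier G) y = label (carrier G) (x \<otimes>\<^bsub>G\<^esub> y)"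
    "\<one>\<^bsub>(ab_copy G :: 'v monoid)\<^esub> = label (carrier G) \<one>\<^bsub>G\<^esub>"
  using assms by (simp_all add: ab_copy_def)

lemma comm_group_ab_copy:
  assumes G: "comm_group G" and s: "small TYPE('v) (carrier G)"
  shows "comm_group (ab_copy G :: 'v monoid)"
proof -
  interpret G: comm_group G by fact
  have l: "\<exists>y\<in>carrier (ab_copy G :: 'v monoid). y \<otimes>\<^bsub>(ab_copy G :: 'v monoid)\<^esub> label (carrier G) x
      = label (carrier G) \<one>\<^bsub>G\<^esub>" if "x \<in> carrier G" for x
    using that s by (intro bexI[of _ "label (carrier G) (inv\<^bsub>G\<^esub> x)"]) auto
  show ?thesis
    by (rule comm_groupI) (use s l in \<open>auto simp: G.m_ac\<close>)
qed

lemma small_ab_copy: "small TYPE('v) (carrier G) \<Longrightarrow> small TYPE('v) (carrier (ab_copy G :: 'v monoid))"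
  by (simp add: small_image)


section \<open>Contravariant modules without labels, their homomorphisms and retracts\<close>

section \<open>Modules with values in arbitrary types\<close>

text \<open>
  The labels introduced by \<^const>\<open>ab_copy\<close> are avoided by working with modules whose values are
  groups over arbitrary types; the action of an arrow is a plain function.
\<close>

type_synonym ('o, 'm, 'a) rmod = "('o, 'm, 'a monoid, 'a \<Rightarrow> 'a) fctr"

locale raw_module = preadditive_category C
  for V :: "'v itself" and C :: "('o, 'm, 'z) preadd_scheme" +
  fixes M :: "('o, 'm, 'a) rmod"
  assumes comm_grp: "X \<in> obj C \<Longrightarrow> comm_group (omap M X)"
    and small_grp: "X \<in> obj C \<Longrightarrow> small V (carrier (omap M X))"
    and act_hom: "c \<in> Homs C X Y \<Longrightarrow> amap M c \<in> hom (omap M Y) (omap M X)"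
    and act_ident: "X \<in> obj C \<Longrightarrow> x \<in> carrier (omap M X) \<Longrightarrow> amap M (ident C X) x = x"
    and act_cmp: "c \<in> Homs C X Y \<Longrightarrow> d \<in> Homs C Y Z \<Longrightarrow> x \<in> carrier (omap M Z) \<Longrightarrow>
      amap M (d \<cdot>\<^bsub>C\<^esub> c) x = amap M c (amap M d x)"
    and act_add: "c \<in> Homs C X Y \<Longrightarrow> d \<in> Homs C X Y \<Longrightarrow> x \<in> carrier (omap M Y) \<Longrightarrow>
      amap M (hom_add C c d) x = amap M c x \<otimes>\<^bsub>omap M X\<^esub> amap M d x"
begin

lemma act_closed: "c \<in> Homs C X Y \<Longrightarrow> x \<in> carrier (omap M Y) \<Longrightarrow> amap M c x \<in> carrier (omap M X)"
  using act_hom by (rule hom_in_carrier)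

lemma grp: "X \<in> obj C \<Longrightarrow> group (omap M X)"
  using comm_grp comm_group.axioms(2) by blast

end

definition raw_hom :: "('o, 'm, 'z) preadd_scheme \<Rightarrow> ('o, 'm, 'a) rmod \<Rightarrow> ('o, 'm, 'b) rmod
    \<Rightarrow> ('o \<Rightarrow> 'a \<Rightarrow> 'b) \<Rightarrow> bool" where
  "raw_hom C M N \<phi> \<longleftrightarrow> (\<forall>X \<in> obj C. \<phi> X \<in> hom (omap M X) (omap N X)) \<and>
    (\<forall>X Y. \<forall>c \<in> Homs C X Y. \<forall>x \<in> carrier (omap M Y). \<phi> X (amap M c x) = amap N c (\<phi> Y x))"

lemma raw_homI:
  assumes "\<And>X x. X \<in> obj C \<Longrightarrow> x \<in> carrier (omap M X) \<Longrightarrow> \<phi> X x \<in> carrier (omap N X)"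
    and "\<And>X x y. X \<in> obj C \<Longrightarrow> x \<in> carrier (omap M X) \<Longrightarrow> y \<in> carrier (omap M X) \<Longrightarrow>
      \<phi> X (x \<otimes>\<^bsub>omap M X\<^esub> y) = \<phi> X x \<otimes>\<^bsub>omap N X\<^esub> \<phi> X y"
    and "\<And>X Y c x. c \<in> Homs C X Y \<Longrightarrow> x \<in> carrier (omap M Y) \<Longrightarrow> \<phi> X (amap M c x) = amap N c (\<phi> Y x)"
  shows "raw_hom C M N \<phi>"
  using assms by (auto simp: raw_hom_def intro!: homI)

lemma raw_homD:
  assumes "raw_hom C M N \<phi>"
  shows "X \<in> obj C \<Longrightarrow> \<phi> X \<in> hom (omap M X) (omap N X)"
    "X \<in> obj C \<Longrightarrow> x \<in> carrier (omap M X) \<Longrightarrow> \<phi> X x \<in> carrier (omap N X)"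
    "X \<in> obj C \<Longrightarrow> x \<in> carrier (omap M X) \<Longrightarrow> y \<in> carrier (omap M X) \<Longrightarrow>
      \<phi> X (x \<otimes>\<^bsub>omap M X\<^esub> y) = \<phi> X x \<otimes>\<^bsub>omap N X\<^esub> \<phi> X y"
    "c \<in> Homs C X Y \<Longrightarrow> x \<in> carrier (omap M Y) \<Longrightarrow> \<phi> X (amap M c x) = amap N c (\<phi> Y x)"
  using assms by (auto simp: raw_hom_def hom_def)

lemma raw_hom_id: "raw_hom C M M (\<lambda>X x. x)"
  by (simp add: raw_hom_def hom_def)

lemma raw_hom_comp:
  assumes C: "preadditive_category C" and "raw_hom C L M \<phi>" "raw_hom C M N \<psi>"
  shows "raw_hom C L N (\<lambda>X x. \<psi> X (\<phi> X x))"
  using raw_homD[OF assms(2)] raw_homD[OF assms(3)] preadditive_category.Homs_obj[OF C]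
  by (intro raw_homI) simp_all

text \<open>The two modules may take values in different types and only elements of the carriers are
  compared, so mutual retracts can stand in for isomorphisms between a module and a relabelled or
  otherwise computed copy.\<close>

definition raw_retract :: "('o, 'm, 'z) preadd_scheme \<Rightarrow> ('o, 'm, 'a) rmod \<Rightarrow> ('o, 'm, 'b) rmod \<Rightarrow> bool" where
  "raw_retract C M N \<longleftrightarrow> (\<exists>s r. raw_hom C M N s \<and> raw_hom C N M r \<and>
    (\<forall>X \<in> obj C. \<forall>x \<in> carrier (omap M X). r X (s X x) = x))"

lemma raw_retract_trans:
  assumes C: "preadditive_category C" and LM: "raw_retract C L M" and MN: "raw_retract C M N"
  shows "raw_retract C L N"
proof -
  obtain s r where sr: "raw_hom C L M s" "raw_hom C M L r"
    "\<forall>X \<in> obj C. \<forall>x \<in> carrier (omap L X). r X (s X x) = x"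
    using LM unfolding raw_retract_def by blast
  obtain s' r' where sr': "raw_hom C M N s'" "raw_hom C N M r'"
    "\<forall>X \<in> obj C. \<forall>x \<in> carrier (omap M X). r' X (s' X x) = x"
    using MN unfolding raw_retract_def by blast
  have "\<forall>X \<in> obj C. \<forall>x \<in> carrier (omap L X). r X (r' X (s' X (s X x))) = x"
    using sr sr' raw_homD(2)[OF sr(1)] by simp
  then show ?thesis
    unfolding raw_retract_def
    using raw_hom_comp[OF C sr(1) sr'(1)] raw_hom_comp[OF C sr'(2) sr(2)] by blast
qed


section \<open>Passage between unlabelled modules and the category of modules\<close>

section \<open>Comparison with the category of modules\<close>

definition underlying :: "('o, 'm, 'v) abmod \<Rightarrow> ('o, 'm, 'v) rmod" where
  "underlying F = \<lparr>omap = omap F, amap = (\<lambda>c. snd (snd (amap F c)))\<rparr>"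

definition copy_mod :: "('o, 'm, 'z) preadd_scheme \<Rightarrow> ('o, 'm, 'a) rmod \<Rightarrow> ('o, 'm, 'v) abmod" where
  "copy_mod C M = \<lparr>omap = (\<lambda>X. ab_copy (omap M X)),
    amap = (\<lambda>c. ab_copy_hom (omap M (tgt C c)) (omap M (src C c)) (amap M c))\<rparr>"

text \<open>The last entry of an arrow of modules is a family of arrows of \<open>Ab\<close>, which
  are triples themselves; this is the underlying function at X.\<close>

definition component :: "('o, 'm, 'v) abmod_arr \<Rightarrow> 'o \<Rightarrow> 'v \<Rightarrow> 'v" where
  "component \<alpha> X = snd (snd (snd (snd \<alpha>) X))"

lemma underlying_simps [simp]:
  "omap (underlying F) = omap F" "amap (underlying F) c = snd (snd (amap F c))"
  by (simp_all add: underlying_def)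

lemma Mod_cat_simps [simp]:
  "obj (Mod_cat V C) = {F. additive_functor (op_cat C) Ab F}"
  "ident (Mod_cat V C) F = (F, F, \<lambda>X \<in> obj C. ident Ab (omap F X))"
  "cmp (Mod_cat V C) (G', H, \<theta>) (F, G, \<eta>) = (F, H, \<lambda>X \<in> obj C. \<theta> X \<cdot>\<^bsub>Ab\<^esub> \<eta> X)"
  "src (Mod_cat V C) (F, G, \<eta>) = F"
  "tgt (Mod_cat V C) (F, G, \<eta>) = G"
  by (simp_all add: Mod_cat_def additive_functor_category_def)

lemma Homs_Mod_cat:
  "Homs (Mod_cat V C) F G = {(F, G, \<eta>) | \<eta>. additive_functor (op_cat C) Ab F \<and>
    additive_functor (op_cat C) Ab G \<and> \<eta> \<in> extensional (obj C) \<and> nat_trans (op_cat C) Ab F G \<eta>}"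
  by (auto simp: Homs_def Mod_cat_def additive_functor_category_def)

lemma mod_amap:
  assumes F: "additive_functor (op_cat C) (Ab :: ('v monoid, 'v ab_arr) preadd) F" and c: "c \<in> Homs C X Y"
  shows "amap F c = (omap F Y, omap F X, amap (underlying F) c)"
    "amap (underlying F) c \<in> hom (omap F Y) (omap F X)"
    "amap (underlying F) c \<in> extensional (carrier (omap F Y))"
proof -
  interpret additive_functor "op_cat C" "Ab :: ('v monoid, 'v ab_arr) preadd" F by (rule F)
  have "amap F c \<in> Homs (Ab :: ('v monoid, 'v ab_arr) preadd) (omap F Y) (omap F X)"
    using amap_hom[of c Y X] c by simp
  then show "amap F c = (omap F Y, omap F X, amap (underlying F) c)"
    "amap (underlying F) c \<in> hom (omap F Y) (omap F X)"
    "amap (underlying F) c \<in> extensional (carrier (omap F Y))"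
    by (auto simp: Homs_Ab)
qed

lemma raw_module_underlying:
  assumes C: "preadditive_category C" and F: "F \<in> obj (Mod_cat (V :: 'v itself) C)"
  shows "raw_module V C (underlying F)"
proof -
  interpret C: preadditive_category C by fact
  have F': "additive_functor (op_cat C) (Ab :: ('v monoid, 'v ab_arr) preadd) F" using F by simp
  interpret F: additive_functor "op_cat C" "Ab :: ('v monoid, 'v ab_arr) preadd" F by (rule F')
  have o: "comm_group (omap F X) \<and> small V (carrier (omap F X))" if "X \<in> obj C" for X
    using F.omap_obj[of X] that by (simp add: small_def)
  show ?thesis
  proof (intro raw_module.intro raw_module_axioms.intro C)
    fix X assume X: "X \<in> obj C"
    show "comm_group (omap (underlying F) X)" "small V (carrier (omap (underlying F) X))"
      using o[OF X] by simp_all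
    show "amap (underlying F) (ident C X) x = x" if "x \<in> carrier (omap (underlying F) X)" for x
      using F.amap_ident[of X] X that by simp
  next
    fix c X Y assume "c \<in> Homs C X Y"
    from mod_amap(2)[OF F' this]
    show "amap (underlying F) c \<in> hom (omap (underlying F) Y) (omap (underlying F) X)" by simp
  next
    fix c X Y d Z x
    assume c: "c \<in> Homs C X Y" and d: "d \<in> Homs C Y Z" and x: "x \<in> carrier (omap (underlying F) Z)"
    have "amap F (d \<cdot>\<^bsub>C\<^esub> c) = amap F c \<cdot>\<^bsub>Ab\<^esub> amap F d"
      using F.amap_cmp[of d Z Y c X] c d by simp
    then show "amap (underlying F) (d \<cdot>\<^bsub>C\<^esub> c) x = amap (underlying F) c (amap (underlying F) d x)"
      using mod_amap(1)[OF F' c] mod_amap(1)[OF F' d] mod_amap(1)[OF F' C.cmp_hom[OF c d]] x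
      by (simp add: compose_def del: underlying_simps(2))
  next
    fix c X Y d x
    assume c: "c \<in> Homs C X Y" and d: "d \<in> Homs C X Y" and x: "x \<in> carrier (omap (underlying F) Y)"
    have "amap F (hom_add C c d) = hom_add Ab (amap F c) (amap F d)"
      using F.amap_add[of c Y X d] c d by simp
    then show "amap (underlying F) (hom_add C c d) x =
        amap (underlying F) c x \<otimes>\<^bsub>omap (underlying F) X\<^esub> amap (underlying F) d x"
      using mod_amap(1)[OF F' c] mod_amap(1)[OF F' d] mod_amap(1)[OF F' C.add_hom[OF c d]] x
      by (simp del: underlying_simps(2))
  qed
qed

context raw_module
begin

text \<open>\<open>V\<close> is a variable of the one-element type \<open>'v itself\<close>, whereas
  constants such as \<open>Ab\<close> and \<open>ab_copy\<close> are governed by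
  \<open>TYPE('v)\<close>. Smallness ignores this argument, so the two forms agree.\<close>

lemma small_TYPE: "X \<in> obj C \<Longrightarrow> small TYPE('v) (carrier (omap M X))"
  using small_grp by (simp add: small_def)

lemma copy_amap:
  assumes "c \<in> Homs C X Y"
  shows "amap (copy_mod C M :: ('o, 'm, 'v) abmod) c = (ab_copy (omap M Y), ab_copy (omap M X),
    \<lambda>x \<in> label (carrier (omap M Y)) ` carrier (omap M Y).
      label (carrier (omap M X)) (amap M c (unlabel (carrier (omap M Y)) x)))"
  using assms Homs_obj[OF assms] small_TYPE HomsD[OF assms]
  by (simp add: copy_mod_def ab_copy_hom_def)

lemma copy_mod_obj: "(copy_mod C M :: ('o, 'm, 'v) abmod) \<in> obj (Mod_cat V C)"
proof -
  let ?A = "Ab :: ('v monoid, 'v ab_arr) preadd"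
  let ?F = "copy_mod C M :: ('o, 'm, 'v) abmod"
  note sm = small_TYPE
  have om: "omap ?F X = ab_copy (omap M X)" for X by (simp add: copy_mod_def)
  interpret A: preadditive_category ?A by (rule preadditive_category_Ab)
  have "additive_functor (op_cat C) ?A ?F"
  proof (intro additive_functor.intro category_functor.intro category_functor_axioms.intro
      additive_functor_axioms.intro preadditive_category_op_cat preadditive_category_Ab)
    show "preadditive_category C" by unfold_locales
    show "omap ?F X \<in> obj ?A" if "X \<in> obj (op_cat C)" for X
      using that comm_group_ab_copy[OF comm_grp sm] small_ab_copy[OF sm]
      by (simp add: copy_mod_def del: ab_copy_simps)
    show "amap ?F c \<in> Homs ?A (omap ?F X) (omap ?F Y)" if "c \<in> Homs (op_cat C) X Y" for c X Y
    proof -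
      have c: "c \<in> Homs C Y X" using that by simp
      note o = Homs_obj[OF c]
      note s = sm[OF conjunct1[OF o]] sm[OF conjunct2[OF o]]
      let ?f = "\<lambda>x \<in> (label (carrier (omap M X)) ` carrier (omap M X) :: 'v set).
        label (carrier (omap M Y)) (amap M c (unlabel (carrier (omap M X)) x)) :: 'v"
      have "?f \<in> hom (ab_copy (omap M X)) (ab_copy (omap M Y))"
      proof (rule homI)
        interpret X: comm_group "omap M X" using comm_grp o by blast
        show "?f x \<in> carrier (ab_copy (omap M Y))" if "x \<in> carrier (ab_copy (omap M X))" for x
          using that s act_closed[OF c] by auto
        show "?f (x \<otimes>\<^bsub>ab_copy (omap M X)\<^esub> y) = ?f x \<otimes>\<^bsub>ab_copy (omap M Y)\<^esub> ?f y"
          if xy: "x \<in> carrier (ab_copy (omap M X))" "y \<in> carrier (ab_copy (omap M X))" for x y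
        proof -
          obtain x' y' where "x' \<in> carrier (omap M X)" "y' \<in> carrier (omap M X)"
            "x = label (carrier (omap M X)) x'" "y = label (carrier (omap M X)) y'"
            using xy s(2) by auto
          then show ?thesis
            using s act_closed[OF c] hom_mult[OF act_hom[OF c]] X.m_closed by simp
        qed
      qed
      then show ?thesis
        using o comm_group_ab_copy[OF comm_grp sm] small_ab_copy[OF sm] s
        by (simp add: copy_amap[OF c] Homs_Ab om small_image)
    qed
    show "amap ?F (ident (op_cat C) X) = ident ?A (omap ?F X)" if "X \<in> obj (op_cat C)" for X
    proof -
      have X: "X \<in> obj C" using that by simp
      show ?thesis
        using sm[OF X] X
        by (auto simp: copy_amap[OF ident_hom[OF X]] act_ident om intro!: restrict_ext)
    qed
    show "amap ?F (g \<cdot>\<^bsub>op_cat C\<^esub> f) = amap ?F g \<cdot>\<^bsub>?A\<^esub> amap ?F f"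
      if "f \<in> Homs (op_cat C) X Y" "g \<in> Homs (op_cat C) Y Z" for f g X Y Z
    proof -
      have f: "f \<in> Homs C Y X" and g: "g \<in> Homs C Z Y" using that by simp_all
      show ?thesis
        using sm[of X] sm[of Y] sm[of Z] Homs_obj[OF f] Homs_obj[OF g] act_closed[OF f]
        by (auto simp: copy_amap[OF f] copy_amap[OF g] copy_amap[OF cmp_hom[OF g f]] act_cmp[OF g f]
            compose_def intro!: restrict_ext)
    qed
    show "amap ?F (hom_add (op_cat C) f g) = hom_add ?A (amap ?F f) (amap ?F g)"
      if "f \<in> Homs (op_cat C) X Y" "g \<in> Homs (op_cat C) X Y" for f g X Y
    proof -
      have f: "f \<in> Homs C Y X" and g: "g \<in> Homs C Y X" using that by simp_all
      show ?thesis
        using sm[of X] sm[of Y] Homs_obj[OF f] act_closed[OF f] act_closed[OF g]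
        by (auto simp: copy_amap[OF f] copy_amap[OF g] copy_amap[OF add_hom[OF f g]] act_add[OF f g]
            intro!: restrict_ext)
    qed
  qed
  then show ?thesis by simp
qed

lemma raw_hom_label:
  "raw_hom C M (underlying (copy_mod C M :: ('o, 'm, 'v) abmod)) (\<lambda>X. label (carrier (omap M X)))"
  using small_TYPE Homs_obj copy_amap
  by (intro raw_homI) (auto simp: copy_mod_def)

lemma raw_hom_unlabel:
  "raw_hom C (underlying (copy_mod C M :: ('o, 'm, 'v) abmod)) M (\<lambda>X. unlabel (carrier (omap M X)))"
proof (rule raw_homI)
  fix X x y assume X: "X \<in> obj C"
    and x: "x \<in> carrier (omap (underlying (copy_mod C M :: ('o, 'm, 'v) abmod)) X)"
    and y: "y \<in> carrier (omap (underlying (copy_mod C M :: ('o, 'm, 'v) abmod)) X)"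
  interpret X: comm_group "omap M X" using comm_grp X by blast
  show "unlabel (carrier (omap M X)) (x \<otimes>\<^bsub>omap (underlying (copy_mod C M :: ('o, 'm, 'v) abmod)) X\<^esub> y) =
      unlabel (carrier (omap M X)) x \<otimes>\<^bsub>omap M X\<^esub> unlabel (carrier (omap M X)) y"
    using small_TYPE[OF X] x y by (auto simp: copy_mod_def)
next
  fix X x assume X: "X \<in> obj C" and x: "x \<in> carrier (omap (underlying (copy_mod C M :: ('o, 'm, 'v) abmod)) X)"
  then show "unlabel (carrier (omap M X)) x \<in> carrier (omap M X)"
    using small_TYPE[OF X] by (auto simp: copy_mod_def)
next
  fix X Y c x assume c: "c \<in> Homs C X Y"
    and x: "x \<in> carrier (omap (underlying (copy_mod C M :: ('o, 'm, 'v) abmod)) Y)"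
  then show "unlabel (carrier (omap M X)) (amap (underlying (copy_mod C M :: ('o, 'm, 'v) abmod)) c x) =
      amap M c (unlabel (carrier (omap M Y)) x)"
    using small_TYPE Homs_obj[OF c] act_closed[OF c] by (auto simp: copy_amap[OF c]) (auto simp: copy_mod_def)
qed

text \<open>Labelling and unlabelling are inverse to each other on carriers. This is how retracts of
  unlabelled modules become statements about \<open>yon\<close> and \<open>dual_mod\<close>.\<close>

lemma raw_retract_copy:
  "raw_retract C M (underlying (copy_mod C M :: ('o, 'm, 'v) abmod))"
  "raw_retract C (underlying (copy_mod C M :: ('o, 'm, 'v) abmod)) M"
proof -
  have 1: "\<forall>X \<in> obj C. \<forall>x \<in> carrier (omap M X).
      unlabel (carrier (omap M X)) (label (carrier (omap M X)) x :: 'v) = x"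
    using small_TYPE by simp
  have 2: "\<forall>X \<in> obj C. \<forall>x \<in> carrier (omap (underlying (copy_mod C M :: ('o, 'm, 'v) abmod)) X).
      label (carrier (omap M X)) (unlabel (carrier (omap M X)) x) = x"
    using small_TYPE by (auto simp: copy_mod_def)
  show "raw_retract C M (underlying (copy_mod C M :: ('o, 'm, 'v) abmod))"
    "raw_retract C (underlying (copy_mod C M :: ('o, 'm, 'v) abmod)) M"
    unfolding raw_retract_def
    using raw_hom_label raw_hom_unlabel 1 2 by blast+
qed

end

lemma raw_hom_component:
  assumes "preadditive_category C" "\<alpha> \<in> Homs (Mod_cat (V :: 'v itself) C) F G"
  shows "raw_hom C (underlying F) (underlying G) (component \<alpha>)"
proof -
  let ?A = "Ab :: ('v monoid, 'v ab_arr) preadd"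
  obtain \<eta> where \<alpha>: "\<alpha> = (F, G, \<eta>)" and F: "additive_functor (op_cat C) ?A F"
    and G: "additive_functor (op_cat C) ?A G" and \<eta>: "nat_trans (op_cat C) ?A F G \<eta>"
    using assms(2) by (auto simp: Homs_Mod_cat)
  have \<eta>X: "\<eta> X = (omap F X, omap G X, component \<alpha> X) \<and> component \<alpha> X \<in> hom (omap F X) (omap G X)"
    if "X \<in> obj C" for X
  proof -
    have "\<eta> X \<in> Homs ?A (omap F X) (omap G X)" using \<eta> that by (simp add: nat_trans_def)
    then show ?thesis by (auto simp: Homs_Ab component_def \<alpha>)
  qed
  show ?thesis
    unfolding raw_hom_def
  proof (intro conjI ballI allI)
    show "component \<alpha> X \<in> hom (omap (underlying F) X) (omap (underlying G) X)" if "X \<in> obj C" for X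
      using \<eta>X[OF that] by simp
    fix X Y c x assume c: "c \<in> Homs C X Y" and x: "x \<in> carrier (omap (underlying F) Y)"
    have "amap G c \<cdot>\<^bsub>?A\<^esub> \<eta> Y = \<eta> X \<cdot>\<^bsub>?A\<^esub> amap F c"
      using \<eta> HomsD[OF c] unfolding nat_trans_def by auto
    then have "compose (carrier (omap F Y)) (amap (underlying G) c) (component \<alpha> Y) =
        compose (carrier (omap F Y)) (component \<alpha> X) (amap (underlying F) c)"
      using \<eta>X preadditive_category.Homs_obj[OF assms(1) c] mod_amap(1)[OF F c] mod_amap(1)[OF G c]
      by (simp del: underlying_simps(2))
    from fun_cong[OF this, of x]
    show "component \<alpha> X (amap (underlying F) c x) = amap (underlying G) c (component \<alpha> Y x)"
      using x by (simp add: compose_def)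
  qed
qed

text \<open>A raw homomorphism is arbitrary off the carriers, while an arrow is undefined there;
  hence it is restricted, and agreement is claimed on carriers only.\<close>

lemma Mod_cat_arr_exists:
  assumes C: "preadditive_category C" and F: "F \<in> obj (Mod_cat (V :: 'v itself) C)"
    and G: "G \<in> obj (Mod_cat V C)" and \<phi>: "raw_hom C (underlying F) (underlying G) \<phi>"
  obtains \<alpha> where "\<alpha> \<in> Homs (Mod_cat V C) F G"
    "\<And>X x. X \<in> obj C \<Longrightarrow> x \<in> carrier (omap F X) \<Longrightarrow> component \<alpha> X x = \<phi> X x"
proof -
  let ?A = "Ab :: ('v monoid, 'v ab_arr) preadd"
  interpret F: raw_module V C "underlying F" using C F by (rule raw_module_underlying)
  interpret G: raw_module V C "underlying G" using C G by (rule raw_module_underlying)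
  have F': "additive_functor (op_cat C) ?A F" and G': "additive_functor (op_cat C) ?A G"
    using F G by simp_all
  define \<eta> where "\<eta> = (\<lambda>X\<in>obj C. (omap F X, omap G X, restrict (\<phi> X) (carrier (omap F X))))"
  have cl: "\<phi> X x \<in> carrier (omap G X)" if "X \<in> obj C" "x \<in> carrier (omap F X)" for X x
    using raw_homD(2)[OF \<phi> that(1)] that(2) by simp
  have "nat_trans (op_cat C) ?A F G \<eta>"
    unfolding nat_trans_def
  proof (intro conjI ballI)
    fix X assume "X \<in> obj (op_cat C)"
    then have X: "X \<in> obj C" by simp
    interpret X: comm_group "omap F X" using F.comm_grp[OF X] by simp
    have "restrict (\<phi> X) (carrier (omap F X)) \<in> hom (omap F X) (omap G X)"
      using raw_homD(3)[OF \<phi> X] cl[OF X] by (intro homI) auto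
    then show "\<eta> X \<in> Homs ?A (omap F X) (omap G X)"
      using F.comm_grp[OF X] F.small_TYPE[OF X] G.comm_grp[OF X] G.small_TYPE[OF X] X
      by (simp add: \<eta>_def Homs_Ab)
  next
    fix c assume "c \<in> arr (op_cat C)"
    then have c: "c \<in> Homs C (src C c) (tgt C c)" using arr_in_Homs by simp
    note o = F.Homs_obj[OF c]
    have "compose (carrier (omap F (tgt C c))) (amap (underlying G) c) (restrict (\<phi> (tgt C c)) (carrier (omap F (tgt C c)))) =
        compose (carrier (omap F (tgt C c))) (restrict (\<phi> (src C c)) (carrier (omap F (src C c)))) (amap (underlying F) c)"
      unfolding compose_def
      using raw_homD(4)[OF \<phi> c] F.act_closed[OF c] by (intro restrict_ext) simp
    then show "amap G c \<cdot>\<^bsub>?A\<^esub> \<eta> (src (op_cat C) c) = \<eta> (tgt (op_cat C) c) \<cdot>\<^bsub>?A\<^esub> amap F c"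
      using o unfolding mod_amap(1)[OF F' c] mod_amap(1)[OF G' c] by (simp add: \<eta>_def del: underlying_simps(2))
  qed
  then have "(F, G, \<eta>) \<in> Homs (Mod_cat V C) F G"
    using F' G' by (simp add: Homs_Mod_cat \<eta>_def)
  moreover have "component (F, G, \<eta>) X x = \<phi> X x" if "X \<in> obj C" "x \<in> carrier (omap F X)" for X x
    using that by (simp add: component_def \<eta>_def)
  ultimately show ?thesis using that by blast
qed

lemma Mod_cat_arr_eqI:
  assumes "\<alpha> \<in> Homs (Mod_cat (V :: 'v itself) C) F G" "\<beta> \<in> Homs (Mod_cat V C) F G"
    and eq: "\<And>X x. X \<in> obj C \<Longrightarrow> x \<in> carrier (omap F X) \<Longrightarrow> component \<alpha> X x = component \<beta> X x"
  shows "\<alpha> = \<beta>"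
proof -
  let ?A = "Ab :: ('v monoid, 'v ab_arr) preadd"
  obtain \<eta> where \<alpha>: "\<alpha> = (F, G, \<eta>)" "\<eta> \<in> extensional (obj C)" "nat_trans (op_cat C) ?A F G \<eta>"
    using assms(1) by (auto simp: Homs_Mod_cat)
  obtain \<theta> where \<beta>: "\<beta> = (F, G, \<theta>)" "\<theta> \<in> extensional (obj C)" "nat_trans (op_cat C) ?A F G \<theta>"
    using assms(2) by (auto simp: Homs_Mod_cat)
  have "\<eta> = \<theta>"
  proof (rule extensionalityI[OF \<alpha>(2) \<beta>(2)])
    fix X assume X: "X \<in> obj C"
    have "\<eta> X \<in> Homs ?A (omap F X) (omap G X)" "\<theta> X \<in> Homs ?A (omap F X) (omap G X)"
      using \<alpha>(3) \<beta>(3) X by (simp_all add: nat_trans_def)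
    then obtain f g where fg: "\<eta> X = (omap F X, omap G X, f)" "\<theta> X = (omap F X, omap G X, g)"
      "f \<in> extensional (carrier (omap F X))" "g \<in> extensional (carrier (omap F X))"
      by (auto simp: Homs_Ab)
    have "f = g"
      using eq[OF X] by (intro extensionalityI[OF fg(3,4)]) (simp add: component_def \<alpha> \<beta> fg)
    then show "\<eta> X = \<theta> X" using fg by simp
  qed
  then show ?thesis using \<alpha> \<beta> by simp
qed

lemma component_cmp:
  assumes "\<alpha> \<in> Homs (Mod_cat (V :: 'v itself) C) F G" "\<beta> \<in> Homs (Mod_cat V C) G H"
    and X: "X \<in> obj C" and x: "x \<in> carrier (omap F X)"
  shows "component (\<beta> \<cdot>\<^bsub>Mod_cat V C\<^esub> \<alpha>) X x = component \<beta> X (component \<alpha> X x)"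
proof -
  let ?A = "Ab :: ('v monoid, 'v ab_arr) preadd"
  obtain \<eta> where \<alpha>: "\<alpha> = (F, G, \<eta>)" "nat_trans (op_cat C) ?A F G \<eta>"
    using assms(1) by (auto simp: Homs_Mod_cat)
  obtain \<theta> where \<beta>: "\<beta> = (G, H, \<theta>)" "nat_trans (op_cat C) ?A G H \<theta>"
    using assms(2) by (auto simp: Homs_Mod_cat)
  have "\<eta> X \<in> Homs ?A (omap F X) (omap G X)" "\<theta> X \<in> Homs ?A (omap G X) (omap H X)"
    using \<alpha>(2) \<beta>(2) X by (simp_all add: nat_trans_def)
  then show ?thesis
    using X x by (auto simp: Homs_Ab component_def \<alpha>(1) \<beta>(1) compose_def)
qed

lemma component_ident:
  "X \<in> obj C \<Longrightarrow> x \<in> carrier (omap F X) \<Longrightarrow> component (ident (Mod_cat V C) F) X x = x"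
  by (simp add: component_def)

lemma Mod_cat_cmp_hom:
  assumes C: "preadditive_category C"
    and \<alpha>: "\<alpha> \<in> Homs (Mod_cat (V :: 'v itself) C) F G" and \<beta>: "\<beta> \<in> Homs (Mod_cat V C) G H"
  shows "\<beta> \<cdot>\<^bsub>Mod_cat V C\<^esub> \<alpha> \<in> Homs (Mod_cat V C) F H"
proof -
  let ?A = "Ab :: ('v monoid, 'v ab_arr) preadd"
  interpret A: preadditive_category ?A by (rule preadditive_category_Ab)
  obtain \<eta> where e: "\<alpha> = (F, G, \<eta>)" "nat_trans (op_cat C) ?A F G \<eta>" "additive_functor (op_cat C) ?A F"
    using \<alpha> by (auto simp: Homs_Mod_cat)
  obtain \<theta> where t: "\<beta> = (G, H, \<theta>)" "nat_trans (op_cat C) ?A G H \<theta>" "additive_functor (op_cat C) ?A H"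
    "additive_functor (op_cat C) ?A G"
    using \<beta> by (auto simp: Homs_Mod_cat)
  have \<eta>: "\<eta> X \<in> Homs ?A (omap F X) (omap G X)" and \<theta>: "\<theta> X \<in> Homs ?A (omap G X) (omap H X)"
    if "X \<in> obj C" for X
    using e(2) t(2) that by (simp_all add: nat_trans_def)
  have "nat_trans (op_cat C) ?A F H (\<lambda>X\<in>obj C. \<theta> X \<cdot>\<^bsub>?A\<^esub> \<eta> X)"
    unfolding nat_trans_def
  proof (intro conjI ballI)
    show "(\<lambda>X\<in>obj C. \<theta> X \<cdot>\<^bsub>?A\<^esub> \<eta> X) X \<in> Homs ?A (omap F X) (omap H X)" if "X \<in> obj (op_cat C)" for X
      using that A.cmp_hom[OF \<eta> \<theta>] by simp
  next
    fix c assume c0: "c \<in> arr (op_cat C)"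
    then have c: "c \<in> Homs C (src C c) (tgt C c)" using arr_in_Homs by simp
    have o: "src C c \<in> obj C" "tgt C c \<in> obj C" using preadditive_category.Homs_obj[OF C c] by simp_all
    interpret F: additive_functor "op_cat C" ?A F by fact
    interpret G: additive_functor "op_cat C" ?A G by fact
    interpret H: additive_functor "op_cat C" ?A H by fact
    have Fc: "amap F c \<in> Homs ?A (omap F (tgt C c)) (omap F (src C c))"
      and Gc: "amap G c \<in> Homs ?A (omap G (tgt C c)) (omap G (src C c))"
      and Hc: "amap H c \<in> Homs ?A (omap H (tgt C c)) (omap H (src C c))"
      using F.amap_hom G.amap_hom H.amap_hom c by simp_all
    have 1: "amap G c \<cdot>\<^bsub>?A\<^esub> \<eta> (tgt C c) = \<eta> (src C c) \<cdot>\<^bsub>?A\<^esub> amap F c"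
      and 2: "amap H c \<cdot>\<^bsub>?A\<^esub> \<theta> (tgt C c) = \<theta> (src C c) \<cdot>\<^bsub>?A\<^esub> amap G c"
      using e(2) t(2) c0 by (simp_all add: nat_trans_def)
    have "amap H c \<cdot>\<^bsub>?A\<^esub> (\<theta> (tgt C c) \<cdot>\<^bsub>?A\<^esub> \<eta> (tgt C c)) = \<theta> (src C c) \<cdot>\<^bsub>?A\<^esub> \<eta> (src C c) \<cdot>\<^bsub>?A\<^esub> amap F c"
      using A.cmp_assoc[OF \<eta>[OF o(2)] \<theta>[OF o(2)] Hc] 2 A.cmp_assoc[OF \<eta>[OF o(2)] Gc \<theta>[OF o(1)]] 1
        A.cmp_assoc[OF Fc \<eta>[OF o(1)] \<theta>[OF o(1)]] by simp
    then show "amap H c \<cdot>\<^bsub>?A\<^esub> (\<lambda>X\<in>obj C. \<theta> X \<cdot>\<^bsub>?A\<^esub> \<eta> X) (src (op_cat C) c) =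
        (\<lambda>X\<in>obj C. \<theta> X \<cdot>\<^bsub>?A\<^esub> \<eta> X) (tgt (op_cat C) c) \<cdot>\<^bsub>?A\<^esub> amap F c"
      using o by simp
  qed
  then show ?thesis using e t by (simp add: Homs_Mod_cat)
qed

text \<open>Injectivity in the category of modules refers to categorical monomorphisms. An
  objectwise injective homomorphism becomes one after labelling, because equality of arrows is
  tested on elements; the extension found there is then unlabelled.\<close>

lemma injective_copy_extend:
  assumes C: "preadditive_category C" and M: "raw_module (V :: 'v itself) C M" and N: "raw_module V C N"
    and E: "raw_module V C E"
    and inj: "injective_object (Mod_cat V C) (copy_mod C E :: ('o, 'm, 'v) abmod)"
    and i: "raw_hom C M N i" and i_inj: "\<And>X. X \<in> obj C \<Longrightarrow> inj_on (i X) (carrier (omap M X))"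
    and \<phi>: "raw_hom C M E \<phi>"
  obtains \<psi> where "raw_hom C N E \<psi>"
    "\<And>X x. X \<in> obj C \<Longrightarrow> x \<in> carrier (omap M X) \<Longrightarrow> \<psi> X (i X x) = \<phi> X x"
proof -
  interpret M: raw_module V C M by fact
  interpret N: raw_module V C N by fact
  interpret E: raw_module V C E by fact
  let ?M = "copy_mod C M :: ('o, 'm, 'v) abmod" and ?N = "copy_mod C N :: ('o, 'm, 'v) abmod"
    and ?E = "copy_mod C E :: ('o, 'm, 'v) abmod"
  have cM: "carrier (omap ?M X) = label (carrier (omap M X)) ` carrier (omap M X)" if "X \<in> obj C" for X
    using M.small_TYPE[OF that] by (simp add: copy_mod_def)
  obtain \<mu> where \<mu>: "\<mu> \<in> Homs (Mod_cat V C) ?M ?N" and \<mu>c: "\<And>X x. X \<in> obj C \<Longrightarrow> x \<in> carrier (omap ?M X) \<Longrightarrow>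
      component \<mu> X x = label (carrier (omap N X)) (i X (unlabel (carrier (omap M X)) x))"
    using Mod_cat_arr_exists[OF C M.copy_mod_obj N.copy_mod_obj
        raw_hom_comp[OF C raw_hom_comp[OF C M.raw_hom_unlabel i] N.raw_hom_label]] by metis
  obtain \<nu> where \<nu>: "\<nu> \<in> Homs (Mod_cat V C) ?M ?E" and \<nu>c: "\<And>X x. X \<in> obj C \<Longrightarrow> x \<in> carrier (omap ?M X) \<Longrightarrow>
      component \<nu> X x = label (carrier (omap E X)) (\<phi> X (unlabel (carrier (omap M X)) x))"
    using Mod_cat_arr_exists[OF C M.copy_mod_obj E.copy_mod_obj
        raw_hom_comp[OF C raw_hom_comp[OF C M.raw_hom_unlabel \<phi>] E.raw_hom_label]] by metis
  have \<mu>_inj: "x = y" if h: "X \<in> obj C" "x \<in> carrier (omap ?M X)" "y \<in> carrier (omap ?M X)"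
    "component \<mu> X x = component \<mu> X y" for X x y
  proof -
    obtain x' y' where xy: "x' \<in> carrier (omap M X)" "y' \<in> carrier (omap M X)"
      "x = label (carrier (omap M X)) x'" "y = label (carrier (omap M X)) y'"
      using h(2,3) unfolding cM[OF h(1)] by blast
    then have "label (carrier (omap N X)) (i X x') = (label (carrier (omap N X)) (i X y') :: 'v)"
      using that(4) \<mu>c[OF that(1,2)] \<mu>c[OF that(1,3)] M.small_TYPE[OF that(1)] by simp
    then have "i X x' = i X y'"
      using inj_on_label[OF N.small_TYPE[OF that(1)]] raw_homD(2)[OF i that(1)] xy(1,2)
      by (simp add: inj_on_def)
    then have "x' = y'" using i_inj[OF that(1)] xy(1,2) by (meson inj_onD)
    then show ?thesis using xy(3,4) by simp
  qed
  have "is_mono (Mod_cat V C) \<mu>"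
    unfolding is_mono_def
  proof (intro conjI allI ballI impI)
    show "\<mu> \<in> arr (Mod_cat V C)" using HomsD[OF \<mu>] by simp
    fix W g h assume "g \<in> Homs (Mod_cat V C) W (src (Mod_cat V C) \<mu>)" "h \<in> Homs (Mod_cat V C) W (src (Mod_cat V C) \<mu>)"
      and eq: "\<mu> \<cdot>\<^bsub>Mod_cat V C\<^esub> g = \<mu> \<cdot>\<^bsub>Mod_cat V C\<^esub> h"
    then have g: "g \<in> Homs (Mod_cat V C) W ?M" and h: "h \<in> Homs (Mod_cat V C) W ?M"
      using HomsD[OF \<mu>] by simp_all
    show "g = h"
    proof (rule Mod_cat_arr_eqI[OF g h])
      fix X x assume X: "X \<in> obj C" and x: "x \<in> carrier (omap W X)"
      have gx: "component g X x \<in> carrier (omap ?M X)" and hx: "component h X x \<in> carrier (omap ?M X)"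
        using raw_homD(2)[OF raw_hom_component[OF C g] X] raw_homD(2)[OF raw_hom_component[OF C h] X] x
        by simp_all
      show "component g X x = component h X x"
        using \<mu>_inj[OF X gx hx] component_cmp[OF g \<mu> X x] component_cmp[OF h \<mu> X x] eq by simp
    qed
  qed
  then obtain \<gamma> where \<gamma>: "\<gamma> \<in> Homs (Mod_cat V C) ?N ?E" "\<gamma> \<cdot>\<^bsub>Mod_cat V C\<^esub> \<mu> = \<nu>"
    using inj \<nu> HomsD[OF \<mu>] unfolding injective_object_def by metis
  let ?\<psi> = "\<lambda>X x. unlabel (carrier (omap E X)) (component \<gamma> X (label (carrier (omap N X)) x))"
  have "raw_hom C N E ?\<psi>"
    by (rule raw_hom_comp[OF C raw_hom_comp[OF C N.raw_hom_label raw_hom_component[OF C \<gamma>(1)]] E.raw_hom_unlabel])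
  moreover have "?\<psi> X (i X x) = \<phi> X x" if X: "X \<in> obj C" and x: "x \<in> carrier (omap M X)" for X x
  proof -
    let ?x = "label (carrier (omap M X)) x :: 'v"
    have lx: "?x \<in> carrier (omap ?M X)" using cM[OF X] x by simp
    have "component \<gamma> X (component \<mu> X ?x) = component \<nu> X ?x"
      using component_cmp[OF \<mu> \<gamma>(1) X lx] \<gamma>(2) by simp
    then have "component \<gamma> X (label (carrier (omap N X)) (i X x)) = label (carrier (omap E X)) (\<phi> X x)"
      using \<mu>c[OF X lx] \<nu>c[OF X lx] M.small_TYPE[OF X] x by simp
    then show ?thesis using E.small_TYPE[OF X] raw_homD(2)[OF \<phi> X x] by simp
  qed
  ultimately show ?thesis using that by blast
qed


section \<open>Represented modules, and extension of homomorphisms into pure injectives\<close>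

section \<open>Represented modules\<close>

definition hom_mod :: "('o, 'm, 'z) preadd_scheme \<Rightarrow> 'o \<Rightarrow> ('o, 'm, 'm) rmod" where
  "hom_mod T X = \<lparr>omap = (\<lambda>C. HomG T C X), amap = (\<lambda>c f. f \<cdot>\<^bsub>T\<^esub> c)\<rparr>"

lemma hom_mod_simps [simp]:
  "omap (hom_mod T X) C = HomG T C X" "amap (hom_mod T X) c f = f \<cdot>\<^bsub>T\<^esub> c"
  by (simp_all add: hom_mod_def)

lemma yon_eq_copy_mod: "yon T X = copy_mod (compacts V T) (hom_mod T X)"
  by (simp add: yon_def copy_mod_def hom_mod_def)

abbreviation yon_hom where
  "yon_hom V T X Y \<equiv> raw_hom (compacts V T) (hom_mod T X) (hom_mod T Y)"

context preadditive_category
begin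

lemma yon_homD:
  assumes "yon_hom V C X Y \<phi>" "compact_object V C K"
  shows "x \<in> Homs C K X \<Longrightarrow> \<phi> K x \<in> Homs C K Y"
    "x \<in> Homs C K X \<Longrightarrow> y \<in> Homs C K X \<Longrightarrow> \<phi> K (x \<uplus> y) = \<phi> K x \<uplus> \<phi> K y"
    "compact_object V C K' \<Longrightarrow> c \<in> Homs C K' K \<Longrightarrow> x \<in> Homs C K X \<Longrightarrow> \<phi> K' (x \<cdot> c) = \<phi> K x \<cdot> c"
  using raw_homD(2-4)[OF assms(1)] assms(2) by (auto simp: Homs_compacts)

lemma yon_homI:
  assumes "\<And>K x. compact_object V C K \<Longrightarrow> x \<in> Homs C K X \<Longrightarrow> \<phi> K x \<in> Homs C K Y"
    and "\<And>K x y. compact_object V C K \<Longrightarrow> x \<in> Homs C K X \<Longrightarrow> y \<in> Homs C K X \<Longrightarrow>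
      \<phi> K (x \<uplus> y) = \<phi> K x \<uplus> \<phi> K y"
    and "\<And>K K' c x. compact_object V C K \<Longrightarrow> compact_object V C K' \<Longrightarrow> c \<in> Homs C K' K \<Longrightarrow>
      x \<in> Homs C K X \<Longrightarrow> \<phi> K' (x \<cdot> c) = \<phi> K x \<cdot> c"
  shows "yon_hom V C X Y \<phi>"
  by (rule raw_homI) (use assms in \<open>auto simp: Homs_compacts split: if_splits\<close>)

lemma yon_hom_zero:
  assumes "yon_hom V C X Y \<phi>" "compact_object V C K" "X \<in> obj C"
  shows "\<phi> K (hom_zero C K X) = hom_zero C K Y"
proof -
  have z: "hom_zero C K X \<in> Homs C K X" using compact_objectD[OF assms(2)] assms(3) zero_hom by blast
  note p = yon_homD(1)[OF assms(1,2) z]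
  show ?thesis
    using yon_homD(2)[OF assms(1,2) z z] add_zero(1)[OF z] add_zero(1)[OF p]
      add_left_cancel[OF p p zero_hom] Homs_obj[OF p] by simp
qed

lemma yon_hom_diff:
  assumes "yon_hom V C X Y \<phi>" "yon_hom V C X Y \<psi>"
  shows "yon_hom V C X Y (\<lambda>K x. \<phi> K x \<uplus> hom_neg C (\<psi> K x))"
proof (rule yon_homI)
  fix K x assume K: "compact_object V C K" and x: "x \<in> Homs C K X"
  note \<phi> = yon_homD[OF assms(1) K] and \<psi> = yon_homD[OF assms(2) K]
  show "\<phi> K x \<uplus> hom_neg C (\<psi> K x) \<in> Homs C K Y"
    using \<phi>(1) \<psi>(1) x add_hom neg_hom by blast
  fix y assume y: "y \<in> Homs C K X"
  interpret G: comm_group "HomG C K Y" using \<phi>(1)[OF x] by (rule HomG_comm_group)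
  have inv: "hom_neg C a = inv\<^bsub>HomG C K Y\<^esub> a" if "a \<in> Homs C K Y" for a
    using HomsD[OF that] by (simp add: hom_neg_def)
  have "(\<phi> K x \<otimes>\<^bsub>HomG C K Y\<^esub> \<phi> K y) \<otimes>\<^bsub>HomG C K Y\<^esub> inv\<^bsub>HomG C K Y\<^esub> (\<psi> K x \<otimes>\<^bsub>HomG C K Y\<^esub> \<psi> K y)
    = (\<phi> K x \<otimes>\<^bsub>HomG C K Y\<^esub> inv\<^bsub>HomG C K Y\<^esub> (\<psi> K x)) \<otimes>\<^bsub>HomG C K Y\<^esub>
      (\<phi> K y \<otimes>\<^bsub>HomG C K Y\<^esub> inv\<^bsub>HomG C K Y\<^esub> (\<psi> K y))"
  proof -
    have cl: "\<phi> K x \<in> carrier (HomG C K Y)" "\<phi> K y \<in> carrier (HomG C K Y)"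
      "\<psi> K x \<in> carrier (HomG C K Y)" "\<psi> K y \<in> carrier (HomG C K Y)"
      using \<phi>(1) \<psi>(1) x y by simp_all
    show ?thesis using cl by (simp only: G.inv_mult G.m_ac G.inv_closed G.m_closed)
  qed
  then show "\<phi> K (x \<uplus> y) \<uplus> hom_neg C (\<psi> K (x \<uplus> y)) =
      (\<phi> K x \<uplus> hom_neg C (\<psi> K x)) \<uplus> (\<phi> K y \<uplus> hom_neg C (\<psi> K y))"
    using \<phi>(1,2) \<psi>(1,2) x y inv add_hom by simp
next
  fix K K' c x assume K: "compact_object V C K" "compact_object V C K'" and c: "c \<in> Homs C K' K"
    and x: "x \<in> Homs C K X"
  note \<phi> = yon_homD[OF assms(1) K(1)] and \<psi> = yon_homD[OF assms(2) K(1)]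
  show "\<phi> K' (x \<cdot> c) \<uplus> hom_neg C (\<psi> K' (x \<cdot> c)) = (\<phi> K x \<uplus> hom_neg C (\<psi> K x)) \<cdot> c"
    using \<phi>(3)[OF K(2) c x] \<psi>(3)[OF K(2) c x] cmp_neg_left[OF c \<psi>(1)[OF x]]
      cmp_add_left[OF c \<phi>(1)[OF x] neg_hom[OF \<psi>(1)[OF x]]] by simp
qed

lemma yon_hom_post:
  assumes "a \<in> Homs C X Y"
  shows "yon_hom V C X Y (\<lambda>K x. a \<cdot> x)"
  using assms by (intro yon_homI) (auto simp: cmp_hom cmp_add_right cmp_assoc)

lemma yon_hom_comp:
  "yon_hom V C X Y \<phi> \<Longrightarrow> yon_hom V C Y Z \<psi> \<Longrightarrow> yon_hom V C X Z (\<lambda>K x. \<psi> K (\<phi> K x))"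
  by (rule raw_hom_comp[OF preadditive_category_compacts]) unfold_locales

end

context compactly_generated
begin

lemma preadditive_compacts: "preadditive_category (compacts V T)"
  by (rule preadditive_category_compacts) unfold_locales

text \<open>Serves both for Hom(-, X) itself and for the image of a map between represented modules;
  the group laws come from the ambient hom-groups.\<close>

lemma raw_module_submodule:
  assumes X: "X \<in> obj T"
    and S: "\<And>K. compact_object V T K \<Longrightarrow> S K \<subseteq> Homs T K X"
    and zero: "\<And>K. compact_object V T K \<Longrightarrow> hom_zero T K X \<in> S K"
    and add: "\<And>K x y. compact_object V T K \<Longrightarrow> x \<in> S K \<Longrightarrow> y \<in> S K \<Longrightarrow> x \<uplus> y \<in> S K"
    and neg: "\<And>K x. compact_object V T K \<Longrightarrow> x \<in> S K \<Longrightarrow> hom_neg T x \<in> S K"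
    and act: "\<And>K K' c x. compact_object V T K \<Longrightarrow> compact_object V T K' \<Longrightarrow> c \<in> Homs T K' K \<Longrightarrow>
      x \<in> S K \<Longrightarrow> x \<cdot> c \<in> S K'"
  shows "raw_module V (compacts V T)
    \<lparr>omap = (\<lambda>K. \<lparr>carrier = S K, mult = hom_add T, one = hom_zero T K X\<rparr>), amap = (\<lambda>c f. f \<cdot> c)\<rparr>"
proof (intro raw_module.intro raw_module_axioms.intro preadditive_compacts; simp)
  fix K assume K: "compact_object V T K"
  have SD: "x \<in> Homs T K X" if "x \<in> S K" for x using S[OF K] that by blast
  show "comm_group \<lparr>carrier = S K, mult = hom_add T, one = hom_zero T K X\<rparr>"
  proof (rule comm_groupI; simp)
    fix x assume "x \<in> S K"
    then show "hom_zero T K X \<uplus> x = x" "\<exists>y\<in>S K. y \<uplus> x = hom_zero T K X"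
      using add_zero(2)[OF SD] add_neg(2)[OF SD] neg[OF K] by blast+
  next
    fix x y assume "x \<in> S K" "y \<in> S K"
    then show "x \<uplus> y \<in> S K" "x \<uplus> y = y \<uplus> x"
      using add[OF K] add_commute[OF SD SD] by blast+
  next
    fix x y z assume "x \<in> S K" "y \<in> S K" "z \<in> S K"
    then show "x \<uplus> y \<uplus> z = x \<uplus> (y \<uplus> z)" using add_assoc[OF SD SD SD] by blast
  qed (rule zero[OF K])
  show "small V (S K)"
    using small_subset[OF small_homs S[OF K]] X compact_objectD[OF K] by blast
  show "\<And>x. x \<in> S K \<Longrightarrow> x \<cdot> ident T K = x" using ident_right[OF SD] .
next
  fix c K K' assume c: "c \<in> Homs (compacts V T) K K'"
  then have K: "compact_object V T K" "compact_object V T K'" and c: "c \<in> Homs T K K'"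
    by (auto simp: Homs_compacts split: if_splits)
  show "(\<lambda>f. f \<cdot> c) \<in> hom \<lparr>carrier = S K', mult = hom_add T, one = hom_zero T K' X\<rparr>
      \<lparr>carrier = S K, mult = hom_add T, one = hom_zero T K X\<rparr>"
    using act[OF K(2,1) c] S[OF K(2)] by (intro homI) (auto simp: subset_iff cmp_add_left[OF c, of _ X])
next
  fix c K K' d K'' x
  assume "c \<in> Homs (compacts V T) K K'" "d \<in> Homs (compacts V T) K' K''" and x: "x \<in> S K''"
  then have K: "compact_object V T K''" and c: "c \<in> Homs T K K'" and d: "d \<in> Homs T K' K''"
    by (auto simp: Homs_compacts split: if_splits)
  show "x \<cdot> (d \<cdot> c) = x \<cdot> d \<cdot> c" using cmp_assoc[OF c d] S[OF K] x by blast
next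
  fix c K K' d x
  assume "c \<in> Homs (compacts V T) K K'" "d \<in> Homs (compacts V T) K K'" and x: "x \<in> S K'"
  then have K: "compact_object V T K'" and c: "c \<in> Homs T K K'" and d: "d \<in> Homs T K K'"
    by (auto simp: Homs_compacts split: if_splits)
  show "x \<cdot> (c \<uplus> d) = x \<cdot> c \<uplus> x \<cdot> d" using cmp_add_right[OF c d] S[OF K] x by blast
qed

lemma raw_module_hom_mod:
  assumes "X \<in> obj T"
  shows "raw_module V (compacts V T) (hom_mod T X)"
proof -
  have "raw_module V (compacts V T)
    \<lparr>omap = (\<lambda>K. \<lparr>carrier = Homs T K X, mult = hom_add T, one = hom_zero T K X\<rparr>), amap = (\<lambda>c f. f \<cdot> c)\<rparr>"
    by (rule raw_module_submodule[OF assms])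
      (use zero_hom[OF compact_objectD assms] add_hom neg_hom cmp_hom in blast)+
  then show ?thesis by (simp add: hom_mod_def HomG_def)
qed

text \<open>Since \<phi> vanishes on the kernel of yu, it descends to the image of yu. That image is
  a submodule of yY, and injectivity of yE extends the descended map along the inclusion.\<close>

lemma pure_injective_extend:
  assumes E: "pure_injective V T E" and u: "u \<in> Homs T X Y" and \<phi>: "yon_hom V T X E \<phi>"
    and ker: "\<And>K x. compact_object V T K \<Longrightarrow> x \<in> Homs T K X \<Longrightarrow> u \<cdot> x = hom_zero T K Y \<Longrightarrow>
      \<phi> K x = hom_zero T K E"
  obtains \<psi> where "yon_hom V T Y E \<psi>"
    "\<And>K x. compact_object V T K \<Longrightarrow> x \<in> Homs T K X \<Longrightarrow> \<psi> K (u \<cdot> x) = \<phi> K x"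
proof -
  note XY = Homs_obj[OF u]
  have E': "E \<in> obj T" using E by (simp add: pure_injective_def)
  define S where "S K = (\<lambda>x. u \<cdot> x) ` Homs T K X" for K
  define I where "I = \<lparr>omap = (\<lambda>K. \<lparr>carrier = S K, mult = hom_add T, one = hom_zero T K Y\<rparr>),
    amap = (\<lambda>c f. f \<cdot> c)\<rparr>"
  \<comment> \<open>The value of \<phi> at a chosen preimage. Two preimages differ by an element
    killed by u, so the choice is immaterial.\<close>
  define \<rho> where "\<rho> K y = \<phi> K (SOME x. x \<in> Homs T K X \<and> u \<cdot> x = y)" for K y
  have \<rho>: "\<rho> K (u \<cdot> x) = \<phi> K x" if K: "compact_object V T K" and x: "x \<in> Homs T K X" for K x
  proof -
    define x' where "x' = (SOME x'. x' \<in> Homs T K X \<and> u \<cdot> x' = u \<cdot> x)"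
    have x': "x' \<in> Homs T K X \<and> u \<cdot> x' = u \<cdot> x"
      unfolding x'_def by (rule someI[of _ x]) (use x in simp)
    have d: "x' \<uplus> hom_neg T x \<in> Homs T K X" using x' x add_hom neg_hom by blast
    have "u \<cdot> (x' \<uplus> hom_neg T x) = hom_zero T K Y"
      using cmp_add_right[OF _ neg_hom[OF x] u, of x'] cmp_neg_right[OF x u] x' add_neg(1)[OF cmp_hom[OF x u]]
      by simp
    then have z: "\<phi> K (x' \<uplus> hom_neg T x) = hom_zero T K E" using ker[OF K d] by blast
    have "x \<uplus> (x' \<uplus> hom_neg T x) = x'" using add_diff_cancel[of x' K X x] x' x by blast
    then have "\<phi> K x' = \<phi> K x \<uplus> \<phi> K (x' \<uplus> hom_neg T x)"
      using yon_homD(2)[OF \<phi> K x d] by simp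
    then have "\<phi> K x' = \<phi> K x" using z add_zero(1)[OF yon_homD(1)[OF \<phi> K x]] by simp
    then show ?thesis by (simp add: \<rho>_def x'_def)
  qed
  have I: "raw_module V (compacts V T) I"
    unfolding I_def
  proof (rule raw_module_submodule)
    show "Y \<in> obj T" using XY by blast
    fix K assume K: "compact_object V T K"
    note K' = compact_objectD[OF K]
    show "S K \<subseteq> Homs T K Y" using cmp_hom[OF _ u] by (auto simp: S_def)
    show "hom_zero T K Y \<in> S K"
      unfolding S_def using cmp_zero_right[OF u K', symmetric] zero_hom[of K X] K' XY by (rule_tac image_eqI) auto
    show "x \<uplus> y \<in> S K" if "x \<in> S K" "y \<in> S K" for x y
      using that cmp_add_right[OF _ _ u, symmetric] add_hom[of _ K X] by (auto simp: S_def)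
    show "hom_neg T x \<in> S K" if "x \<in> S K" for x
      using that cmp_neg_right[OF _ u, symmetric] neg_hom[of _ K X] by (auto simp: S_def)
    fix K' c x assume "compact_object V T K'" and c: "c \<in> Homs T K' K" and "x \<in> S K"
    then obtain x' where x': "x' \<in> Homs T K X" "x = u \<cdot> x'" by (auto simp: S_def)
    then show "x \<cdot> c \<in> S K'"
      unfolding S_def using cmp_assoc[OF c x'(1) u] cmp_hom[OF c x'(1)] by (rule_tac x = "x' \<cdot> c" in image_eqI) auto
  qed
  have SY: "S K \<subseteq> Homs T K Y" for K using cmp_hom[OF _ u] by (auto simp: S_def)
  have incl: "raw_hom (compacts V T) I (hom_mod T Y) (\<lambda>K x. x)"
    using SY by (intro raw_homI) (auto simp: I_def)
  have "raw_hom (compacts V T) I (hom_mod T E) \<rho>"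
  proof (rule raw_homI)
    fix K y assume K: "K \<in> obj (compacts V T)" and y: "y \<in> carrier (omap I K)"
    then obtain x where x: "x \<in> Homs T K X" "y = u \<cdot> x" by (auto simp: I_def S_def)
    show "\<rho> K y \<in> carrier (omap (hom_mod T E) K)" using K x \<rho> yon_homD(1)[OF \<phi>] by simp
    fix y' assume "y' \<in> carrier (omap I K)"
    then obtain x' where x': "x' \<in> Homs T K X" "y' = u \<cdot> x'" by (auto simp: I_def S_def)
    have "y \<uplus> y' = u \<cdot> (x \<uplus> x')" using cmp_add_right[OF x(1) x'(1) u] x x' by simp
    then show "\<rho> K (y \<otimes>\<^bsub>omap I K\<^esub> y') = \<rho> K y \<otimes>\<^bsub>omap (hom_mod T E) K\<^esub> \<rho> K y'"
      using \<rho>[of K "x \<uplus> x'"] \<rho>[of K x] \<rho>[of K x'] K x x' add_hom[OF x(1) x'(1)]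
        yon_homD(2)[OF \<phi> _ x(1) x'(1)] by (simp add: I_def)
  next
    fix K K' c y assume "c \<in> Homs (compacts V T) K K'" and y: "y \<in> carrier (omap I K')"
    then have K: "compact_object V T K" "compact_object V T K'" and c: "c \<in> Homs T K K'"
      by (auto simp: Homs_compacts split: if_splits)
    obtain x where x: "x \<in> Homs T K' X" "y = u \<cdot> x" using y by (auto simp: I_def S_def)
    show "\<rho> K (amap I c y) = amap (hom_mod T E) c (\<rho> K' y)"
      using \<rho>[OF K(2) x(1)] \<rho>[OF K(1) cmp_hom[OF c x(1)]] cmp_assoc[OF c x(1) u] x
        yon_homD(3)[OF \<phi> K(2,1) c x(1)] by (simp add: I_def)
  qed
  moreover have "injective_object (Mod_cat V (compacts V T)) (copy_mod (compacts V T) (hom_mod T E))"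
    using E unfolding pure_injective_def yon_eq_copy_mod[of T E V] by blast
  ultimately obtain \<psi> where \<psi>: "yon_hom V T Y E \<psi>"
    and \<psi>\<rho>: "\<And>K y. K \<in> obj (compacts V T) \<Longrightarrow> y \<in> carrier (omap I K) \<Longrightarrow> \<psi> K y = \<rho> K y"
    using injective_copy_extend[OF preadditive_compacts I raw_module_hom_mod raw_module_hom_mod _ incl, of E \<rho>]
      XY E' by (auto simp: inj_on_def)
  have "\<psi> K (u \<cdot> x) = \<phi> K x" if "compact_object V T K" "x \<in> Homs T K X" for K x
    using \<psi>\<rho>[of K "u \<cdot> x"] \<rho>[OF that] that by (simp add: I_def S_def)
  then show ?thesis using that \<psi> by blast
qed

end


section \<open>Generators, telescopes, phantoms, and fullness of y on maps into pure
  injectives\<close>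

section \<open>Telescopes\<close>

text \<open>Closure under desuspension transfers knowledge about maps from generators into S to maps
  from generators into \<Sigma>S, as needed for cones.\<close>

locale generating_set = compactly_generated V T
  for V :: "'v itself" and T :: "('o, 'm, 'z) triang_scheme" (structure) +
  fixes \<G> :: "'o set"
  assumes universe: "grothendieck_universe V"
    and small_generators: "small V \<G>"
    and generators_compact: "G \<in> \<G> \<Longrightarrow> compact_object V T G"
    and generators_detect_zero: "X \<in> obj T \<Longrightarrow> (\<And>G. G \<in> \<G> \<Longrightarrow> Homs T G X = {hom_zero T G X}) \<Longrightarrow> is_zero_object T X"
    and generators_desuspend: "G \<in> \<G> \<Longrightarrow> \<exists>G' \<in> \<G>. \<exists>u \<in> Homs T (omap (susp T) G') G. \<exists>v \<in> Homs T G (omap (susp T) G').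
      v \<cdot> u = ident T (omap (susp T) G') \<and> u \<cdot> v = ident T G"

text \<open>A small set of compact generators is enlarged by all iterates of a chosen desuspension.
  The iterates stay compact by \<open>compact_desuspension\<close>, and countably many iterates of a
  small set form a small set.\<close>

lemma (in compactly_generated) generating_set_exists:
  assumes universe: "grothendieck_universe V"
  obtains \<G> where "generating_set V T \<G>"
proof -
  obtain \<G>0 where sm: "small V \<G>0" and cp: "\<forall>C\<in>\<G>0. compact_object V T C"
    and det: "\<forall>X\<in>obj T. (\<forall>C\<in>\<G>0. Homs T C X = {hom_zero T C X}) \<longrightarrow> is_zero_object T X"
    using compact_generators by blast
  define P where "P G G' \<longleftrightarrow> G' \<in> obj T \<and> (\<exists>u \<in> Homs T (\<Sigma>\<^sub>o G') G. \<exists>v \<in> Homs T G (\<Sigma>\<^sub>o G').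
      v \<cdot> u = ident T (\<Sigma>\<^sub>o G') \<and> u \<cdot> v = ident T G)" for G G'
  define d where "d G = (SOME G'. P G G')" for G
  have d: "P G (d G)" if "G \<in> obj T" for G
    unfolding d_def by (rule desuspension[OF that], rule someI[of "P G"]) (auto simp: P_def)
  define \<G> where "\<G> = (\<lambda>(n, G). (d ^^ n) G) ` ((UNIV :: nat set) \<times> \<G>0)"
  have comp: "compact_object V T ((d ^^ n) G)" if "G \<in> \<G>0" for n G
  proof (induction n)
    case 0
    then show ?case using cp that by simp
  next
    case (Suc n)
    then have "P ((d ^^ n) G) ((d ^^ Suc n) G)" using d[OF compact_objectD] by simp
    then show ?case using compact_desuspension[OF Suc] unfolding P_def by blast
  qed
  have "generating_set V T \<G>"
  proof (intro generating_set.intro generating_set_axioms.intro)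
    show "compactly_generated V T" by unfold_locales
    show "small V \<G>"
      unfolding \<G>_def by (intro small_image small_Times universe sm small_countable) simp
    show "compact_object V T G" if "G \<in> \<G>" for G using that comp by (auto simp: \<G>_def)
    show "is_zero_object T X" if "X \<in> obj T" "\<And>G. G \<in> \<G> \<Longrightarrow> Homs T G X = {hom_zero T G X}" for X
    proof -
      have "C \<in> \<G>" if "C \<in> \<G>0" for C
        unfolding \<G>_def using that by (intro image_eqI[of _ _ "(0, C)"]) auto
      then show ?thesis using det that by blast
    qed
    fix G assume "G \<in> \<G>"
    then obtain n G0 where G: "G0 \<in> \<G>0" "G = (d ^^ n) G0" by (auto simp: \<G>_def)
    then have "P G (d G)" using d[OF compact_objectD[OF comp]] by simp
    moreover have "d G \<in> \<G>"
      unfolding \<G>_def using G by (intro image_eqI[of _ _ "(Suc n, G0)"]) auto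
    ultimately show "\<exists>G' \<in> \<G>. \<exists>u \<in> Homs T (\<Sigma>\<^sub>o G') G. \<exists>v \<in> Homs T G (\<Sigma>\<^sub>o G').
      v \<cdot> u = ident T (\<Sigma>\<^sub>o G') \<and> u \<cdot> v = ident T G" unfolding P_def by blast
  qed (rule universe)
  then show ?thesis by (rule that)
qed

context generating_set
begin

text \<open>The cone Z is zero because no generator maps to it. Given w from G to Z, the map h w is
  killed by \<Sigma>t, as these are consecutive maps of a triangle, and fixed by \<Sigma>t, by
  desuspending G. So h w = 0, whence w = g y for some y, and w = g t y = 0.\<close>

lemma is_iso_if_identity_on_generators:
  assumes t: "t \<in> Homs T S S" and id: "\<And>G y. G \<in> \<G> \<Longrightarrow> y \<in> Homs T G S \<Longrightarrow> t \<cdot> y = y"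
  shows "is_iso T S S t"
proof -
  obtain Z g h where tri: "(t, g, h) \<in> tri T" and g: "g \<in> Homs T S Z" and h: "h \<in> Homs T Z (\<Sigma>\<^sub>o S)"
    using coneE[OF t] by blast
  note tri2 = tri_rotate[OF tri t] and St = susp.amap_hom[OF t]
  have Sid: "\<Sigma>\<^sub>a t \<cdot> z = z" if G: "G \<in> \<G>" and z: "z \<in> Homs T G (\<Sigma>\<^sub>o S)" for G z
  proof -
    obtain G' u v where G': "G' \<in> \<G>" and u: "u \<in> Homs T (\<Sigma>\<^sub>o G') G" and v: "v \<in> Homs T G (\<Sigma>\<^sub>o G')"
      and uv: "u \<cdot> v = ident T G"
      using generators_desuspend[OF G] by blast
    note zu = cmp_hom[OF u z]
    obtain z' where z': "z' \<in> Homs T G' S" "\<Sigma>\<^sub>a z' = z \<cdot> u"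
      using susp_full[OF zu] compact_objectD[OF generators_compact[OF G']] Homs_obj[OF t] by blast
    have "\<Sigma>\<^sub>a t \<cdot> (z \<cdot> u) = z \<cdot> u"
      using susp.amap_cmp[OF z'(1) t] id[OF G' z'(1)] z'(2) by simp
    then have "\<Sigma>\<^sub>a t \<cdot> (z \<cdot> u) \<cdot> v = z \<cdot> u \<cdot> v" by simp
    then show ?thesis
      using cmp_assoc[OF v zu St] cmp_assoc[OF v u z] uv ident_right[OF z] by simp
  qed
  have "Homs T G Z = {hom_zero T G Z}" if G: "G \<in> \<G>" for G
  proof -
    note G' = compact_objectD[OF generators_compact[OF G]]
    have "w = hom_zero T G Z" if w: "w \<in> Homs T G Z" for w
    proof -
      note hw = cmp_hom[OF w h]
      have "hom_neg T (\<Sigma>\<^sub>a t) \<cdot> h = hom_zero T Z (\<Sigma>\<^sub>o S)"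
        using tri_cmp_zero[OF tri_rotate[OF tri2 g] h neg_hom[OF St]] .
      then have "hom_neg T (\<Sigma>\<^sub>a t \<cdot> h) = hom_zero T Z (\<Sigma>\<^sub>o S)"
        using cmp_neg_left[OF h St] by simp
      then have "\<Sigma>\<^sub>a t \<cdot> h = hom_zero T Z (\<Sigma>\<^sub>o S)"
        using neg_neg[OF cmp_hom[OF h St]] add_neg(2)[OF cmp_hom[OF h St]] add_zero(2)[OF cmp_hom[OF h St]]
        by simp
      then have "\<Sigma>\<^sub>a t \<cdot> (h \<cdot> w) = hom_zero T G (\<Sigma>\<^sub>o S)"
        using cmp_assoc[OF w h St] cmp_zero_left[OF w] Homs_obj[OF h] by simp
      then have "h \<cdot> w = hom_zero T G (\<Sigma>\<^sub>o S)" using Sid[OF G hw] by simp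
      then obtain y where y: "y \<in> Homs T G S" "g \<cdot> y = w"
        using hom_exact_covariant[OF tri2 g h w] by blast
      have "w = g \<cdot> t \<cdot> y" using id[OF G y(1)] y(2) cmp_assoc[OF y(1) t g] by simp
      then show ?thesis using tri_cmp_zero[OF tri t g] cmp_zero_left[OF y(1)] Homs_obj[OF g] by simp
    qed
    then show ?thesis using zero_hom[OF G'] Homs_obj[OF g] by blast
  qed
  then have "is_zero_object T Z" using generators_detect_zero Homs_obj[OF g] by blast
  then show ?thesis using is_iso_if_cone_zero[OF tri t g] by blast
qed

lemma nat_coproduct:
  assumes "\<And>n :: nat. K n \<in> obj T"
  obtains S \<iota> where "is_coproduct T UNIV K S \<iota>"
    "\<And>C. compact_object V T C \<Longrightarrow> sums_from_summands T UNIV K S \<iota> C"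
proof -
  have sN: "small V (UNIV :: nat set)" using universe by (rule small_countable) simp
  let ?e = "label UNIV :: nat \<Rightarrow> 'v"
  have e: "inj ?e" using inj_on_label[OF sN] .
  let ?K = "\<lambda>i. K (inv_into UNIV ?e i)"
  obtain S \<iota> where cop: "is_coproduct T (range ?e) ?K S \<iota>"
    using small_coproducts[OF small_image[OF sN], of ?e ?K] assms by blast
  have "bij_betw ?e UNIV (range ?e)" using e by (simp add: bij_betw_def)
  from coproduct_reindex[OF cop this]
  have 1: "is_coproduct T UNIV K S (\<lambda>n. \<iota> (?e n))" using e by simp
  have "sums_from_summands T UNIV K S (\<lambda>n. \<iota> (?e n)) C" if "compact_object V T C" for C
    using sums_from_summands_reindex[OF compact_object_sums[OF that small_image[OF sN] _ cop] refl] assms e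
    by simp
  then show ?thesis by (rule that[OF 1])
qed

text \<open>The coproduct has one summand for every morphism from a generator to K. Labels make the
  set of these morphisms an index set over \<open>'v\<close>, and \<open>unlabel\<close> recovers
  the morphism of an index.\<close>

lemma generator_cover:
  assumes K: "K \<in> obj T"
  obtains I :: "'v set" and X S \<iota> p where "small V I" "\<And>i. i \<in> I \<Longrightarrow> compact_object V T (X i)"
    "is_coproduct T I X S \<iota>" "p \<in> Homs T S K"
    "\<And>G y. G \<in> \<G> \<Longrightarrow> y \<in> Homs T G K \<Longrightarrow> \<exists>x \<in> Homs T G S. p \<cdot> x = y"
proof -
  define J where "J = (\<Union>G\<in>\<G>. Homs T G K)"
  have sJ: "small V J"
    unfolding J_def
    by (rule small_UNION[OF universe small_generators])
      (rule small_homs[OF compact_objectD[OF generators_compact] K])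
  have sJ': "small TYPE('v) J" using sJ by (simp add: small_def)
  define I where "I = (label J :: 'm \<Rightarrow> 'v) ` J"
  define X where "X i = src T (unlabel J i)" for i :: 'v
  have ul: "unlabel J (label J g :: 'v) = g" if "g \<in> J" for g using sJ' that by simp
  have sI: "small V I" unfolding I_def using sJ by (rule small_image)
  have JX: "X (label J g) \<in> \<G> \<and> g \<in> Homs T (X (label J g)) K" if "g \<in> J" for g
    using that ul by (auto simp: X_def J_def dest: HomsD)
  have comp: "compact_object V T (X i)" if "i \<in> I" for i
    using that generators_compact[OF conjunct1[OF JX]] by (auto simp: I_def)
  obtain S \<iota> where cop: "is_coproduct T I X S \<iota>"
    using small_coproducts[OF sI, of X] compact_objectD[OF comp] by blast
  have fi: "unlabel J i \<in> Homs T (X i) K" if "i \<in> I" for i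
    using that JX ul by (auto simp: I_def)
  obtain p where p: "p \<in> Homs T S K" "\<forall>i\<in>I. p \<cdot> \<iota> i = unlabel J i"
    using coproduct_induced[OF cop K, of "unlabel J"] fi by blast
  have cov: "\<exists>x \<in> Homs T G S. p \<cdot> x = y" if "G \<in> \<G>" "y \<in> Homs T G K" for G y
  proof -
    have y: "y \<in> J" using that by (auto simp: J_def)
    have XG: "X (label J y) = G" using ul[OF y] HomsD[OF that(2)] by (simp add: X_def)
    have "label J y \<in> I" using y by (simp add: I_def)
    then have "\<iota> (label J y) \<in> Homs T G S" "p \<cdot> \<iota> (label J y) = y"
      using coproductD(2)[OF cop] p(2) XG ul[OF y] by metis+
    then show ?thesis by blast
  qed
  show ?thesis by (rule that[OF sI comp cop p(1)], assumption, rule cov)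
qed

text \<open>Yoneda on the compact summands: the values of \<phi> at the inclusions \<iota> i are
  morphisms to E and glue to a. Agreement with \<phi> extends from maps through summands to all maps
  from compacts by the sum criterion.\<close>

lemma lift_from_coproduct:
  assumes I: "small V (I :: 'v set)" and X: "\<And>i. i \<in> I \<Longrightarrow> compact_object V T (X i)"
    and cop: "is_coproduct T I X S \<iota>" and E: "E \<in> obj T" and \<phi>: "yon_hom V T S E \<phi>"
  obtains a where "a \<in> Homs T S E" "\<And>C x. compact_object V T C \<Longrightarrow> x \<in> Homs T C S \<Longrightarrow> \<phi> C x = a \<cdot> x"
proof -
  note S = coproductD(1)[OF cop] and \<iota> = coproductD(2)[OF cop]
  have "\<exists>a \<in> Homs T S E. \<forall>i\<in>I. a \<cdot> \<iota> i = \<phi> (X i) (\<iota> i)"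
    by (rule coproduct_induced[OF cop E]) (rule yon_homD(1)[OF \<phi> X \<iota>])
  then obtain a where a: "a \<in> Homs T S E" "\<forall>i\<in>I. a \<cdot> \<iota> i = \<phi> (X i) (\<iota> i)"
    by blast
  have "\<phi> C x = a \<cdot> x" if C: "compact_object V T C" and x: "x \<in> Homs T C S" for C x
  proof (rule sums_from_summands_induct[where P = "\<lambda>x. \<phi> C x = a \<cdot> x", OF compact_object_sums[OF C I _ cop] x])
    show "\<And>i. i \<in> I \<Longrightarrow> X i \<in> obj T" using compact_objectD[OF X] by blast
    show "\<phi> C (hom_zero T C S) = a \<cdot> hom_zero T C S"
      using yon_hom_zero[OF \<phi> C S] cmp_zero_right[OF a(1) compact_objectD[OF C]] by simp
    show "\<phi> C (x \<uplus> y) = a \<cdot> (x \<uplus> y)"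
      if "x \<in> Homs T C S" "y \<in> Homs T C S" "\<phi> C x = a \<cdot> x" "\<phi> C y = a \<cdot> y" for x y
      using that yon_homD(2)[OF \<phi> C that(1,2)] cmp_add_right[OF that(1,2) a(1)] by simp
    show "\<phi> C (\<iota> i \<cdot> x) = a \<cdot> (\<iota> i \<cdot> x)" if "i \<in> I" "x \<in> Homs T C (X i)" for i x
      using yon_homD(3)[OF \<phi> X[OF that(1)] C that(2) \<iota>[OF that(1)]] a(2) that(1)
        cmp_assoc[OF that(2) \<iota>[OF that(1)] a(1)] by simp
  qed
  then show ?thesis by (rule that[OF a(1)])
qed

text \<open>
  If the transition maps of a sequence vanish on generators, then \<open>1 - shift\<close> acts as the identity
  on morphisms from generators.  So it is invertible although no homotopy colimit is formed.
\<close>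

lemma telescope:
  assumes K: "\<And>n. K n \<in> obj T" and c: "\<And>n. c n \<in> Homs T (K n) (K (Suc n))"
    and c0: "\<And>n G y. G \<in> \<G> \<Longrightarrow> y \<in> Homs T G (K n) \<Longrightarrow> c n \<cdot> y = hom_zero T G (K (Suc n))"
    and cop: "is_coproduct T UNIV K S \<iota>"
    and sums: "\<And>C. compact_object V T C \<Longrightarrow> sums_from_summands T UNIV K S \<iota> C"
  obtains t where "is_iso T S S t" "\<And>n. t \<cdot> \<iota> n = \<iota> n \<uplus> hom_neg T (\<iota> (Suc n) \<cdot> c n)"
proof -
  note S = coproductD(1)[OF cop] and \<iota> = coproductD(2)[OF cop, OF UNIV_I]
  have \<iota>c: "\<iota> (Suc n) \<cdot> c n \<in> Homs T (K n) S" for n using cmp_hom[OF c \<iota>] .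
  have "\<exists>t \<in> Homs T S S. \<forall>n\<in>UNIV. t \<cdot> \<iota> n = \<iota> n \<uplus> hom_neg T (\<iota> (Suc n) \<cdot> c n)"
    by (rule coproduct_induced[OF cop S]) (rule add_hom[OF \<iota> neg_hom[OF \<iota>c]])
  then obtain t where t: "t \<in> Homs T S S" and t\<iota>: "\<forall>n\<in>UNIV. t \<cdot> \<iota> n = \<iota> n \<uplus> hom_neg T (\<iota> (Suc n) \<cdot> c n)"
    by blast
  have "t \<cdot> y = y" if G: "G \<in> \<G>" and y: "y \<in> Homs T G S" for G y
  proof (rule sums_from_summands_induct[where P = "\<lambda>y. t \<cdot> y = y", OF sums[OF generators_compact[OF G]] y])
    note G' = compact_objectD[OF generators_compact[OF G]]
    show "t \<cdot> hom_zero T G S = hom_zero T G S" using cmp_zero_right[OF t G'] .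
    show "t \<cdot> (a \<uplus> b) = a \<uplus> b" if "a \<in> Homs T G S" "b \<in> Homs T G S" "t \<cdot> a = a" "t \<cdot> b = b" for a b
      using that cmp_add_right[OF that(1,2) t] by simp
    show "t \<cdot> (\<iota> n \<cdot> x) = \<iota> n \<cdot> x" if x: "x \<in> Homs T G (K n)" for n x
    proof -
      have "\<iota> (Suc n) \<cdot> c n \<cdot> x = hom_zero T G S"
        using cmp_assoc[OF x c \<iota>] c0[OF G x] cmp_zero_right[OF \<iota> G'] by simp
      then have "hom_neg T (\<iota> (Suc n) \<cdot> c n) \<cdot> x = hom_zero T G S"
        using cmp_neg_left[OF x \<iota>c] add_neg(2)[OF zero_hom[OF G' S]] add_zero(1)[OF neg_hom[OF zero_hom[OF G' S]]]
        by simp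
      then show ?thesis
        using cmp_assoc[OF x \<iota> t] t\<iota> cmp_add_left[OF x \<iota> neg_hom[OF \<iota>c]] add_zero(1)[OF cmp_hom[OF x \<iota>]]
        by simp
    qed
  qed
  then have "is_iso T S S t" by (rule is_iso_if_identity_on_generators[OF t])
  then show ?thesis by (rule that) (use t\<iota> in simp)
qed

text \<open>The maps k n glue to a map b on the coproduct, and their compatibility says that b (1 -
  shift) = 0. As 1 - shift is invertible, b vanishes.\<close>

lemma telescope_vanishing:
  assumes K: "\<And>n. K n \<in> obj T" and c: "\<And>n. c n \<in> Homs T (K n) (K (Suc n))"
    and c0: "\<And>n G y. G \<in> \<G> \<Longrightarrow> y \<in> Homs T G (K n) \<Longrightarrow> c n \<cdot> y = hom_zero T G (K (Suc n))"
    and k: "\<And>n. k n \<in> Homs T (K n) E" and kc: "\<And>n. k (Suc n) \<cdot> c n = k n"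
  shows "k 0 = hom_zero T (K 0) E"
proof -
  obtain S \<iota> where cop: "is_coproduct T UNIV K S \<iota>"
    and sums: "\<And>C. compact_object V T C \<Longrightarrow> sums_from_summands T UNIV K S \<iota> C"
    by (rule nat_coproduct[OF K], rule that, assumption, simp)
  obtain t where t: "is_iso T S S t" and t\<iota>: "\<And>n. t \<cdot> \<iota> n = \<iota> n \<uplus> hom_neg T (\<iota> (Suc n) \<cdot> c n)"
    by (rule telescope[OF K c c0 cop sums], assumption+, rule that, assumption, simp)
  note S = coproductD(1)[OF cop] and \<iota> = coproductD(2)[OF cop, OF UNIV_I]
  have E: "E \<in> obj T" using Homs_obj[OF k] by blast
  have \<iota>c: "\<iota> (Suc n) \<cdot> c n \<in> Homs T (K n) S" for n using cmp_hom[OF c \<iota>] .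
  obtain t' where t': "t \<in> Homs T S S" "t' \<in> Homs T S S" "t \<cdot> t' = ident T S"
    using is_isoE[OF t] by metis
  obtain b where b: "b \<in> Homs T S E" "\<forall>n\<in>UNIV. b \<cdot> \<iota> n = k n"
    using coproduct_induced[OF cop E k] by blast
  have "b \<cdot> t = hom_zero T S E"
  proof (rule coproduct_eqI[OF cop cmp_hom[OF t'(1) b(1)] zero_hom[OF S E]])
    fix n
    have "b \<cdot> t \<cdot> \<iota> n = b \<cdot> (\<iota> n \<uplus> hom_neg T (\<iota> (Suc n) \<cdot> c n))"
      using cmp_assoc[OF \<iota> t'(1) b(1)] t\<iota> by simp
    also have "\<dots> = k n \<uplus> hom_neg T (k (Suc n) \<cdot> c n)"
      using cmp_add_right[OF \<iota> neg_hom[OF \<iota>c] b(1)] cmp_neg_right[OF \<iota>c b(1)] cmp_assoc[OF c \<iota> b(1)] b(2)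
      by simp
    finally show "b \<cdot> t \<cdot> \<iota> n = hom_zero T S E \<cdot> \<iota> n"
      using kc add_neg(1)[OF k] cmp_zero_left[OF \<iota> E] by simp
  qed
  then have "b \<cdot> t \<cdot> t' = hom_zero T S E" using cmp_zero_left[OF t'(2) E] by simp
  then have "b = hom_zero T S E"
    using cmp_assoc[OF t'(2,1) b(1)] t'(3) ident_right[OF b(1)] by simp
  then show ?thesis using b(2) cmp_zero_left[OF \<iota> E] by (metis UNIV_I)
qed

text \<open>
  The morphism is \<open>b (1 - shift)\<inverse> \<iota>\<^sub>0\<close> with \<open>b \<iota>\<^sub>n = a\<^sub>n\<close>.  Every \<open>y : C \<rightarrow> K\<^sub>0\<close> with \<open>C\<close> compact is
  killed by some composite of transition maps, so iterating the step expresses \<open>\<phi>\<^sub>0 y\<close> as a finite sum.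
\<close>

lemma telescope_lift:
  assumes K: "\<And>n. K n \<in> obj T" and c: "\<And>n. c n \<in> Homs T (K n) (K (Suc n))"
    and c0: "\<And>n G y. G \<in> \<G> \<Longrightarrow> y \<in> Homs T G (K n) \<Longrightarrow> c n \<cdot> y = hom_zero T G (K (Suc n))"
    and \<phi>: "\<And>n. yon_hom V T (K n) E (\<phi> n)" and a: "\<And>n. a n \<in> Homs T (K n) E"
    and step: "\<And>n C x. compact_object V T C \<Longrightarrow> x \<in> Homs T C (K n) \<Longrightarrow>
      \<phi> n C x = a n \<cdot> x \<uplus> \<phi> (Suc n) C (c n \<cdot> x)"
  obtains f where "f \<in> Homs T (K 0) E"
    "\<And>C x. compact_object V T C \<Longrightarrow> x \<in> Homs T C (K 0) \<Longrightarrow> \<phi> 0 C x = f \<cdot> x"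
proof -
  obtain S \<iota> where cop: "is_coproduct T UNIV K S \<iota>"
    and sums: "\<And>C. compact_object V T C \<Longrightarrow> sums_from_summands T UNIV K S \<iota> C"
    by (rule nat_coproduct[OF K], rule that, assumption, simp)
  obtain t where t: "is_iso T S S t" and t\<iota>: "\<And>n. t \<cdot> \<iota> n = \<iota> n \<uplus> hom_neg T (\<iota> (Suc n) \<cdot> c n)"
    by (rule telescope[OF K c c0 cop sums], assumption+, rule that, assumption, simp)
  note S = coproductD(1)[OF cop] and \<iota> = coproductD(2)[OF cop, OF UNIV_I]
  have E: "E \<in> obj T" using Homs_obj[OF a] by blast
  have \<iota>c: "\<iota> (Suc n) \<cdot> c n \<in> Homs T (K n) S" for n using cmp_hom[OF c \<iota>] .
  obtain t' where tH: "t \<in> Homs T S S" and t'H: "t' \<in> Homs T S S" and tt': "t \<cdot> t' = ident T S"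
    using is_isoE[OF t] by metis
  obtain b where b: "b \<in> Homs T S E" and b\<iota>: "\<forall>n\<in>UNIV. b \<cdot> \<iota> n = a n"
    using coproduct_induced[OF cop E a] by blast
  obtain \<pi> where \<pi>: "\<And>n. \<pi> n \<in> Homs T S (K n)" and \<pi>1: "\<And>n. \<pi> n \<cdot> \<iota> n = ident T (K n)"
    and \<pi>0: "\<And>m n. m \<noteq> n \<Longrightarrow> \<pi> n \<cdot> \<iota> m = hom_zero T (K m) (K n)"
    using coproduct_projections[OF cop K] by (metis UNIV_I)
  \<comment> \<open>The coordinates of s are the composites of transition maps out of K 0: the first
    is the identity, and the next one is always c n after the previous. This comes from comparing
    \<pi> n t with \<pi> n and using t s = \<iota> 0.\<close>
  define s where "s = t' \<cdot> \<iota> 0"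
  have s: "s \<in> Homs T (K 0) S" unfolding s_def using cmp_hom[OF \<iota> t'H] .
  have ts: "t \<cdot> s = \<iota> 0"
    unfolding s_def using cmp_assoc[OF \<iota> t'H tH] tt' ident_left[OF \<iota>] by simp
  have \<pi>t\<iota>: "\<pi> n \<cdot> t \<cdot> \<iota> m = \<pi> n \<cdot> \<iota> m \<uplus> hom_neg T (\<pi> n \<cdot> \<iota> (Suc m) \<cdot> c m)" for n m
    using cmp_assoc[OF \<iota> tH \<pi>] t\<iota> cmp_add_right[OF \<iota> neg_hom[OF \<iota>c] \<pi>] cmp_neg_right[OF \<iota>c \<pi>]
      cmp_assoc[OF c \<iota> \<pi>] by simp
  have neg0: "hom_neg T (hom_zero T X Y) = hom_zero T X Y" if "X \<in> obj T" "Y \<in> obj T" for X Y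
    using add_neg(1)[OF zero_hom[OF that]] add_zero(2)[OF neg_hom[OF zero_hom[OF that]]] by simp
  have "\<pi> 0 \<cdot> t = \<pi> 0"
  proof (rule coproduct_eqI[OF cop cmp_hom[OF tH \<pi>] \<pi>])
    fix m
    show "\<pi> 0 \<cdot> t \<cdot> \<iota> m = \<pi> 0 \<cdot> \<iota> m"
      unfolding \<pi>t\<iota> using \<pi>0[of "Suc m" 0] cmp_zero_left[OF c K] neg0[OF K K] add_zero(1)[OF cmp_hom[OF \<iota> \<pi>]]
      by simp
  qed
  then have \<pi>s0: "\<pi> 0 \<cdot> s = ident T (K 0)" using cmp_assoc[OF s tH \<pi>, of 0] ts \<pi>1 by simp
  have \<pi>t: "\<pi> (Suc n) \<cdot> t = \<pi> (Suc n) \<uplus> hom_neg T (c n \<cdot> \<pi> n)" for n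
  proof (rule coproduct_eqI[OF cop cmp_hom[OF tH \<pi>] add_hom[OF \<pi> neg_hom[OF cmp_hom[OF \<pi> c]]]])
    fix m
    have "\<pi> (Suc n) \<cdot> \<iota> (Suc m) \<cdot> c m = c n \<cdot> (\<pi> n \<cdot> \<iota> m)"
    proof (cases "m = n")
      case True
      then show ?thesis using \<pi>1 ident_left[OF c] ident_right[OF c] by simp
    next
      case False
      then show ?thesis using \<pi>0 cmp_zero_left[OF c K] cmp_zero_right[OF c K] by simp
    qed
    then show "\<pi> (Suc n) \<cdot> t \<cdot> \<iota> m = (\<pi> (Suc n) \<uplus> hom_neg T (c n \<cdot> \<pi> n)) \<cdot> \<iota> m"
      unfolding \<pi>t\<iota> using cmp_add_left[OF \<iota> \<pi> neg_hom[OF cmp_hom[OF \<pi> c]]]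
        cmp_neg_left[OF \<iota> cmp_hom[OF \<pi> c]] cmp_assoc[OF \<iota> \<pi> c] by simp
  qed
  have \<pi>s: "\<pi> (Suc n) \<cdot> s = c n \<cdot> (\<pi> n \<cdot> s)" for n
  proof -
    have "\<pi> (Suc n) \<cdot> s \<uplus> hom_neg T (c n \<cdot> (\<pi> n \<cdot> s)) = \<pi> (Suc n) \<cdot> t \<cdot> s"
      unfolding \<pi>t using cmp_add_left[OF s \<pi> neg_hom[OF cmp_hom[OF \<pi> c]]]
        cmp_neg_left[OF s cmp_hom[OF \<pi> c]] cmp_assoc[OF s \<pi> c] by simp
    also have "\<dots> = hom_zero T (K 0) (K (Suc n))"
      using cmp_assoc[OF s tH \<pi>] ts \<pi>0[of 0 "Suc n"] by simp
    finally show ?thesis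
      using diff_eq_zero_iff[OF cmp_hom[OF s \<pi>] cmp_hom[OF cmp_hom[OF s \<pi>] c]] by simp
  qed
  \<comment> \<open>The partial sum of the idempotents \<iota> m \<pi> m over m < n.\<close>
  define q where "q n = rec_nat (hom_zero T S S) (\<lambda>n e. e \<uplus> \<iota> n \<cdot> \<pi> n) n" for n
  have q0: "q 0 = hom_zero T S S" and qS: "q (Suc n) = q n \<uplus> \<iota> n \<cdot> \<pi> n" for n
    by (simp_all add: q_def)
  have \<iota>\<pi>: "\<iota> n \<cdot> \<pi> n \<in> Homs T S S" for n using cmp_hom[OF \<pi> \<iota>] .
  have q: "q n \<in> Homs T S S" for n
    by (induction n) (simp_all add: q0 qS zero_hom S add_hom \<iota>\<pi>)
  have q\<iota>: "q n \<cdot> \<iota> m = (if m < n then \<iota> m else hom_zero T (K m) S)" for n m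
  proof (induction n)
    case 0
    then show ?case using cmp_zero_left[OF \<iota> S] by (simp add: q0)
  next
    case (Suc n)
    have "\<iota> n \<cdot> \<pi> n \<cdot> \<iota> m = (if m = n then \<iota> m else hom_zero T (K m) S)"
      using cmp_assoc[OF \<iota> \<pi> \<iota>, symmetric] \<pi>1 \<pi>0[of m n] ident_right[OF \<iota>] cmp_zero_right[OF \<iota> K] by auto
    then show ?case
      using Suc cmp_add_left[OF \<iota> q \<iota>\<pi>] add_zero[OF \<iota>] add_zero[OF zero_hom[OF K S]]
      by (auto simp: qS less_Suc_eq)
  qed
  \<comment> \<open>A map from a compact object meets only finitely many summands, so eventually its
    coordinates vanish and the partial sums reproduce it. Applied to s y this says that y dies along
    the sequence.\<close>
  have fin: "\<exists>N. \<forall>n\<ge>N. \<pi> n \<cdot> z = hom_zero T C (K n) \<and> q n \<cdot> z = z"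
    if C: "compact_object V T C" and z: "z \<in> Homs T C S" for C z
  proof (rule sums_from_summands_induct[where P = "\<lambda>z. \<exists>N. \<forall>n\<ge>N. \<pi> n \<cdot> z = hom_zero T C (K n) \<and> q n \<cdot> z = z",
        OF sums[OF C] z])
    note C' = compact_objectD[OF C]
    show "\<exists>N. \<forall>n\<ge>N. \<pi> n \<cdot> hom_zero T C S = hom_zero T C (K n) \<and> q n \<cdot> hom_zero T C S = hom_zero T C S"
      using cmp_zero_right[OF \<pi> C'] cmp_zero_right[OF q C'] by blast
  next
    note C' = compact_objectD[OF C]
    fix x y assume x: "x \<in> Homs T C S" and y: "y \<in> Homs T C S"
      and "\<exists>N. \<forall>n\<ge>N. \<pi> n \<cdot> x = hom_zero T C (K n) \<and> q n \<cdot> x = x"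
      and "\<exists>N. \<forall>n\<ge>N. \<pi> n \<cdot> y = hom_zero T C (K n) \<and> q n \<cdot> y = y"
    then obtain N M where "\<forall>n\<ge>N. \<pi> n \<cdot> x = hom_zero T C (K n) \<and> q n \<cdot> x = x"
      "\<forall>n\<ge>M. \<pi> n \<cdot> y = hom_zero T C (K n) \<and> q n \<cdot> y = y" by blast
    then have "\<forall>n\<ge>max N M. \<pi> n \<cdot> (x \<uplus> y) = hom_zero T C (K n) \<and> q n \<cdot> (x \<uplus> y) = x \<uplus> y"
      using cmp_add_right[OF x y \<pi>] cmp_add_right[OF x y q] add_zero(1)[OF zero_hom[OF C' K]] by simp
    then show "\<exists>N. \<forall>n\<ge>N. \<pi> n \<cdot> (x \<uplus> y) = hom_zero T C (K n) \<and> q n \<cdot> (x \<uplus> y) = x \<uplus> y" by blast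
  next
    fix m x assume x: "x \<in> Homs T C (K m)"
    have "\<forall>n\<ge>Suc m. \<pi> n \<cdot> (\<iota> m \<cdot> x) = hom_zero T C (K n) \<and> q n \<cdot> (\<iota> m \<cdot> x) = \<iota> m \<cdot> x"
      using cmp_assoc[OF x \<iota> \<pi>] cmp_assoc[OF x \<iota> q] q\<iota> \<pi>0 cmp_zero_left[OF x K] by simp
    then show "\<exists>N. \<forall>n\<ge>N. \<pi> n \<cdot> (\<iota> m \<cdot> x) = hom_zero T C (K n) \<and> q n \<cdot> (\<iota> m \<cdot> x) = \<iota> m \<cdot> x" by blast
  qed
  \<comment> \<open>Each use of \<open>step\<close> splits off one correction a n, which is b on the
    n-th summand, and leaves \<phi> n at the n-th coordinate as remainder.\<close>
  have main: "\<phi> 0 C y = b \<cdot> (q n \<cdot> (s \<cdot> y)) \<uplus> \<phi> n C (\<pi> n \<cdot> (s \<cdot> y))"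
    if C: "compact_object V T C" and y: "y \<in> Homs T C (K 0)" for C y n
  proof (induction n)
    case 0
    note sy = cmp_hom[OF y s]
    show ?case
      using cmp_zero_left[OF sy S] cmp_zero_right[OF b compact_objectD[OF C]] cmp_assoc[OF y s \<pi>] \<pi>s0
        ident_left[OF y] add_zero(2)[OF yon_homD(1)[OF \<phi> C y]] by (simp add: q0)
  next
    case (Suc n)
    note sy = cmp_hom[OF y s]
    note psy = cmp_hom[OF sy \<pi>]
    have p: "\<pi> (Suc n) \<cdot> (s \<cdot> y) = c n \<cdot> (\<pi> n \<cdot> (s \<cdot> y))"
      using cmp_assoc[OF y s \<pi>] \<pi>s cmp_assoc[OF y cmp_hom[OF s \<pi>] c] by simp
    have "b \<cdot> (q (Suc n) \<cdot> (s \<cdot> y)) = b \<cdot> (q n \<cdot> (s \<cdot> y)) \<uplus> b \<cdot> (\<iota> n \<cdot> \<pi> n \<cdot> (s \<cdot> y))"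
      unfolding qS
      using cmp_add_left[OF sy q \<iota>\<pi>] cmp_add_right[OF cmp_hom[OF sy q] cmp_hom[OF sy \<iota>\<pi>] b] by simp
    also have "b \<cdot> (\<iota> n \<cdot> \<pi> n \<cdot> (s \<cdot> y)) = a n \<cdot> (\<pi> n \<cdot> (s \<cdot> y))"
      using cmp_assoc[OF sy \<pi> \<iota>] cmp_assoc[OF psy \<iota> b] b\<iota> by simp
    finally show ?case
      using Suc step[OF C psy] p
        add_assoc[OF cmp_hom[OF cmp_hom[OF sy q] b] cmp_hom[OF psy a] yon_homD(1)[OF \<phi> C cmp_hom[OF psy c]]]
      by simp
  qed
  have "\<phi> 0 C y = b \<cdot> s \<cdot> y" if C: "compact_object V T C" and y: "y \<in> Homs T C (K 0)" for C y
  proof -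
    note sy = cmp_hom[OF y s]
    obtain N where "\<pi> N \<cdot> (s \<cdot> y) = hom_zero T C (K N)" "q N \<cdot> (s \<cdot> y) = s \<cdot> y"
      using fin[OF C sy] by blast
    then show ?thesis
      using main[OF C y, of N] yon_hom_zero[OF \<phi> C K] add_zero(1)[OF cmp_hom[OF sy b]] cmp_assoc[OF y s b]
      by simp
  qed
  then show ?thesis by (rule that[OF cmp_hom[OF s b]])
qed

text \<open>
  A phantom \<open>k : K \<rightarrow> E\<close> extends to the cone of a cover of \<open>K\<close> by generators.  The extension is again a
  phantom after correcting it by a map through the suspension of the cover, which injectivity provides.
\<close>

lemma phantom_step:
  assumes E: "pure_injective V T E" and k: "k \<in> Homs T K E"
    and ph: "\<And>C x. compact_object V T C \<Longrightarrow> x \<in> Homs T C K \<Longrightarrow> k \<cdot> x = hom_zero T C E"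
  obtains K' c k' where "c \<in> Homs T K K'" "k' \<in> Homs T K' E" "k' \<cdot> c = k"
    "\<And>G y. G \<in> \<G> \<Longrightarrow> y \<in> Homs T G K \<Longrightarrow> c \<cdot> y = hom_zero T G K'"
    "\<And>C x. compact_object V T C \<Longrightarrow> x \<in> Homs T C K' \<Longrightarrow> k' \<cdot> x = hom_zero T C E"
proof -
  note KE = Homs_obj[OF k]
  obtain I :: "'v set" and X S \<iota> p where I: "small V I" and X: "\<And>i. i \<in> I \<Longrightarrow> compact_object V T (X i)"
    and cop: "is_coproduct T I X S \<iota>" and p: "p \<in> Homs T S K"
    and cover: "\<And>G y. G \<in> \<G> \<Longrightarrow> y \<in> Homs T G K \<Longrightarrow> \<exists>x \<in> Homs T G S. p \<cdot> x = y"
    using generator_cover[of K] KE by metis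
  note S = coproductD(1)[OF cop] and \<iota> = coproductD(2)[OF cop]
  have X': "\<And>i. i \<in> I \<Longrightarrow> X i \<in> obj T" using compact_objectD[OF X] by blast
  obtain K' c d where tri: "(p, c, d) \<in> tri T" and c: "c \<in> Homs T K K'" and d: "d \<in> Homs T K' (\<Sigma>\<^sub>o S)"
    using coneE[OF p] by blast
  have "k \<cdot> p = hom_zero T S E"
  proof (rule coproduct_eqI[OF cop cmp_hom[OF p k] zero_hom])
    fix i assume i: "i \<in> I"
    show "k \<cdot> p \<cdot> \<iota> i = hom_zero T S E \<cdot> \<iota> i"
      using cmp_assoc[OF \<iota>[OF i] p k] ph[OF X[OF i] cmp_hom[OF \<iota>[OF i] p]] cmp_zero_left[OF \<iota>[OF i]] KE
      by simp
  qed (use S KE in auto)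
  then obtain k1 where k1: "k1 \<in> Homs T K' E" "k1 \<cdot> c = k"
    using hom_exact_contravariant[OF tri p c k] by blast
  have ker: "k1 \<cdot> x = hom_zero T C E"
    if C: "compact_object V T C" and x: "x \<in> Homs T C K'" and dx: "d \<cdot> x = hom_zero T C (\<Sigma>\<^sub>o S)" for C x
  proof -
    obtain y where y: "y \<in> Homs T C K" "c \<cdot> y = x"
      using hom_exact_covariant[OF tri_rotate[OF tri p] c d x dx] by blast
    then show ?thesis using cmp_assoc[OF y(1) c k1(1)] k1(2) ph[OF C y(1)] by simp
  qed
  obtain \<chi> where \<chi>: "yon_hom V T (\<Sigma>\<^sub>o S) E \<chi>"
    and \<chi>d: "\<And>C x. compact_object V T C \<Longrightarrow> x \<in> Homs T C K' \<Longrightarrow> \<chi> C (d \<cdot> x) = k1 \<cdot> x"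
    using pure_injective_extend[OF E d yon_hom_post[OF k1(1)] ker] by blast
  \<comment> \<open>\<Sigma>S is again a coproduct of compact objects, so \<chi> is induced by a
    morphism l; subtracting l d from k1 makes the extension phantom and does not change its
    restriction along c.\<close>
  obtain l where l: "l \<in> Homs T (\<Sigma>\<^sub>o S) E"
    and \<chi>l: "\<And>C x. compact_object V T C \<Longrightarrow> x \<in> Homs T C (\<Sigma>\<^sub>o S) \<Longrightarrow> \<chi> C x = l \<cdot> x"
    using lift_from_coproduct[OF I compact_susp[OF X] coproduct_susp[OF cop X'] _ \<chi>] KE by blast
  note ld = cmp_hom[OF d l]
  let ?k' = "k1 \<uplus> hom_neg T (l \<cdot> d)"
  have k': "?k' \<in> Homs T K' E" using add_hom[OF k1(1) neg_hom[OF ld]] .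
  have dc: "d \<cdot> c = hom_zero T K (\<Sigma>\<^sub>o S)" using tri_cmp_zero[OF tri_rotate[OF tri p] c d] .
  have K: "K \<in> obj T" and E': "E \<in> obj T" using KE by blast+
  have "l \<cdot> d \<cdot> c = hom_zero T K E" using cmp_assoc[OF c d l] dc cmp_zero_right[OF l K] by simp
  then have "hom_neg T (l \<cdot> d) \<cdot> c = hom_zero T K E"
    using cmp_neg_left[OF c ld] add_neg(1)[OF zero_hom[OF K E']] add_zero(2)[OF neg_hom[OF zero_hom[OF K E']]]
    by simp
  then have "?k' \<cdot> c = k"
    using cmp_add_left[OF c k1(1) neg_hom[OF ld]] k1(2) add_zero(1)[OF k] by simp
  moreover have "c \<cdot> y = hom_zero T G K'" if G: "G \<in> \<G>" and y: "y \<in> Homs T G K" for G y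
  proof -
    obtain x where x: "x \<in> Homs T G S" "p \<cdot> x = y" using cover[OF G y] by blast
    then show ?thesis
      using cmp_assoc[OF x(1) p c] tri_cmp_zero[OF tri p c] cmp_zero_left[OF x(1)] Homs_obj[OF c] by simp
  qed
  moreover have "?k' \<cdot> x = hom_zero T C E" if C: "compact_object V T C" and x: "x \<in> Homs T C K'" for C x
  proof -
    have "k1 \<cdot> x = l \<cdot> d \<cdot> x"
      using \<chi>d[OF C x] \<chi>l[OF C cmp_hom[OF x d]] cmp_assoc[OF x d l] by simp
    then show ?thesis
      using cmp_add_left[OF x k1(1) neg_hom[OF ld]] cmp_neg_left[OF x ld] add_neg(1)[OF cmp_hom[OF x ld]]
      by simp
  qed
  ultimately show ?thesis by (rule that[OF c k'])
qed

text \<open>Iterating \<open>phantom_step\<close> gives a sequence with transition maps that vanish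
  on generators and a compatible family of phantoms that starts with k;
  \<open>telescope_vanishing\<close> then applies.\<close>

lemma phantom_to_pure_injective:
  assumes E: "pure_injective V T E" and k: "k \<in> Homs T K E"
    and ph: "\<And>C x. compact_object V T C \<Longrightarrow> x \<in> Homs T C K \<Longrightarrow> k \<cdot> x = hom_zero T C E"
  shows "k = hom_zero T K E"
proof -
  define P where "P w \<longleftrightarrow> snd w \<in> Homs T (fst w) E \<and>
    (\<forall>C x. compact_object V T C \<longrightarrow> x \<in> Homs T C (fst w) \<longrightarrow> snd w \<cdot> x = hom_zero T C E)" for w
  define Q where "Q w w' c \<longleftrightarrow> c \<in> Homs T (fst w) (fst w') \<and> snd w' \<cdot> c = snd w \<and>
    (\<forall>G y. G \<in> \<G> \<longrightarrow> y \<in> Homs T G (fst w) \<longrightarrow> c \<cdot> y = hom_zero T G (fst w'))" for w w' c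
  have "\<exists>w'. P w' \<and> (\<exists>c. Q w w' c)" if "P w" for w
  proof -
    obtain K' c k' where "c \<in> Homs T (fst w) K'" "k' \<in> Homs T K' E" "k' \<cdot> c = snd w"
      "\<And>G y. G \<in> \<G> \<Longrightarrow> y \<in> Homs T G (fst w) \<Longrightarrow> c \<cdot> y = hom_zero T G K'"
      "\<And>C x. compact_object V T C \<Longrightarrow> x \<in> Homs T C K' \<Longrightarrow> k' \<cdot> x = hom_zero T C E"
      using phantom_step[OF E, of "snd w" "fst w"] \<open>P w\<close> unfolding P_def by metis
    then have "P (K', k') \<and> Q w (K', k') c" by (simp add: P_def Q_def)
    then show ?thesis by blast
  qed
  moreover have "P (K, k)" using k ph by (simp add: P_def)
  \<comment> \<open>The clause for n = 0 in the predicate fixes the start of the dependent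
    choice.\<close>
  ultimately obtain w where w0: "w 0 = (K, k)" and w: "\<And>n. P (w n)" "\<And>n. \<exists>c. Q (w n) (w (Suc n)) c"
    using dependent_nat_choice[of "\<lambda>n w. P w \<and> (n = 0 \<longrightarrow> w = (K, k))" "\<lambda>n w w'. \<exists>c. Q w w' c"]
    by (metis nat.distinct(1))
  obtain c where c: "\<And>n. Q (w n) (w (Suc n)) (c n)" using w(2) by metis
  have "fst (w n) \<in> obj T" for n using w(1)[of n] Homs_obj unfolding P_def by blast
  then have "snd (w 0) = hom_zero T (fst (w 0)) E"
    by (rule telescope_vanishing[of "\<lambda>n. fst (w n)" c "\<lambda>n. snd (w n)"])
      (use w(1) c in \<open>auto simp: P_def Q_def\<close>)
  then show ?thesis by (simp add: w0)
qed

text \<open>On the cover S, \<phi> is induced by a0. On the fibre k of p the map a0 is phantom,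
  because \<phi> is applied to p k x = 0; so a0 k = 0 and a0 = a p. Then \<phi> - ya vanishes on
  whatever lifts to S, that is on the kernel of yc, and pure injectivity extends it along c.\<close>

lemma lift_step:
  assumes E: "pure_injective V T E" and K: "K \<in> obj T" and \<phi>: "yon_hom V T K E \<phi>"
  obtains K' c \<phi>' a where "c \<in> Homs T K K'" "a \<in> Homs T K E" "yon_hom V T K' E \<phi>'"
    "\<And>G y. G \<in> \<G> \<Longrightarrow> y \<in> Homs T G K \<Longrightarrow> c \<cdot> y = hom_zero T G K'"
    "\<And>C x. compact_object V T C \<Longrightarrow> x \<in> Homs T C K \<Longrightarrow> \<phi> C x = a \<cdot> x \<uplus> \<phi>' C (c \<cdot> x)"
proof -
  have E': "E \<in> obj T" using E by (simp add: pure_injective_def)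
  obtain I :: "'v set" and X S \<iota> p where I: "small V I" and X: "\<And>i. i \<in> I \<Longrightarrow> compact_object V T (X i)"
    and cop: "is_coproduct T I X S \<iota>" and p: "p \<in> Homs T S K"
    and cover: "\<And>G y. G \<in> \<G> \<Longrightarrow> y \<in> Homs T G K \<Longrightarrow> \<exists>x \<in> Homs T G S. p \<cdot> x = y"
    using generator_cover[OF K] by metis
  obtain K' c d where tri: "(p, c, d) \<in> tri T" and c: "c \<in> Homs T K K'"
    using coneE[OF p] by blast
  obtain a0 where a0: "a0 \<in> Homs T S E"
    and \<phi>a0: "\<And>C x. compact_object V T C \<Longrightarrow> x \<in> Homs T C S \<Longrightarrow> \<phi> C (p \<cdot> x) = a0 \<cdot> x"
    using lift_from_coproduct[OF I X cop E' yon_hom_comp[OF yon_hom_post[OF p] \<phi>]] by blast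
  obtain F k h where k: "k \<in> Homs T F S" and fib: "(k, p, h) \<in> tri T"
    using fibreE[OF p] by blast
  have "a0 \<cdot> k = hom_zero T F E"
  proof (rule phantom_to_pure_injective[OF E cmp_hom[OF k a0]])
    fix C x assume C: "compact_object V T C" and x: "x \<in> Homs T C F"
    have "p \<cdot> (k \<cdot> x) = hom_zero T C K"
      using cmp_assoc[OF x k p] tri_cmp_zero[OF fib k p] cmp_zero_left[OF x K] by simp
    then show "a0 \<cdot> k \<cdot> x = hom_zero T C E"
      using \<phi>a0[OF C cmp_hom[OF x k]] cmp_assoc[OF x k a0] yon_hom_zero[OF \<phi> C K] by simp
  qed
  then obtain a where a: "a \<in> Homs T K E" "a \<cdot> p = a0"
    using hom_exact_contravariant[OF fib k p a0] by blast
  note diff = yon_hom_diff[OF \<phi> yon_hom_post[OF a(1)]]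
  have ker: "\<phi> C x \<uplus> hom_neg T (a \<cdot> x) = hom_zero T C E"
    if C: "compact_object V T C" and x: "x \<in> Homs T C K" and cx: "c \<cdot> x = hom_zero T C K'" for C x
  proof -
    obtain y where y: "y \<in> Homs T C S" "p \<cdot> y = x"
      using hom_exact_covariant[OF tri p c x cx] by blast
    then have "\<phi> C x = a \<cdot> x" using \<phi>a0[OF C y(1)] cmp_assoc[OF y(1) p a(1)] a(2) by simp
    then show ?thesis using add_neg(1)[OF cmp_hom[OF x a(1)]] by simp
  qed
  obtain \<phi>' where \<phi>': "yon_hom V T K' E \<phi>'"
    and \<phi>'c: "\<And>C x. compact_object V T C \<Longrightarrow> x \<in> Homs T C K \<Longrightarrow> \<phi>' C (c \<cdot> x) = \<phi> C x \<uplus> hom_neg T (a \<cdot> x)"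
    using pure_injective_extend[OF E c diff ker] by blast
  have eq: "\<phi> C x = a \<cdot> x \<uplus> \<phi>' C (c \<cdot> x)" if C: "compact_object V T C" and x: "x \<in> Homs T C K" for C x
    using \<phi>'c[OF C x] add_diff_cancel[OF yon_homD(1)[OF \<phi> C x] cmp_hom[OF x a(1)]] by simp
  have kill: "c \<cdot> y = hom_zero T G K'" if G: "G \<in> \<G>" and y: "y \<in> Homs T G K" for G y
  proof -
    obtain x where x: "x \<in> Homs T G S" "p \<cdot> x = y" using cover[OF G y] by blast
    then show ?thesis
      using cmp_assoc[OF x(1) p c] tri_cmp_zero[OF tri p c] cmp_zero_left[OF x(1)] Homs_obj[OF c] by simp
  qed
  show ?thesis
    by (rule that[OF c a(1) \<phi>']) (rule kill eq; assumption)+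
qed

text \<open>Iterated use of \<open>lift_step\<close> records at each stage the object, the
  homomorphism still to be induced, the transition map and the correction; these are the input of
  \<open>telescope_lift\<close>.\<close>

lemma yon_full_on_pure_injectives:
  assumes E: "pure_injective V T E" and K: "K \<in> obj T" and \<phi>: "yon_hom V T K E \<phi>"
  obtains f where "f \<in> Homs T K E"
    "\<And>C x. compact_object V T C \<Longrightarrow> x \<in> Homs T C K \<Longrightarrow> \<phi> C x = f \<cdot> x"
proof -
  define P where "P w \<longleftrightarrow> fst w \<in> obj T \<and> yon_hom V T (fst w) E (snd w)" for w
  define Q where "Q w w' ca \<longleftrightarrow> fst ca \<in> Homs T (fst w) (fst w') \<and> snd ca \<in> Homs T (fst w) E \<and>
    (\<forall>G y. G \<in> \<G> \<longrightarrow> y \<in> Homs T G (fst w) \<longrightarrow> fst ca \<cdot> y = hom_zero T G (fst w')) \<and>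
    (\<forall>C x. compact_object V T C \<longrightarrow> x \<in> Homs T C (fst w) \<longrightarrow>
      snd w C x = snd ca \<cdot> x \<uplus> snd w' C (fst ca \<cdot> x))" for w w' ca
  have "\<exists>w'. P w' \<and> (\<exists>ca. Q w w' ca)" if w: "P w" for w
  proof -
    have w': "fst w \<in> obj T" "yon_hom V T (fst w) E (snd w)" using w by (simp_all add: P_def)
    show ?thesis
    proof (rule lift_step[OF E w'])
      fix K' c \<phi>' a
      assume "c \<in> Homs T (fst w) K'" "a \<in> Homs T (fst w) E" "yon_hom V T K' E \<phi>'"
        "\<And>G y. G \<in> \<G> \<Longrightarrow> y \<in> Homs T G (fst w) \<Longrightarrow> c \<cdot> y = hom_zero T G K'"
        "\<And>C x. compact_object V T C \<Longrightarrow> x \<in> Homs T C (fst w) \<Longrightarrow> snd w C x = a \<cdot> x \<uplus> \<phi>' C (c \<cdot> x)"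
      then have "P (K', \<phi>') \<and> Q w (K', \<phi>') (c, a)" using Homs_obj by (simp add: P_def Q_def)
      then show ?thesis by blast
    qed
  qed
  moreover have "P (K, \<phi>)" using K \<phi> by (simp add: P_def)
  ultimately obtain w where w0: "w 0 = (K, \<phi>)" and w: "\<And>n. P (w n)" "\<And>n. \<exists>ca. Q (w n) (w (Suc n)) ca"
    using dependent_nat_choice[of "\<lambda>n w. P w \<and> (n = 0 \<longrightarrow> w = (K, \<phi>))" "\<lambda>n w w'. \<exists>ca. Q w w' ca"]
    by (metis nat.distinct(1))
  obtain ca where ca: "\<And>n. Q (w n) (w (Suc n)) (ca n)" using w(2) by metis
  obtain f where "f \<in> Homs T (fst (w 0)) E"
    "\<And>C x. compact_object V T C \<Longrightarrow> x \<in> Homs T C (fst (w 0)) \<Longrightarrow> snd (w 0) C x = f \<cdot> x"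
    by (rule telescope_lift[of "\<lambda>n. fst (w n)" "\<lambda>n. fst (ca n)" E "\<lambda>n. snd (w n)" "\<lambda>n. snd (ca n)"])
      (use w(1) ca in \<open>auto simp: P_def Q_def\<close>)
  then show ?thesis using that by (simp add: w0)
qed

end


section \<open>Character duals of modules, evaluation, and the triple dual\<close>

section \<open>Duals of modules\<close>

definition dual_raw :: "('p, 'n, 'w) preadd_scheme \<Rightarrow> ('p, 'n, 'o, 'm) fctr \<Rightarrow> ('o, 'm, 'a) rmod
    \<Rightarrow> ('p, 'n, 'a \<Rightarrow> rat set) rmod" where
  "dual_raw C D M = \<lparr>omap = (\<lambda>Y. hom_group (omap M (omap D Y)) QZ),
    amap = (\<lambda>c \<xi>. compose (carrier (omap M (omap D (src C c)))) \<xi> (amap M (amap D c)))\<rparr>"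

lemma dual_raw_simps [simp]:
  "omap (dual_raw C D M) Y = hom_group (omap M (omap D Y)) QZ"
  "amap (dual_raw C D M) c \<xi> = compose (carrier (omap M (omap D (src C c)))) \<xi> (amap M (amap D c))"
  by (simp_all add: dual_raw_def)

lemma dual_mod_eq_copy_mod:
  "dual_mod U D f = copy_mod (compacts V U) (dual_raw (compacts V U) D (underlying f))"
  by (simp add: dual_mod_def copy_mod_def dual_raw_def underlying_def)

lemma hom_compose_QZ:
  assumes "f \<in> hom G H" "\<xi> \<in> hom H QZ" "group G"
  shows "compose (carrier G) \<xi> f \<in> hom G QZ"
  using group.hom_compose[OF assms(3,1,2)] .

text \<open>A module over C, pulled back along the contravariant D, is covariant on C'; characters
  with values in Q/Z make it contravariant again. In an AGJ triple both D and D' are instances, with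
  the roles of the categories exchanged.\<close>

locale dualizing_functor = C: preadditive_category C + C': preadditive_category C' +
    D: additive_functor "op_cat C'" C D
  for V :: "'v itself" and C :: "('o, 'm, 'z) preadd_scheme" and C' :: "('p, 'n, 'w) preadd_scheme"
    and D :: "('p, 'n, 'o, 'm) fctr" +
  assumes universe: "grothendieck_universe V"
begin

lemma D_obj: "Y \<in> obj C' \<Longrightarrow> omap D Y \<in> obj C"
  using D.omap_obj by simp

lemma D_hom: "c \<in> Homs C' X Y \<Longrightarrow> amap D c \<in> Homs C (omap D Y) (omap D X)"
  using D.amap_hom by simp

lemma D_ident: "Y \<in> obj C' \<Longrightarrow> amap D (ident C' Y) = ident C (omap D Y)"
  using D.amap_ident by simp

lemma D_cmp: "c \<in> Homs C' X Y \<Longrightarrow> d \<in> Homs C' Y Z \<Longrightarrow> amap D (d \<cdot>\<^bsub>C'\<^esub> c) = amap D c \<cdot>\<^bsub>C\<^esub> amap D d"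
  using D.amap_cmp[of d Z Y c X] by simp

lemma D_add: "c \<in> Homs C' X Y \<Longrightarrow> d \<in> Homs C' X Y \<Longrightarrow>
    amap D (c \<uplus>\<^bsub>C'\<^esub> d) = amap D c \<uplus>\<^bsub>C\<^esub> amap D d"
  using D.amap_add[of c Y X d] by simp

lemma raw_module_dual:
  assumes M: "raw_module V C M"
  shows "raw_module V C' (dual_raw C' D M)"
proof (intro raw_module.intro raw_module_axioms.intro C'.preadditive_category_axioms)
  interpret M: raw_module V C M by fact
  let ?N = "dual_raw C' D M"
  show "comm_group (omap ?N Y)" if "Y \<in> obj C'" for Y
    using comm_group_hom_group[OF M.grp[OF D_obj[OF that]] comm_group_QZ] by simp
  show "small V (carrier (omap ?N Y))" if "Y \<in> obj C'" for Y
    using small_hom_group_QZ[OF universe M.small_grp[OF D_obj[OF that]]] by simp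
  show "amap ?N c \<in> hom (omap ?N Y) (omap ?N X)" if c: "c \<in> Homs C' X Y" for c X Y
  proof (rule homI)
    note X = C'.Homs_obj[OF c]
    interpret G: group "omap M (omap D X)" using M.grp D_obj X by blast
    note act = M.act_closed[OF D_hom[OF c]]
    fix \<xi> assume "\<xi> \<in> carrier (omap ?N Y)"
    then have \<xi>: "\<xi> \<in> hom (omap M (omap D Y)) QZ" by simp
    show "amap ?N c \<xi> \<in> carrier (omap ?N X)"
      using G.hom_compose[OF M.act_hom[OF D_hom[OF c]] \<xi>] HomsD[OF c] by (simp add: compose_def)
    fix \<zeta> assume "\<zeta> \<in> carrier (omap ?N Y)"
    then have \<zeta>: "\<zeta> \<in> hom (omap M (omap D Y)) QZ" by simp
    show "amap ?N c (\<xi> \<otimes>\<^bsub>omap ?N Y\<^esub> \<zeta>) = amap ?N c \<xi> \<otimes>\<^bsub>omap ?N X\<^esub> amap ?N c \<zeta>"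
      using act HomsD[OF c] by (auto simp: compose_def intro!: restrict_ext)
  qed
  show "amap ?N (ident C' Y) \<xi> = \<xi>" if Y: "Y \<in> obj C'" and \<xi>: "\<xi> \<in> carrier (omap ?N Y)" for Y \<xi>
    using M.act_ident[OF D_obj[OF Y]] \<xi> HomsD[OF C'.ident_hom[OF Y]] D_ident[OF Y]
    by (auto simp: compose_def fun_eq_iff extensional_def)
  show "amap ?N (d \<cdot>\<^bsub>C'\<^esub> c) \<xi> = amap ?N c (amap ?N d \<xi>)"
    if c: "c \<in> Homs C' X Y" and d: "d \<in> Homs C' Y Z" and \<xi>: "\<xi> \<in> carrier (omap ?N Z)" for c d X Y Z \<xi>
    using M.act_closed[OF D_hom[OF c]] M.act_cmp[OF D_hom[OF d] D_hom[OF c]] HomsD[OF c] HomsD[OF d]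
      HomsD[OF C'.cmp_hom[OF c d]] D_cmp[OF c d]
    by (auto simp: compose_def intro!: restrict_ext)
  show "amap ?N (hom_add C' c d) \<xi> = amap ?N c \<xi> \<otimes>\<^bsub>omap ?N X\<^esub> amap ?N d \<xi>"
    if c: "c \<in> Homs C' X Y" and d: "d \<in> Homs C' X Y" and \<xi>: "\<xi> \<in> carrier (omap ?N Y)" for c d X Y \<xi>
    using M.act_closed[OF D_hom[OF c]] M.act_closed[OF D_hom[OF d]] M.act_add[OF D_hom[OF c] D_hom[OF d]]
      HomsD[OF c] HomsD[OF d] HomsD[OF C'.add_hom[OF c d]] D_add[OF c d] \<xi>
    by (auto simp: compose_def hom_mult intro!: restrict_ext)
qed

lemma raw_hom_dual:
  assumes M: "raw_module V C M" and \<phi>: "raw_hom C M N \<phi>"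
  shows "raw_hom C' (dual_raw C' D N) (dual_raw C' D M)
    (\<lambda>Y \<xi>. compose (carrier (omap M (omap D Y))) \<xi> (\<phi> (omap D Y)))"
proof (rule raw_homI)
  interpret M: raw_module V C M by fact
  fix Y \<xi> assume Y: "Y \<in> obj C'" and "\<xi> \<in> carrier (omap (dual_raw C' D N) Y)"
  then have \<xi>: "\<xi> \<in> hom (omap N (omap D Y)) QZ" by simp
  note DY = D_obj[OF Y]
  show "compose (carrier (omap M (omap D Y))) \<xi> (\<phi> (omap D Y)) \<in> carrier (omap (dual_raw C' D M) Y)"
    using hom_compose_QZ[OF raw_homD(1)[OF \<phi> DY] \<xi> M.grp[OF DY]] by (simp add: compose_def)
  fix \<zeta>
  show "compose (carrier (omap M (omap D Y))) (\<xi> \<otimes>\<^bsub>omap (dual_raw C' D N) Y\<^esub> \<zeta>) (\<phi> (omap D Y)) =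
    compose (carrier (omap M (omap D Y))) \<xi> (\<phi> (omap D Y)) \<otimes>\<^bsub>omap (dual_raw C' D M) Y\<^esub>
    compose (carrier (omap M (omap D Y))) \<zeta> (\<phi> (omap D Y))"
    using raw_homD(2)[OF \<phi> DY] by (auto simp: compose_def intro!: restrict_ext)
next
  interpret M: raw_module V C M by fact
  fix X Y c \<xi> assume c: "c \<in> Homs C' X Y" and "\<xi> \<in> carrier (omap (dual_raw C' D N) Y)"
  have o: "omap D X \<in> obj C" "omap D Y \<in> obj C" using C'.Homs_obj[OF c] D_obj by simp_all
  show "compose (carrier (omap M (omap D X))) (amap (dual_raw C' D N) c \<xi>) (\<phi> (omap D X)) =
    amap (dual_raw C' D M) c (compose (carrier (omap M (omap D Y))) \<xi> (\<phi> (omap D Y)))"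
    using HomsD[OF c] raw_homD(2)[OF \<phi> o(1)] raw_homD(4)[OF \<phi> D_hom[OF c]] M.act_closed[OF D_hom[OF c]]
    by (auto simp: compose_def intro!: restrict_ext)
qed

text \<open>Dualizing reverses homomorphisms, so the dual of the retraction is the new section and
  the dual of the section the new retraction.\<close>

lemma raw_retract_dual:
  assumes M: "raw_module V C M" and N: "raw_module V C N" and MN: "raw_retract C M N"
  shows "raw_retract C' (dual_raw C' D M) (dual_raw C' D N)"
proof -
  obtain s r where s: "raw_hom C M N s" and r: "raw_hom C N M r"
    and rs: "\<forall>X \<in> obj C. \<forall>x \<in> carrier (omap M X). r X (s X x) = x"
    using MN unfolding raw_retract_def by blast
  let ?s = "\<lambda>Y \<xi>. compose (carrier (omap N (omap D Y))) \<xi> (r (omap D Y))"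
  let ?r = "\<lambda>Y \<xi>. compose (carrier (omap M (omap D Y))) \<xi> (s (omap D Y))"
  have "?r Y (?s Y \<xi>) = \<xi>" if Y: "Y \<in> obj C'" and \<xi>: "\<xi> \<in> carrier (omap (dual_raw C' D M) Y)" for Y \<xi>
    using rs D_obj[OF Y] \<xi> raw_homD(2)[OF s D_obj[OF Y]]
    by (auto simp: compose_def fun_eq_iff extensional_def)
  then show ?thesis
    unfolding raw_retract_def using raw_hom_dual[OF N r] raw_hom_dual[OF M s] by blast
qed

end

lemma raw_retract_bij:
  assumes M: "raw_module V C M" and \<phi>: "raw_hom C M N \<phi>"
    and bij: "\<And>X. X \<in> obj C \<Longrightarrow> bij_betw (\<phi> X) (carrier (omap M X)) (carrier (omap N X))"
  shows "raw_retract C M N" "raw_retract C N M"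
proof -
  interpret M: raw_module V C M by fact
  define \<psi> where "\<psi> X = inv_into (carrier (omap M X)) (\<phi> X)" for X
  have l: "\<psi> X (\<phi> X x) = x" if "X \<in> obj C" "x \<in> carrier (omap M X)" for X x
    unfolding \<psi>_def using bij_betw_inv_into_left[OF bij[OF that(1)] that(2)] .
  have rr: "\<phi> X (\<psi> X y) = y" if "X \<in> obj C" "y \<in> carrier (omap N X)" for X y
    unfolding \<psi>_def using bij_betw_inv_into_right[OF bij[OF that(1)] that(2)] .
  have cl: "\<psi> X y \<in> carrier (omap M X)" if "X \<in> obj C" "y \<in> carrier (omap N X)" for X y
    unfolding \<psi>_def using bij_betwE[OF bij_betw_inv_into[OF bij[OF that(1)]]] that(2) by blast
  have \<psi>: "raw_hom C N M \<psi>"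
  proof (rule raw_homI)
    show "\<psi> X y \<in> carrier (omap M X)" if "X \<in> obj C" "y \<in> carrier (omap N X)" for X y
      using cl[OF that] .
    show "\<psi> X (x \<otimes>\<^bsub>omap N X\<^esub> y) = \<psi> X x \<otimes>\<^bsub>omap M X\<^esub> \<psi> X y"
      if X: "X \<in> obj C" and x: "x \<in> carrier (omap N X)" and y: "y \<in> carrier (omap N X)" for X x y
    proof -
      interpret G: group "omap M X" using M.grp[OF X] .
      show ?thesis
        using l[OF X G.m_closed[OF cl[OF X x] cl[OF X y]]] raw_homD(3)[OF \<phi> X cl[OF X x] cl[OF X y]]
          rr[OF X x] rr[OF X y] by simp
    qed
    show "\<psi> X (amap N c y) = amap M c (\<psi> Y y)"
      if c: "c \<in> Homs C X Y" and y: "y \<in> carrier (omap N Y)" for c X Y y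
    proof -
      have X: "X \<in> obj C" and Y: "Y \<in> obj C" using M.Homs_obj[OF c] by simp_all
      show ?thesis
        using raw_homD(4)[OF \<phi> c cl[OF Y y]] rr[OF Y y] l[OF X M.act_closed[OF c cl[OF Y y]]] by simp
    qed
  qed
  show "raw_retract C M N"
    unfolding raw_retract_def by (intro exI[of _ \<phi>] exI[of _ \<psi>] conjI ballI \<phi> \<psi> l)
  show "raw_retract C N M"
    unfolding raw_retract_def by (intro exI[of _ \<phi>] exI[of _ \<psi>] conjI ballI \<phi> \<psi> rr)
qed

text \<open>The canonical map to the double dual. The double dual at X consists of characters of the
  character group of M(D'DX), so x is first moved there by e X.\<close>

definition evaluation :: "('o, 'm, 'p, 'n) fctr \<Rightarrow> ('p, 'n, 'o, 'm) fctr \<Rightarrow> ('o, 'm, 'a) rmod \<Rightarrow> ('o \<Rightarrow> 'm)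
    \<Rightarrow> 'o \<Rightarrow> 'a \<Rightarrow> ('a \<Rightarrow> rat set) \<Rightarrow> rat set" where
  "evaluation D D' M e X x = (\<lambda>\<zeta> \<in> carrier (hom_group (omap M (omap D' (omap D X))) QZ). \<zeta> (amap M (e X) x))"

lemma evaluation_in_hom:
  assumes "group G" and a: "a \<in> carrier G"
  shows "(\<lambda>\<zeta> \<in> carrier (hom_group G QZ). \<zeta> a) \<in> hom (hom_group G QZ) QZ"
proof (rule homI)
  interpret H: comm_group "hom_group G QZ"
    using assms(1) comm_group_QZ by (rule comm_group_hom_group)
  fix \<zeta> assume \<zeta>: "\<zeta> \<in> carrier (hom_group G QZ)"
  then show "(\<lambda>\<zeta> \<in> carrier (hom_group G QZ). \<zeta> a) \<zeta> \<in> carrier QZ"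
    using hom_in_carrier[of \<zeta> G QZ a] a by simp
  fix \<xi> assume \<xi>: "\<xi> \<in> carrier (hom_group G QZ)"
  have "(\<lambda>\<zeta> \<in> carrier (hom_group G QZ). \<zeta> a) (\<zeta> \<otimes>\<^bsub>hom_group G QZ\<^esub> \<xi>) = (\<zeta> \<otimes>\<^bsub>hom_group G QZ\<^esub> \<xi>) a"
    using H.m_closed[OF \<zeta> \<xi>] by (rule restrict_apply')
  then show "(\<lambda>\<zeta> \<in> carrier (hom_group G QZ). \<zeta> a) (\<zeta> \<otimes>\<^bsub>hom_group G QZ\<^esub> \<xi>) =
    (\<lambda>\<zeta> \<in> carrier (hom_group G QZ). \<zeta> a) \<zeta> \<otimes>\<^bsub>QZ\<^esub> (\<lambda>\<zeta> \<in> carrier (hom_group G QZ). \<zeta> a) \<xi>"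
    using \<zeta> \<xi> a by simp
qed

lemma raw_hom_evaluation:
  assumes "dualizing_functor V C C' D'" "dualizing_functor V C' C D" and M: "raw_module V C M"
    and e: "\<And>X. X \<in> obj C \<Longrightarrow> e X \<in> Homs C (omap D' (omap D X)) X"
    and nat: "\<And>c X Y. c \<in> Homs C X Y \<Longrightarrow> c \<cdot>\<^bsub>C\<^esub> e X = e Y \<cdot>\<^bsub>C\<^esub> amap D' (amap D c)"
  shows "raw_hom C M (dual_raw C D (dual_raw C' D' M)) (evaluation D D' M e)"
proof (rule raw_homI)
  interpret D': dualizing_functor V C C' D' by fact
  interpret D: dualizing_functor V C' C D by fact
  interpret M: raw_module V C M by fact
  interpret Q: comm_group QZ by (rule comm_group_QZ)
  fix X x assume X: "X \<in> obj C" and x: "x \<in> carrier (omap M X)"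
  note ex = M.act_closed[OF e[OF X] x]
  show "evaluation D D' M e X x \<in> carrier (omap (dual_raw C D (dual_raw C' D' M)) X)"
    using evaluation_in_hom[OF M.grp[OF D'.D_obj[OF D.D_obj[OF X]]] ex] by (simp add: evaluation_def)
  fix y assume y: "y \<in> carrier (omap M X)"
  note ey = M.act_closed[OF e[OF X] y]
  show "evaluation D D' M e X (x \<otimes>\<^bsub>omap M X\<^esub> y) =
    evaluation D D' M e X x \<otimes>\<^bsub>omap (dual_raw C D (dual_raw C' D' M)) X\<^esub> evaluation D D' M e X y"
    using ex ey hom_mult[OF M.act_hom[OF e[OF X]] x y]
    by (auto simp: evaluation_def hom_mult intro!: restrict_ext)
next
  interpret D': dualizing_functor V C C' D' by fact
  interpret D: dualizing_functor V C' C D by fact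
  interpret M: raw_module V C M by fact
  interpret N: raw_module V C' "dual_raw C' D' M" by (rule D'.raw_module_dual[OF M])
  fix X Y c x assume c: "c \<in> Homs C X Y" and x: "x \<in> carrier (omap M Y)"
  have X: "X \<in> obj C" and Y: "Y \<in> obj C" using D'.C.Homs_obj[OF c] by simp_all
  note Dc = D.D_hom[OF c]
  note D'Dc = D'.D_hom[OF Dc]
  have eq: "amap M (e X) (amap M c x) = amap M (amap D' (amap D c)) (amap M (e Y) x)"
    using M.act_cmp[OF e[OF X] c x] M.act_cmp[OF D'Dc e[OF Y] x] nat[OF c] by simp
  show "evaluation D D' M e X (amap M c x) = amap (dual_raw C D (dual_raw C' D' M)) c (evaluation D D' M e Y x)"
  proof (rule extensionalityI)
    let ?K = "carrier (hom_group (omap M (omap D' (omap D X))) QZ)"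
    show "evaluation D D' M e X (amap M c x) \<in> extensional ?K"
      by (simp add: evaluation_def)
    show "amap (dual_raw C D (dual_raw C' D' M)) c (evaluation D D' M e Y x) \<in> extensional ?K"
      using HomsD[OF c] by (simp add: compose_def)
    fix \<zeta> assume \<zeta>: "\<zeta> \<in> ?K"
    have cl: "amap (dual_raw C' D' M) (amap D c) \<zeta> \<in> carrier (hom_group (omap M (omap D' (omap D Y))) QZ)"
      using N.act_closed[OF Dc, of \<zeta>] \<zeta> by simp
    have "amap (dual_raw C D (dual_raw C' D' M)) c (evaluation D D' M e Y x) \<zeta> =
        evaluation D D' M e Y x (amap (dual_raw C' D' M) (amap D c) \<zeta>)"
      using \<zeta> HomsD[OF c] by (simp add: compose_def)
    also have "\<dots> = amap (dual_raw C' D' M) (amap D c) \<zeta> (amap M (e Y) x)"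
      using cl by (simp add: evaluation_def)
    also have "\<dots> = \<zeta> (amap M (amap D' (amap D c)) (amap M (e Y) x))"
      using M.act_closed[OF e[OF Y] x] HomsD[OF Dc] by (simp add: compose_def)
    finally show "evaluation D D' M e X (amap M c x) \<zeta> =
        amap (dual_raw C D (dual_raw C' D' M)) c (evaluation D D' M e Y x) \<zeta>"
      using \<zeta> eq by (simp add: evaluation_def)
  qed
qed

text \<open>
  By the triangle identities the dual of evaluation is a left inverse of the evaluation of the dual.
\<close>

lemma raw_retract_triple_dual:
  assumes D': "dualizing_functor V C C' D'" and D: "dualizing_functor V C' C D" and M: "raw_module V C M"
    and e: "\<And>X. X \<in> obj C \<Longrightarrow> e X \<in> Homs C (omap D' (omap D X)) X"
    and nat: "\<And>c X Y. c \<in> Homs C X Y \<Longrightarrow> c \<cdot>\<^bsub>C\<^esub> e X = e Y \<cdot>\<^bsub>C\<^esub> amap D' (amap D c)"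
    and e': "\<And>Y. Y \<in> obj C' \<Longrightarrow> e' Y \<in> Homs C' (omap D (omap D' Y)) Y"
    and nat': "\<And>c X Y. c \<in> Homs C' X Y \<Longrightarrow> c \<cdot>\<^bsub>C'\<^esub> e' X = e' Y \<cdot>\<^bsub>C'\<^esub> amap D (amap D' c)"
    and triangle: "\<And>Y. Y \<in> obj C' \<Longrightarrow> e (omap D' Y) \<cdot>\<^bsub>C\<^esub> amap D' (e' Y) = ident C (omap D' Y)"
  shows "raw_retract C' (dual_raw C' D' M) (dual_raw C' D' (dual_raw C D (dual_raw C' D' M)))"
proof -
  interpret D': dualizing_functor V C C' D' by fact
  interpret D: dualizing_functor V C' C D by fact
  interpret M: raw_module V C M by fact
  let ?N = "dual_raw C' D' M"
  let ?M2 = "dual_raw C D ?N"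
  let ?s = "evaluation D' D ?N e'"
  let ?r = "\<lambda>Y \<xi>. compose (carrier (omap M (omap D' Y))) \<xi> (evaluation D D' M e (omap D' Y))"
  note N = D'.raw_module_dual[OF M]
  interpret N: raw_module V C' ?N by (rule N)
  have s: "raw_hom C' ?N (dual_raw C' D' ?M2) ?s"
    by (rule raw_hom_evaluation[OF D D' N e' nat'])
  note ev = raw_hom_evaluation[OF D' D M e nat]
  have r: "raw_hom C' (dual_raw C' D' ?M2) ?N ?r"
    by (rule D'.raw_hom_dual[OF M ev])
  have "?r Y (?s Y \<xi>) = \<xi>" if Y: "Y \<in> obj C'" and \<xi>: "\<xi> \<in> carrier (omap ?N Y)" for Y \<xi>
  proof (rule extensionalityI)
    let ?K = "carrier (omap M (omap D' Y))"
    show "?r Y (?s Y \<xi>) \<in> extensional ?K" by (simp add: compose_def)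
    show "\<xi> \<in> extensional ?K" using \<xi> by simp
    fix x assume x: "x \<in> ?K"
    note D'Y = D'.D_obj[OF Y]
    have evx: "evaluation D D' M e (omap D' Y) x \<in> carrier (omap ?M2 (omap D' Y))"
      using raw_homD(2)[OF ev D'Y x] .
    have e\<xi>: "amap ?N (e' Y) \<xi> \<in> carrier (omap ?N (omap D (omap D' Y)))"
      using N.act_closed[OF e'[OF Y] \<xi>] .
    have ex: "amap M (e (omap D' Y)) x \<in> carrier (omap M (omap D' (omap D (omap D' Y))))"
      using M.act_closed[OF e[OF D'Y] x] .
    have "?r Y (?s Y \<xi>) x = ?s Y \<xi> (evaluation D D' M e (omap D' Y) x)"
      using x by (simp add: compose_def)
    also have "\<dots> = evaluation D D' M e (omap D' Y) x (amap ?N (e' Y) \<xi>)"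
      using evx by (simp add: evaluation_def[of D' D ?N])
    also have "\<dots> = amap ?N (e' Y) \<xi> (amap M (e (omap D' Y)) x)"
      using e\<xi> by (simp add: evaluation_def)
    also have "\<dots> = \<xi> (amap M (amap D' (e' Y)) (amap M (e (omap D' Y)) x))"
      using ex HomsD[OF e'[OF Y]] by (simp add: compose_def)
    also have "\<dots> = \<xi> x"
      using M.act_cmp[OF D'.D_hom[OF e'[OF Y]] e[OF D'Y] x] triangle[OF Y] M.act_ident[OF D'Y x] by simp
    finally show "?r Y (?s Y \<xi>) x = \<xi> x" .
  qed
  then show ?thesis unfolding raw_retract_def using s r by blast
qed


section \<open>AGJ triples: symmetry, additivity of the duality on compacts, and counits\<close>

section \<open>Auslander--Gruson--Jensen duality\<close>

text \<open>Purity states exactness for labelled groups; injectivity of the first map is turned into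
  cancellation of f against maps from compact objects.\<close>

lemma (in compactly_generated) pure_mono_inj:
  assumes f: "pure_mono V T f" and fH: "f \<in> Homs T X Y" and K: "compact_object V T K"
    and x: "x \<in> Homs T K X" and x': "x' \<in> Homs T K X" and eq: "f \<cdot> x = f \<cdot> x'"
  shows "x = x'"
proof -
  obtain g where ex: "mod_short_exact (compacts V T) (yon_arr T f :: ('o, 'm, 'v) abmod_arr) (yon_arr T g)"
    using f unfolding pure_mono_def by blast
  have sX: "small TYPE('v) (Homs T K X)" and sY: "small TYPE('v) (Homs T K Y)"
    using small_homs[of K] Homs_obj[OF x] Homs_obj[OF fH] by (auto simp: small_def)
  let ?h = "ab_copy_hom (HomG T K X) (HomG T K Y) (\<lambda>g. f \<cdot> g) :: 'v ab_arr"
  have KT: "compact_object TYPE('v) T K" using K by (simp add: compact_object_def small_def)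
  have "\<forall>X \<in> obj (compacts V T). ab_short_exact (snd (snd (yon_arr T f :: ('o, 'm, 'v) abmod_arr)) X)
      (snd (snd (yon_arr T g :: ('o, 'm, 'v) abmod_arr)) X)"
    using ex by (simp add: mod_short_exact_def split_beta)
  then have "ab_short_exact (snd (snd (yon_arr T f :: ('o, 'm, 'v) abmod_arr)) K)
      (snd (snd (yon_arr T g :: ('o, 'm, 'v) abmod_arr)) K)"
    using K by simp
  then have "\<exists>b. ab_short_exact ?h b"
    using HomsD[OF fH] KT unfolding yon_arr_def by fastforce
  then have inj: "inj_on (snd (snd ?h)) (carrier (fst ?h))"
    by (auto simp: ab_short_exact_def)
  let ?lx = "label (Homs T K X) x :: 'v" and ?lx' = "label (Homs T K X) x' :: 'v"
  have c: "?lx \<in> carrier (fst ?h)" "?lx' \<in> carrier (fst ?h)"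
    using x x' sX by (simp_all add: ab_copy_hom_def)
  have "snd (snd ?h) ?lx = snd (snd ?h) ?lx'"
    using x x' sX eq by (simp add: ab_copy_hom_def)
  then have "?lx = ?lx'" using inj_onD[OF inj _ c] by blast
  then show ?thesis using unlabel_label[OF sX x] unlabel_label[OF sX x'] by metis
qed

text \<open>Passing to opposite categories exchanges unit with counit and one triangle identity with
  the other, so AGJ data may be read with T and U interchanged.\<close>

lemma adjoint_equivalence_op:
  fixes C :: "('o, 'm) preadd" and C' :: "('p, 'n) preadd"
  assumes "adjoint_equivalence C (op_cat C') F G"
  shows "adjoint_equivalence C' (op_cat C) G F"
proof -
  interpret F: category_functor C "op_cat C'" F using assms by (simp add: adjoint_equivalence_def)
  interpret G: category_functor "op_cat C'" C G using assms by (simp add: adjoint_equivalence_def)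
  have C': "preadditive_category C'"
    using preadditive_category_op_cat[OF F.D.preadditive_category_axioms] by simp
  have opC: "preadditive_category (op_cat C)"
    using preadditive_category_op_cat[OF F.C.preadditive_category_axioms] .
  obtain \<eta> \<epsilon> where \<eta>: "nat_iso C C id_fctr (comp_fctr G F) \<eta>"
    and \<epsilon>: "nat_iso (op_cat C') (op_cat C') (comp_fctr F G) id_fctr \<epsilon>"
    and t1: "\<forall>X \<in> obj C. \<epsilon> (omap F X) \<cdot>\<^bsub>op_cat C'\<^esub> amap F (\<eta> X) = ident (op_cat C') (omap F X)"
    and t2: "\<forall>Y \<in> obj (op_cat C'). amap G (\<epsilon> Y) \<cdot>\<^bsub>C\<^esub> \<eta> (omap G Y) = ident C (omap G Y)"
    using assms by (auto simp: adjoint_equivalence_def)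
  have 1: "category_functor C' (op_cat C) G"
    using C' opC G.omap_obj G.amap_hom G.amap_ident G.amap_cmp
    by (intro category_functor.intro category_functor_axioms.intro) simp_all
  have 2: "category_functor (op_cat C) C' F"
    using C' opC F.omap_obj F.amap_hom F.amap_ident F.amap_cmp
    by (intro category_functor.intro category_functor_axioms.intro) simp_all
  have 3: "nat_iso C' C' id_fctr (comp_fctr F G) \<epsilon>"
    using \<epsilon> by (simp add: nat_iso_def nat_trans_def is_iso_def id_fctr_def comp_fctr_def conj_commute)
  have 4: "nat_iso (op_cat C) (op_cat C) (comp_fctr G F) id_fctr \<eta>"
    using \<eta> by (simp add: nat_iso_def nat_trans_def is_iso_def id_fctr_def comp_fctr_def conj_commute)
  show ?thesis
    unfolding adjoint_equivalence_def
  proof (intro conjI exI[of _ \<epsilon>] exI[of _ \<eta>])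
    show "category_functor C' (op_cat C) G" "category_functor (op_cat C) C' F" by (fact 1 2)+
    show "nat_iso C' C' id_fctr (comp_fctr F G) \<epsilon>"
      "nat_iso (op_cat C) (op_cat C) (comp_fctr G F) id_fctr \<eta>" by (fact 3 4)+
    show "\<forall>Y\<in>obj C'. \<eta> (omap G Y) \<cdot>\<^bsub>op_cat C\<^esub> amap G (\<epsilon> Y) = ident (op_cat C) (omap G Y)"
      using t2 by simp
    show "\<forall>X\<in>obj (op_cat C). amap F (\<eta> X) \<cdot>\<^bsub>C'\<^esub> \<epsilon> (omap F X) = ident C' (omap F X)"
      using t1 by simp
  qed
qed

lemma AGJ_duality_triple_swap:
  assumes "AGJ_duality_triple V T U Q Q' D D'"
  shows "AGJ_duality_triple V U T Q' Q D' D"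
proof -
  have d: "duality_triple V U T Q' Q"
  proof -
    have dt: "duality_triple V T U Q Q'" using assms by (simp add: AGJ_duality_triple_def)
    from dt[unfolded duality_triple_def] show ?thesis
    proof (elim conjE exE)
      fix i j
      assume "compactly_generated V T" "compactly_generated V U"
        "exact_contravariant T U Q" "exact_contravariant U T Q'"
        "\<forall>X \<in> obj T. pure_injective V U (omap Q X)" "\<forall>Y \<in> obj U. pure_injective V T (omap Q' Y)"
        "coproducts_to_products V T U Q" "coproducts_to_products V U T Q'"
        "nat_trans T T id_fctr (comp_fctr Q' Q) i" "\<forall>X \<in> obj T. pure_mono V T (i X)"
        "nat_trans U U id_fctr (comp_fctr Q Q') j" "\<forall>Y \<in> obj U. pure_mono V U (j Y)"
        "\<forall>X \<in> obj T. amap Q (i X) \<cdot>\<^bsub>U\<^esub> j (omap Q X) = ident U (omap Q X)"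
        "\<forall>Y \<in> obj U. amap Q' (j Y) \<cdot>\<^bsub>T\<^esub> i (omap Q' Y) = ident T (omap Q' Y)"
      then show ?thesis
        unfolding duality_triple_def by (intro conjI exI[of _ j] exI[of _ i])
    qed
  qed
  have a: "adjoint_equivalence (compacts V U) (op_cat (compacts V T)) D' D"
    by (rule adjoint_equivalence_op) (use assms in \<open>simp add: AGJ_duality_triple_def\<close>)
  show ?thesis using assms d a by (simp add: AGJ_duality_triple_def)
qed

locale AGJ =
  fixes V :: "'v itself" and T :: "('o, 'm, 'z) triang_scheme" and U :: "('p, 'n, 'w) triang_scheme"
    and Q :: "('o, 'm, 'p, 'n) fctr" and Q' :: "('p, 'n, 'o, 'm) fctr"
    and D :: "('o, 'm, 'p, 'n) fctr" and D' :: "('p, 'n, 'o, 'm) fctr"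
  assumes universe: "grothendieck_universe V" and agj: "AGJ_duality_triple V T U Q Q' D D'"
begin

text \<open>Results are proved for one direction of the duality and obtained for the other through
  this symmetry.\<close>

lemma AGJ_swap: "AGJ V U T Q' Q D' D"
  by (rule AGJ.intro[OF universe AGJ_duality_triple_swap[OF agj]])

sublocale T: compactly_generated V T
  using agj by (simp add: AGJ_duality_triple_def duality_triple_def)

sublocale U: compactly_generated V U
  using agj by (simp add: AGJ_duality_triple_def duality_triple_def)

sublocale Tc: preadditive_category "compacts V T"
  by (rule T.preadditive_compacts)

sublocale Uc: preadditive_category "compacts V U"
  by (rule U.preadditive_compacts)

lemma D_functor: "category_functor (compacts V T) (op_cat (compacts V U)) D"
  using agj by (simp add: AGJ_duality_triple_def adjoint_equivalence_def)

lemma D_compact: "compact_object V T C \<Longrightarrow> compact_object V U (omap D C)"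
  using category_functor.omap_obj[OF D_functor, of C] by simp

lemma D_hom:
  "c \<in> Homs (compacts V T) X Y \<Longrightarrow> amap D c \<in> Homs (compacts V U) (omap D Y) (omap D X)"
  using category_functor.amap_hom[OF D_functor, of c X Y] by simp

lemma Q_obj: "X \<in> obj T \<Longrightarrow> omap Q X \<in> obj U"
  using agj by (simp add: AGJ_duality_triple_def duality_triple_def pure_injective_def)

lemma Q_pure_injective: "X \<in> obj T \<Longrightarrow> pure_injective V U (omap Q X)"
  using agj by (simp add: AGJ_duality_triple_def duality_triple_def)

lemma unit_exists:
  "\<exists>j. \<forall>Y \<in> obj U. j Y \<in> Homs U Y (omap Q (omap Q' Y)) \<and> pure_mono V U (j Y)"
proof -
  obtain j where j: "nat_trans U U id_fctr (comp_fctr Q Q') j" "\<forall>Y \<in> obj U. pure_mono V U (j Y)"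
    using agj unfolding AGJ_duality_triple_def duality_triple_def by blast
  have "j Y \<in> Homs U Y (omap Q (omap Q' Y))" if "Y \<in> obj U" for Y
    using j(1) that by (simp add: nat_trans_def id_fctr_def comp_fctr_def)
  then show ?thesis using j(2) by blast
qed

lemma formula:
  "\<exists>\<theta>. (\<forall>C X. compact_object V T C \<longrightarrow> X \<in> obj T \<longrightarrow>
      \<theta> C X \<in> Group.iso (hom_group (HomG T C X) QZ) (HomG U (omap D C) (omap Q X))) \<and>
    (\<forall>c C C' X \<xi>. c \<in> Homs (compacts V T) C C' \<longrightarrow> X \<in> obj T \<longrightarrow>
      \<xi> \<in> carrier (hom_group (HomG T C X) QZ) \<longrightarrow>
      \<theta> C' X (\<lambda>g \<in> Homs T C' X. \<xi> (g \<cdot>\<^bsub>T\<^esub> c)) = \<theta> C X \<xi> \<cdot>\<^bsub>U\<^esub> amap D c)"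
proof -
  obtain \<theta> where 1: "\<forall>C \<in> obj (compacts V T). \<forall>X \<in> obj T.
      \<theta> C X \<in> Group.iso (hom_group (HomG T C X) QZ) (HomG U (omap D C) (omap Q X))"
    and 2: "\<forall>c \<in> arr (compacts V T). \<forall>X \<in> obj T.
      \<forall>\<xi> \<in> carrier (hom_group (HomG T (src T c) X) QZ).
        \<theta> (tgt T c) X (\<lambda>g \<in> Homs T (tgt T c) X. \<xi> (g \<cdot>\<^bsub>T\<^esub> c)) = \<theta> (src T c) X \<xi> \<cdot>\<^bsub>U\<^esub> amap D c"
    using agj unfolding AGJ_duality_triple_def AGJ_formula_def by blast
  have 3: "\<theta> C' X (\<lambda>g \<in> Homs T C' X. \<xi> (g \<cdot>\<^bsub>T\<^esub> c)) = \<theta> C X \<xi> \<cdot>\<^bsub>U\<^esub> amap D c"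
    if "c \<in> Homs (compacts V T) C C'" "X \<in> obj T" "\<xi> \<in> carrier (hom_group (HomG T C X) QZ)" for c C C' X \<xi>
    using 2 that HomsD[OF that(1)] by auto
  show ?thesis
    by (rule exI[of _ \<theta>], intro conjI allI impI) (use 1 in simp, rule 3)
qed

text \<open>
  Additivity of \<open>D\<close> is not assumed; it follows from the naturality of the AGJ isomorphism, because
  morphisms into the objects \<open>QX\<close> detect equality of morphisms between compact objects.
\<close>

lemma D_add:
  assumes c: "c \<in> Homs (compacts V T) C C'" and d: "d \<in> Homs (compacts V T) C C'"
  shows "amap D (c \<uplus>\<^bsub>T\<^esub> d) = amap D c \<uplus>\<^bsub>U\<^esub> amap D d"
proof -
  have C: "compact_object V T C" "compact_object V T C'" and cT: "c \<in> Homs T C C'" and dT: "d \<in> Homs T C C'"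
    using c d by (auto simp: Homs_compacts split: if_splits)
  have cd: "c \<uplus>\<^bsub>T\<^esub> d \<in> Homs (compacts V T) C C'"
    using T.add_hom[OF cT dT] C by (simp add: Homs_compacts)
  note DC = D_compact[OF C(1)] and DC' = D_compact[OF C(2)]
  have H: "amap D c \<in> Homs U (omap D C') (omap D C)" "amap D d \<in> Homs U (omap D C') (omap D C)"
    "amap D (c \<uplus>\<^bsub>T\<^esub> d) \<in> Homs U (omap D C') (omap D C)"
    using D_hom[OF c] D_hom[OF d] D_hom[OF cd] by (auto simp: Homs_compacts split: if_splits)
  obtain \<theta> where \<theta>0: "\<forall>C X. compact_object V T C \<longrightarrow> X \<in> obj T \<longrightarrow>
      \<theta> C X \<in> Group.iso (hom_group (HomG T C X) QZ) (HomG U (omap D C) (omap Q X))"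
    and nat0: "\<forall>c C C' X \<xi>. c \<in> Homs (compacts V T) C C' \<longrightarrow> X \<in> obj T \<longrightarrow>
      \<xi> \<in> carrier (hom_group (HomG T C X) QZ) \<longrightarrow>
      \<theta> C' X (\<lambda>g \<in> Homs T C' X. \<xi> (g \<cdot>\<^bsub>T\<^esub> c)) = \<theta> C X \<xi> \<cdot>\<^bsub>U\<^esub> amap D c"
    using formula by blast
  note \<theta> = \<theta>0[rule_format] and nat = nat0[rule_format]
  \<comment> \<open>Every map v into QX is the image under \<theta> of a character \<xi>, and
    naturality turns v after D(c) into the image of \<xi> precomposed with c. The latter is additive
    in c.\<close>
  have det: "v \<cdot>\<^bsub>U\<^esub> amap D (c \<uplus>\<^bsub>T\<^esub> d) = v \<cdot>\<^bsub>U\<^esub> (amap D c \<uplus>\<^bsub>U\<^esub> amap D d)"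
    if X: "X \<in> obj T" and v: "v \<in> Homs U (omap D C) (omap Q X)" for v X
  proof -
    let ?H = "hom_group (HomG T C X) QZ" and ?H' = "hom_group (HomG T C' X) QZ"
    have "bij_betw (\<theta> C X) (carrier ?H) (carrier (HomG U (omap D C) (omap Q X)))"
      using \<theta>[OF C(1) X] unfolding Group.iso_def by blast
    from bij_betw_imp_surj_on[OF this] have "v \<in> \<theta> C X ` carrier ?H" using v by simp
    then obtain \<xi> where \<xi>: "\<xi> \<in> carrier ?H" "\<theta> C X \<xi> = v" by (elim imageE) simp
    let ?p = "\<lambda>c. \<lambda>g \<in> Homs T C' X. \<xi> (g \<cdot>\<^bsub>T\<^esub> c)"
    have \<xi>h: "\<xi> \<in> hom (HomG T C X) QZ" using \<xi> by simp
    have gH: "group (HomG T C' X)"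
      using T.hom_comm_group[OF compact_objectD[OF C(2)] X] comm_group.axioms(2) by blast
    have pH: "?p a \<in> carrier ?H'" if a: "a \<in> Homs T C C'" for a
    proof -
      have "(\<lambda>g. g \<cdot>\<^bsub>T\<^esub> a) \<in> hom (HomG T C' X) (HomG T C X)"
        using T.cmp_hom[OF a] T.cmp_add_left[OF a] by (intro homI) simp_all
      from hom_compose_QZ[OF this \<xi>h gH] show ?thesis by (simp add: compose_def)
    qed
    have add: "?p (c \<uplus>\<^bsub>T\<^esub> d) = ?p c \<otimes>\<^bsub>?H'\<^esub> ?p d"
      using T.cmp_add_right[OF cT dT] T.cmp_hom[OF cT] T.cmp_hom[OF dT] hom_mult[OF \<xi>h]
      by (auto intro!: restrict_ext)
    have "\<theta> C' X \<in> hom ?H' (HomG U (omap D C') (omap Q X))"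
      using \<theta>[OF C(2) X] unfolding Group.iso_def by blast
    from hom_mult[OF this pH[OF cT] pH[OF dT]]
    have "\<theta> C' X (?p (c \<uplus>\<^bsub>T\<^esub> d)) = \<theta> C' X (?p c) \<uplus>\<^bsub>U\<^esub> \<theta> C' X (?p d)"
      unfolding add by (simp only: HomG_simps)
    then have "v \<cdot>\<^bsub>U\<^esub> amap D (c \<uplus>\<^bsub>T\<^esub> d) = v \<cdot>\<^bsub>U\<^esub> amap D c \<uplus>\<^bsub>U\<^esub> v \<cdot>\<^bsub>U\<^esub> amap D d"
      using nat[OF c X \<xi>(1)] nat[OF d X \<xi>(1)] nat[OF cd X \<xi>(1)] \<xi>(2) by simp
    then show ?thesis using U.cmp_add_right[OF H(1,2) v] by simp
  qed
  interpret S: AGJ V U T Q' Q D' D by (rule AGJ_swap)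
  note o = compact_objectD[OF DC]
  \<comment> \<open>The unit of DC is a pure monomorphism into an object of the form QX, so it
    cancels against maps from the compact object DC'.\<close>
  obtain j where j: "j \<in> Homs U (omap D C) (omap Q (omap Q' (omap D C)))" "pure_mono V U j"
    using unit_exists o by blast
  show ?thesis
    by (rule U.pure_mono_inj[OF j(2,1) DC' H(3) U.add_hom[OF H(1,2)] det[OF S.Q_obj[OF o] j(1)]])
qed

lemma D_dualizing: "dualizing_functor V (compacts V U) (compacts V T) D"
proof -
  interpret F: category_functor "compacts V T" "op_cat (compacts V U)" D by (rule D_functor)
  have "additive_functor (op_cat (compacts V T)) (compacts V U) D"
    using F.omap_obj F.amap_hom F.amap_ident F.amap_cmp D_add
    by (intro additive_functor.intro category_functor.intro category_functor_axioms.intro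
        additive_functor_axioms.intro preadditive_category_op_cat Tc.preadditive_category_axioms
        Uc.preadditive_category_axioms) simp_all
  then show ?thesis
    using universe Tc.preadditive_category_axioms Uc.preadditive_category_axioms
    by (intro dualizing_functor.intro dualizing_functor_axioms.intro)
qed

text \<open>The equivalence provides maps \<eta> from X to D'DX and, read in the opposite category,
  \<epsilon> from Y to DD'Y. Evaluation into double duals needs maps in the other direction, so e
  and e' are the inverses of \<eta> and \<epsilon>.\<close>

lemma counits:
  obtains e e' \<epsilon> where
    "\<And>X. X \<in> obj (compacts V T) \<Longrightarrow> e X \<in> Homs (compacts V T) (omap D' (omap D X)) X"
    "\<And>c X Y. c \<in> Homs (compacts V T) X Y \<Longrightarrow> c \<cdot>\<^bsub>T\<^esub> e X = e Y \<cdot>\<^bsub>T\<^esub> amap D' (amap D c)"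
    "\<And>Y. Y \<in> obj (compacts V U) \<Longrightarrow> e' Y \<in> Homs (compacts V U) (omap D (omap D' Y)) Y"
    "\<And>c X Y. c \<in> Homs (compacts V U) X Y \<Longrightarrow> c \<cdot>\<^bsub>U\<^esub> e' X = e' Y \<cdot>\<^bsub>U\<^esub> amap D (amap D' c)"
    "\<And>Y. Y \<in> obj (compacts V U) \<Longrightarrow> e (omap D' Y) \<cdot>\<^bsub>T\<^esub> amap D' (e' Y) = ident T (omap D' Y)"
    "\<And>Y. Y \<in> obj (compacts V U) \<Longrightarrow> \<epsilon> Y \<in> Homs (compacts V U) Y (omap D (omap D' Y))"
    "\<And>c X Y. c \<in> Homs (compacts V U) X Y \<Longrightarrow> \<epsilon> Y \<cdot>\<^bsub>U\<^esub> c = amap D (amap D' c) \<cdot>\<^bsub>U\<^esub> \<epsilon> X"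
    "\<And>Y. Y \<in> obj (compacts V U) \<Longrightarrow> e' Y \<cdot>\<^bsub>U\<^esub> \<epsilon> Y = ident U Y"
    "\<And>Y. Y \<in> obj (compacts V U) \<Longrightarrow> \<epsilon> Y \<cdot>\<^bsub>U\<^esub> e' Y = ident U (omap D (omap D' Y))"
proof -
  let ?T = "compacts V T" and ?U = "compacts V U"
  interpret S: AGJ V U T Q' Q D' D by (rule AGJ_swap)
  interpret D: dualizing_functor V ?U ?T D by (rule D_dualizing)
  interpret D': dualizing_functor V ?T ?U D' by (rule S.D_dualizing)
  obtain \<eta> \<epsilon> where \<eta>: "nat_iso ?T ?T id_fctr (comp_fctr D' D) \<eta>"
    and \<epsilon>: "nat_iso (op_cat ?U) (op_cat ?U) (comp_fctr D D') id_fctr \<epsilon>"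
    and tr: "\<forall>Y \<in> obj (op_cat ?U). amap D' (\<epsilon> Y) \<cdot>\<^bsub>?T\<^esub> \<eta> (omap D' Y) = ident ?T (omap D' Y)"
    using agj unfolding AGJ_duality_triple_def adjoint_equivalence_def by blast
  have \<eta>iso: "is_iso ?T X (omap D' (omap D X)) (\<eta> X)" if "X \<in> obj ?T" for X
    using \<eta> that by (simp add: nat_iso_def id_fctr_def comp_fctr_def)
  have \<eta>nat: "amap D' (amap D c) \<cdot>\<^bsub>T\<^esub> \<eta> X = \<eta> Y \<cdot>\<^bsub>T\<^esub> c" if c: "c \<in> Homs ?T X Y" for c X Y
    using \<eta> HomsD[OF c] by (auto simp: nat_iso_def nat_trans_def id_fctr_def comp_fctr_def)
  have \<epsilon>iso: "is_iso ?U Y (omap D (omap D' Y)) (\<epsilon> Y)" if "Y \<in> obj ?U" for Y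
    using \<epsilon> that by (auto simp: nat_iso_def id_fctr_def comp_fctr_def is_iso_def)
  have \<epsilon>nat: "\<epsilon> Y \<cdot>\<^bsub>U\<^esub> c = amap D (amap D' c) \<cdot>\<^bsub>U\<^esub> \<epsilon> X" if c: "c \<in> Homs ?U X Y" for c X Y
    using \<epsilon> HomsD[OF c] by (auto simp: nat_iso_def nat_trans_def id_fctr_def comp_fctr_def)
  define e where "e X = (SOME g. g \<in> Homs ?T (omap D' (omap D X)) X \<and> g \<cdot>\<^bsub>T\<^esub> \<eta> X = ident T X \<and>
      \<eta> X \<cdot>\<^bsub>T\<^esub> g = ident T (omap D' (omap D X)))" for X
  define e' where "e' Y = (SOME g. g \<in> Homs ?U (omap D (omap D' Y)) Y \<and> g \<cdot>\<^bsub>U\<^esub> \<epsilon> Y = ident U Y \<and>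
      \<epsilon> Y \<cdot>\<^bsub>U\<^esub> g = ident U (omap D (omap D' Y)))" for Y
  have e: "e X \<in> Homs ?T (omap D' (omap D X)) X \<and> e X \<cdot>\<^bsub>T\<^esub> \<eta> X = ident T X \<and>
      \<eta> X \<cdot>\<^bsub>T\<^esub> e X = ident T (omap D' (omap D X))" if "X \<in> obj ?T" for X
    unfolding e_def by (rule someI_ex) (use \<eta>iso[OF that] in \<open>auto simp: is_iso_def\<close>)
  have e': "e' Y \<in> Homs ?U (omap D (omap D' Y)) Y \<and> e' Y \<cdot>\<^bsub>U\<^esub> \<epsilon> Y = ident U Y \<and>
      \<epsilon> Y \<cdot>\<^bsub>U\<^esub> e' Y = ident U (omap D (omap D' Y))" if "Y \<in> obj ?U" for Y
    unfolding e'_def by (rule someI_ex) (use \<epsilon>iso[OF that] in \<open>auto simp: is_iso_def\<close>)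
  have \<eta>H: "\<eta> X \<in> Homs ?T X (omap D' (omap D X))" if "X \<in> obj ?T" for X
    using \<eta>iso[OF that] by (simp add: is_iso_def)
  have \<epsilon>H: "\<epsilon> Y \<in> Homs ?U Y (omap D (omap D' Y))" if "Y \<in> obj ?U" for Y
    using \<epsilon>iso[OF that] by (simp add: is_iso_def)
  have enat: "c \<cdot>\<^bsub>T\<^esub> e X = e Y \<cdot>\<^bsub>T\<^esub> amap D' (amap D c)" if c: "c \<in> Homs ?T X Y" for c X Y
  proof -
    have X: "X \<in> obj ?T" and Y: "Y \<in> obj ?T" using Tc.Homs_obj[OF c] by simp_all
    note eX = conjunct1[OF e[OF X]] and eY = conjunct1[OF e[OF Y]]
    note DDc = D'.D_hom[OF D.D_hom[OF c]]
    have "e Y \<cdot>\<^bsub>T\<^esub> amap D' (amap D c) = e Y \<cdot>\<^bsub>T\<^esub> (amap D' (amap D c) \<cdot>\<^bsub>T\<^esub> (\<eta> X \<cdot>\<^bsub>T\<^esub> e X))"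
      using e[OF X] Tc.ident_right[OF DDc] by simp
    also have "\<dots> = e Y \<cdot>\<^bsub>T\<^esub> (\<eta> Y \<cdot>\<^bsub>T\<^esub> (c \<cdot>\<^bsub>T\<^esub> e X))"
      using Tc.cmp_assoc[OF eX \<eta>H[OF X] DDc] \<eta>nat[OF c] Tc.cmp_assoc[OF eX c \<eta>H[OF Y]] by simp
    also have "\<dots> = c \<cdot>\<^bsub>T\<^esub> e X"
      using Tc.cmp_assoc[OF Tc.cmp_hom[OF eX c] \<eta>H[OF Y] eY] e[OF Y] Tc.ident_left[OF Tc.cmp_hom[OF eX c]]
      by simp
    finally show ?thesis by simp
  qed
  have e'nat: "c \<cdot>\<^bsub>U\<^esub> e' X = e' Y \<cdot>\<^bsub>U\<^esub> amap D (amap D' c)" if c: "c \<in> Homs ?U X Y" for c X Y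
  proof -
    have X: "X \<in> obj ?U" and Y: "Y \<in> obj ?U" using Uc.Homs_obj[OF c] by simp_all
    note eX = conjunct1[OF e'[OF X]] and eY = conjunct1[OF e'[OF Y]]
    note DDc = D.D_hom[OF D'.D_hom[OF c]]
    have "e' Y \<cdot>\<^bsub>U\<^esub> amap D (amap D' c) = e' Y \<cdot>\<^bsub>U\<^esub> (amap D (amap D' c) \<cdot>\<^bsub>U\<^esub> (\<epsilon> X \<cdot>\<^bsub>U\<^esub> e' X))"
      using e'[OF X] Uc.ident_right[OF DDc] by simp
    also have "\<dots> = e' Y \<cdot>\<^bsub>U\<^esub> (\<epsilon> Y \<cdot>\<^bsub>U\<^esub> (c \<cdot>\<^bsub>U\<^esub> e' X))"
      using Uc.cmp_assoc[OF eX \<epsilon>H[OF X] DDc] \<epsilon>nat[OF c] Uc.cmp_assoc[OF eX c \<epsilon>H[OF Y]] by simp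
    also have "\<dots> = c \<cdot>\<^bsub>U\<^esub> e' X"
      using Uc.cmp_assoc[OF Uc.cmp_hom[OF eX c] \<epsilon>H[OF Y] eY] e'[OF Y] Uc.ident_left[OF Uc.cmp_hom[OF eX c]]
      by simp
    finally show ?thesis by simp
  qed
  \<comment> \<open>D'(\<epsilon> Y) has \<eta> at D'Y as a right inverse, by the given triangle
    identity, and D'(e' Y) as a left inverse, by functoriality. So these two agree, and e at D'Y
    inverts them.\<close>
  have tri: "e (omap D' Y) \<cdot>\<^bsub>T\<^esub> amap D' (e' Y) = ident T (omap D' Y)" if Y: "Y \<in> obj ?U" for Y
  proof -
    note D'Y = D'.D_obj[OF Y]
    note eY = conjunct1[OF e[OF D'Y]] and e'Y = conjunct1[OF e'[OF Y]] and \<eta>Y = \<eta>H[OF D'Y]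
    note D'e = D'.D_hom[OF e'Y] and D'\<epsilon> = D'.D_hom[OF \<epsilon>H[OF Y]]
    have 1: "amap D' (\<epsilon> Y) \<cdot>\<^bsub>T\<^esub> \<eta> (omap D' Y) = ident T (omap D' Y)" using tr Y by simp
    have "e' Y \<cdot>\<^bsub>?U\<^esub> \<epsilon> Y = ident ?U Y" "\<epsilon> Y \<cdot>\<^bsub>?U\<^esub> e' Y = ident ?U (omap D (omap D' Y))"
      using e'[OF Y] by simp_all
    then have 2: "amap D' (e' Y) \<cdot>\<^bsub>T\<^esub> amap D' (\<epsilon> Y) = ident T (omap D' (omap D (omap D' Y)))"
      using D'.D_cmp[OF e'Y \<epsilon>H[OF Y]] D'.D_ident[OF D.D_obj[OF D'Y]] by simp
    have "amap D' (e' Y) = amap D' (e' Y) \<cdot>\<^bsub>T\<^esub> (amap D' (\<epsilon> Y) \<cdot>\<^bsub>T\<^esub> \<eta> (omap D' Y))"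
      using 1 Tc.ident_right[OF D'e] by simp
    also have "\<dots> = \<eta> (omap D' Y)"
      using Tc.cmp_assoc[OF \<eta>Y D'\<epsilon> D'e] 2 Tc.ident_left[OF \<eta>Y] by simp
    finally show ?thesis using e[OF D'Y] by simp
  qed
  show ?thesis
    by (rule that[of e e' \<epsilon>]) (use e enat e' e'nat tri \<epsilon>H \<epsilon>nat in blast)+
qed

end


section \<open>Duals of represented modules, and lifting of retracts to the triangulated
  category\<close>

context AGJ
begin

text \<open>At Y the isomorphism is \<theta> followed by precomposition with \<epsilon> Y:
  Hom(Hom(D'Y, X), Q/Z) -> Hom(DD'Y, QX) -> Hom(Y, QX).\<close>

lemma dual_represented:
  assumes X: "X \<in> obj T"
  shows "raw_retract (compacts V U) (dual_raw (compacts V U) D' (hom_mod T X)) (hom_mod U (omap Q X))"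
    "raw_retract (compacts V U) (hom_mod U (omap Q X)) (dual_raw (compacts V U) D' (hom_mod T X))"
proof -
  let ?T = "compacts V T" and ?U = "compacts V U"
  let ?N = "dual_raw ?U D' (hom_mod T X)"
  interpret S: AGJ V U T Q' Q D' D by (rule AGJ_swap)
  interpret D: dualizing_functor V ?U ?T D by (rule D_dualizing)
  interpret D': dualizing_functor V ?T ?U D' by (rule S.D_dualizing)
  have N: "raw_module V ?U ?N" by (rule D'.raw_module_dual[OF T.raw_module_hom_mod[OF X]])
  obtain \<theta> where \<theta>0: "\<forall>C X. compact_object V T C \<longrightarrow> X \<in> obj T \<longrightarrow>
      \<theta> C X \<in> Group.iso (hom_group (HomG T C X) QZ) (HomG U (omap D C) (omap Q X))"
    and nat0: "\<forall>c C C' X \<xi>. c \<in> Homs (compacts V T) C C' \<longrightarrow> X \<in> obj T \<longrightarrow>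
      \<xi> \<in> carrier (hom_group (HomG T C X) QZ) \<longrightarrow>
      \<theta> C' X (\<lambda>g \<in> Homs T C' X. \<xi> (g \<cdot>\<^bsub>T\<^esub> c)) = \<theta> C X \<xi> \<cdot>\<^bsub>U\<^esub> amap D c"
    using formula by blast
  note \<theta> = \<theta>0[rule_format, OF _ X] and nat = nat0[rule_format, OF _ X]
  have "raw_retract ?U ?N (hom_mod U (omap Q X)) \<and> raw_retract ?U (hom_mod U (omap Q X)) ?N"
  proof (rule counits)
    fix e e' \<epsilon>
    assume e': "\<And>Y. Y \<in> obj ?U \<Longrightarrow> e' Y \<in> Homs ?U (omap D (omap D' Y)) Y"
      and \<epsilon>: "\<And>Y. Y \<in> obj ?U \<Longrightarrow> \<epsilon> Y \<in> Homs ?U Y (omap D (omap D' Y))"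
      and \<epsilon>nat: "\<And>c X Y. c \<in> Homs ?U X Y \<Longrightarrow> \<epsilon> Y \<cdot>\<^bsub>U\<^esub> c = amap D (amap D' c) \<cdot>\<^bsub>U\<^esub> \<epsilon> X"
      and e'\<epsilon>: "\<And>Y. Y \<in> obj ?U \<Longrightarrow> e' Y \<cdot>\<^bsub>U\<^esub> \<epsilon> Y = ident U Y"
      and \<epsilon>e': "\<And>Y. Y \<in> obj ?U \<Longrightarrow> \<epsilon> Y \<cdot>\<^bsub>U\<^esub> e' Y = ident U (omap D (omap D' Y))"
    have UcH: "c \<in> Homs U A B" if "c \<in> Homs ?U A B" for c A B
      using that by (auto simp: Homs_compacts split: if_splits)
    note \<epsilon>U = UcH[OF \<epsilon>] and e'U = UcH[OF e']
    let ?\<phi> = "\<lambda>Y \<xi>. \<theta> (omap D' Y) X \<xi> \<cdot>\<^bsub>U\<^esub> \<epsilon> Y"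
    have \<theta>iso: "\<theta> (omap D' Y) X \<in> Group.iso (omap ?N Y) (HomG U (omap D (omap D' Y)) (omap Q X))"
      if "Y \<in> obj ?U" for Y
      using \<theta>[of "omap D' Y"] D'.D_obj[OF that] by simp
    then have \<theta>hom: "\<theta> (omap D' Y) X \<in> hom (omap ?N Y) (HomG U (omap D (omap D' Y)) (omap Q X))"
      and \<theta>bij: "bij_betw (\<theta> (omap D' Y) X) (carrier (omap ?N Y)) (Homs U (omap D (omap D' Y)) (omap Q X))"
      if "Y \<in> obj ?U" for Y
      using that unfolding Group.iso_def HomG_simps by blast+
    have \<theta>H: "\<theta> (omap D' Y) X \<xi> \<in> Homs U (omap D (omap D' Y)) (omap Q X)"
      if "Y \<in> obj ?U" "\<xi> \<in> carrier (omap ?N Y)" for Y \<xi>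
      using bij_betwE[OF \<theta>bij[OF that(1)]] that(2) by blast
    have hom: "raw_hom ?U ?N (hom_mod U (omap Q X)) ?\<phi>"
    proof (rule raw_homI)
      fix Y \<xi> assume Y: "Y \<in> obj ?U" and \<xi>: "\<xi> \<in> carrier (omap ?N Y)"
      show "?\<phi> Y \<xi> \<in> carrier (omap (hom_mod U (omap Q X)) Y)"
        using U.cmp_hom[OF \<epsilon>U[OF Y] \<theta>H[OF Y \<xi>]] by simp
      fix \<zeta> assume \<zeta>: "\<zeta> \<in> carrier (omap ?N Y)"
      have "\<theta> (omap D' Y) X (\<xi> \<otimes>\<^bsub>omap ?N Y\<^esub> \<zeta>) = \<theta> (omap D' Y) X \<xi> \<uplus>\<^bsub>U\<^esub> \<theta> (omap D' Y) X \<zeta>"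
        using hom_mult[OF \<theta>hom[OF Y] \<xi> \<zeta>] unfolding HomG_simps .
      then show "?\<phi> Y (\<xi> \<otimes>\<^bsub>omap ?N Y\<^esub> \<zeta>) = ?\<phi> Y \<xi> \<otimes>\<^bsub>omap (hom_mod U (omap Q X)) Y\<^esub> ?\<phi> Y \<zeta>"
        using U.cmp_add_left[OF \<epsilon>U[OF Y] \<theta>H[OF Y \<xi>] \<theta>H[OF Y \<zeta>]]
        unfolding hom_mod_simps HomG_simps by simp
    next
      fix Y Y' c \<xi> assume c: "c \<in> Homs ?U Y Y'" and \<xi>: "\<xi> \<in> carrier (omap ?N Y')"
      have o: "Y \<in> obj ?U" "Y' \<in> obj ?U" using Uc.Homs_obj[OF c] by simp_all
      note DDc = UcH[OF D.D_hom[OF D'.D_hom[OF c]]]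
      have a: "amap ?N c \<xi> = (\<lambda>g\<in>Homs T (omap D' Y) X. \<xi> (g \<cdot>\<^bsub>T\<^esub> amap D' c))"
        using HomsD[OF c] by (simp add: compose_def)
      have "\<theta> (omap D' Y) X (amap ?N c \<xi>) = \<theta> (omap D' Y') X \<xi> \<cdot>\<^bsub>U\<^esub> amap D (amap D' c)"
        unfolding a using nat[OF D'.D_hom[OF c]] \<xi> by simp
      then have "?\<phi> Y (amap ?N c \<xi>) = \<theta> (omap D' Y') X \<xi> \<cdot>\<^bsub>U\<^esub> (amap D (amap D' c) \<cdot>\<^bsub>U\<^esub> \<epsilon> Y)"
        using U.cmp_assoc[OF \<epsilon>U[OF o(1)] DDc \<theta>H[OF o(2) \<xi>]] by (simp only:)
      also have "\<dots> = ?\<phi> Y' \<xi> \<cdot>\<^bsub>U\<^esub> c"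
        using \<epsilon>nat[OF c] U.cmp_assoc[OF UcH[OF c] \<epsilon>U[OF o(2)] \<theta>H[OF o(2) \<xi>]] by simp
      finally show "?\<phi> Y (amap ?N c \<xi>) = amap (hom_mod U (omap Q X)) c (?\<phi> Y' \<xi>)"
        unfolding hom_mod_simps .
    qed
    have bij: "bij_betw (?\<phi> Y) (carrier (omap ?N Y)) (carrier (omap (hom_mod U (omap Q X)) Y))"
      if Y: "Y \<in> obj ?U" for Y
    proof -
      have "bij_betw (\<lambda>v. v \<cdot>\<^bsub>U\<^esub> \<epsilon> Y) (Homs U (omap D (omap D' Y)) (omap Q X)) (Homs U Y (omap Q X))"
      proof (rule bij_betw_byWitness[where f' = "\<lambda>v. v \<cdot>\<^bsub>U\<^esub> e' Y"])
        show "\<forall>v\<in>Homs U (omap D (omap D' Y)) (omap Q X). v \<cdot>\<^bsub>U\<^esub> \<epsilon> Y \<cdot>\<^bsub>U\<^esub> e' Y = v"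
          using U.cmp_assoc[OF e'U[OF Y] \<epsilon>U[OF Y], of _ "omap Q X"] \<epsilon>e'[OF Y] U.ident_right by simp
        show "\<forall>v\<in>Homs U Y (omap Q X). v \<cdot>\<^bsub>U\<^esub> e' Y \<cdot>\<^bsub>U\<^esub> \<epsilon> Y = v"
          using U.cmp_assoc[OF \<epsilon>U[OF Y] e'U[OF Y], of _ "omap Q X"] e'\<epsilon>[OF Y] U.ident_right by simp
        show "(\<lambda>v. v \<cdot>\<^bsub>U\<^esub> \<epsilon> Y) ` Homs U (omap D (omap D' Y)) (omap Q X) \<subseteq> Homs U Y (omap Q X)"
          using U.cmp_hom[OF \<epsilon>U[OF Y]] by blast
        show "(\<lambda>v. v \<cdot>\<^bsub>U\<^esub> e' Y) ` Homs U Y (omap Q X) \<subseteq> Homs U (omap D (omap D' Y)) (omap Q X)"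
          using U.cmp_hom[OF e'U[OF Y]] by blast
      qed
      from bij_betw_trans[OF \<theta>bij[OF Y] this] show ?thesis by (simp add: comp_def)
    qed
    show ?thesis
      using raw_retract_bij[OF N hom bij] by blast
  qed
  then show "raw_retract ?U ?N (hom_mod U (omap Q X))" "raw_retract ?U (hom_mod U (omap Q X)) ?N"
    by blast+
qed

lemma triple_dual:
  assumes M: "raw_module V (compacts V T) M"
  shows "raw_retract (compacts V U) (dual_raw (compacts V U) D' M)
    (dual_raw (compacts V U) D' (dual_raw (compacts V T) D (dual_raw (compacts V U) D' M)))"
proof (rule counits)
  interpret S: AGJ V U T Q' Q D' D by (rule AGJ_swap)
  fix e e' \<epsilon>
  assume "\<And>X. X \<in> obj (compacts V T) \<Longrightarrow> e X \<in> Homs (compacts V T) (omap D' (omap D X)) X"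
    "\<And>c X Y. c \<in> Homs (compacts V T) X Y \<Longrightarrow> c \<cdot>\<^bsub>T\<^esub> e X = e Y \<cdot>\<^bsub>T\<^esub> amap D' (amap D c)"
    "\<And>Y. Y \<in> obj (compacts V U) \<Longrightarrow> e' Y \<in> Homs (compacts V U) (omap D (omap D' Y)) Y"
    "\<And>c X Y. c \<in> Homs (compacts V U) X Y \<Longrightarrow> c \<cdot>\<^bsub>U\<^esub> e' X = e' Y \<cdot>\<^bsub>U\<^esub> amap D (amap D' c)"
    "\<And>Y. Y \<in> obj (compacts V U) \<Longrightarrow> e (omap D' Y) \<cdot>\<^bsub>T\<^esub> amap D' (e' Y) = ident T (omap D' Y)"
  then show ?thesis
    by (intro raw_retract_triple_dual[OF S.D_dualizing D_dualizing M, where e = e and e' = e']) simp_all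
qed

text \<open>
  The double dual of \<open>Y\<close> replaces \<open>Y\<close> because it is pure injective, so that the section lifts and not
  only the retraction.
\<close>

lemma retract_lift:
  assumes X: "X \<in> obj T" and Y: "Y \<in> obj U"
    and ret: "raw_retract (compacts V U) (hom_mod U (omap Q X)) (hom_mod U Y)"
  obtains s r where "s \<in> Homs U (omap Q X) (omap Q (omap Q' Y))" "r \<in> Homs U (omap Q (omap Q' Y)) (omap Q X)"
    "r \<cdot>\<^bsub>U\<^esub> s = ident U (omap Q X)"
proof -
  interpret S: AGJ V U T Q' Q D' D by (rule AGJ_swap)
  let ?E = "omap Q X" and ?Z = "omap Q (omap Q' Y)"
  obtain \<G> where "generating_set V U \<G>" by (rule U.generating_set_exists[OF universe])
  then interpret G: generating_set V U \<G> .
  obtain s0 r0 where s0: "yon_hom V U ?E Y s0" and r0: "yon_hom V U Y ?E r0"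
    and rs: "\<forall>K \<in> obj (compacts V U). \<forall>x \<in> carrier (omap (hom_mod U ?E) K). r0 K (s0 K x) = x"
    using ret unfolding raw_retract_def by blast
  note E = Q_pure_injective[OF X] and Z = Q_pure_injective[OF S.Q_obj[OF Y]]
  have EO: "?E \<in> obj U" and ZO: "?Z \<in> obj U" using Q_obj X S.Q_obj[OF Y] by blast+
  obtain j where j: "j \<in> Homs U Y ?Z" and jp: "pure_mono V U j"
    using unit_exists Y by blast
  have ker: "r0 K y = hom_zero U K ?E"
    if K: "compact_object V U K" and y: "y \<in> Homs U K Y" and jy: "j \<cdot>\<^bsub>U\<^esub> y = hom_zero U K ?Z" for K y
  proof -
    note K' = compact_objectD[OF K]
    have "y = hom_zero U K Y"
      by (rule U.pure_mono_inj[OF jp j K y U.zero_hom[OF K' Y]])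
        (use jy U.cmp_zero_right[OF j K'] in simp)
    then show ?thesis using U.yon_hom_zero[OF r0 K Y] by simp
  qed
  obtain r1 where r1: "yon_hom V U ?Z ?E r1"
    and r1j: "\<And>K y. compact_object V U K \<Longrightarrow> y \<in> Homs U K Y \<Longrightarrow> r1 K (j \<cdot>\<^bsub>U\<^esub> y) = r0 K y"
    using U.pure_injective_extend[OF E j r0 ker] by blast
  obtain s where s: "s \<in> Homs U ?E ?Z"
    and s': "\<And>K x. compact_object V U K \<Longrightarrow> x \<in> Homs U K ?E \<Longrightarrow> j \<cdot>\<^bsub>U\<^esub> s0 K x = s \<cdot>\<^bsub>U\<^esub> x"
    using G.yon_full_on_pure_injectives[OF Z EO U.yon_hom_comp[OF s0 U.yon_hom_post[OF j]]] by blast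
  obtain r where r: "r \<in> Homs U ?Z ?E"
    and r': "\<And>K x. compact_object V U K \<Longrightarrow> x \<in> Homs U K ?Z \<Longrightarrow> r1 K x = r \<cdot>\<^bsub>U\<^esub> x"
    using G.yon_full_on_pure_injectives[OF E ZO r1] by blast
  note rsH = U.cmp_hom[OF s r]
  have "r \<cdot>\<^bsub>U\<^esub> s \<cdot>\<^bsub>U\<^esub> x = x" if G: "G \<in> \<G>" and x: "x \<in> Homs U G ?E" for G x
  proof -
    note K = G.generators_compact[OF G]
    note s0x = U.yon_homD(1)[OF s0 K x]
    have "r \<cdot>\<^bsub>U\<^esub> s \<cdot>\<^bsub>U\<^esub> x = r \<cdot>\<^bsub>U\<^esub> (s \<cdot>\<^bsub>U\<^esub> x)" using U.cmp_assoc[OF x s r] by simp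
    also have "\<dots> = r \<cdot>\<^bsub>U\<^esub> (j \<cdot>\<^bsub>U\<^esub> s0 G x)" using s'[OF K x] by simp
    also have "\<dots> = r1 G (j \<cdot>\<^bsub>U\<^esub> s0 G x)" using r'[OF K U.cmp_hom[OF s0x j]] by simp
    also have "\<dots> = r0 G (s0 G x)" using r1j[OF K s0x] .
    also have "\<dots> = x" using rs K x by simp
    finally show ?thesis .
  qed
  \<comment> \<open>The composite r s is controlled only on maps from compact objects, where it is
    the identity. This makes it invertible, and composing r with the inverse gives a true
    retraction.\<close>
  then have "is_iso U ?E ?E (r \<cdot>\<^bsub>U\<^esub> s)"
    by (rule G.is_iso_if_identity_on_generators[OF rsH])
  then obtain g where g: "g \<in> Homs U ?E ?E" "g \<cdot>\<^bsub>U\<^esub> (r \<cdot>\<^bsub>U\<^esub> s) = ident U ?E"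
    by (rule U.is_isoE)
  show ?thesis
    by (rule that[OF s U.cmp_hom[OF r g(1)]]) (use U.cmp_assoc[OF s r g(1)] g(2) in simp)
qed

end


section \<open>The classes \<A> and \<B>: closure properties, represented part, and duality\<close>

section \<open>The classes of modules\<close>

lemma raw_hom_mult:
  assumes N: "raw_module V C N" and \<phi>: "raw_hom C M N \<phi>" and \<psi>: "raw_hom C M N \<psi>"
  shows "raw_hom C M N (\<lambda>X x. \<phi> X x \<otimes>\<^bsub>omap N X\<^esub> \<psi> X x)"
proof (rule raw_homI)
  interpret N: raw_module V C N by fact
  fix X x assume X: "X \<in> obj C" and x: "x \<in> carrier (omap M X)"
  interpret G: comm_group "omap N X" by (rule N.comm_grp[OF X])
  note \<phi>X = raw_homD(2,3)[OF \<phi> X] and \<psi>X = raw_homD(2,3)[OF \<psi> X]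
  show "\<phi> X x \<otimes>\<^bsub>omap N X\<^esub> \<psi> X x \<in> carrier (omap N X)" using \<phi>X(1) \<psi>X(1) x by simp
  fix y assume y: "y \<in> carrier (omap M X)"
  show "\<phi> X (x \<otimes>\<^bsub>omap M X\<^esub> y) \<otimes>\<^bsub>omap N X\<^esub> \<psi> X (x \<otimes>\<^bsub>omap M X\<^esub> y) =
      \<phi> X x \<otimes>\<^bsub>omap N X\<^esub> \<psi> X x \<otimes>\<^bsub>omap N X\<^esub> (\<phi> X y \<otimes>\<^bsub>omap N X\<^esub> \<psi> X y)"
    using \<phi>X \<psi>X x y by (simp add: G.m_ac)
next
  interpret N: raw_module V C N by fact
  fix X Y c x assume c: "c \<in> Homs C X Y" and x: "x \<in> carrier (omap M Y)"
  have Y: "Y \<in> obj C" using N.Homs_obj[OF c] by simp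
  show "\<phi> X (amap M c x) \<otimes>\<^bsub>omap N X\<^esub> \<psi> X (amap M c x) = amap N c (\<phi> Y x \<otimes>\<^bsub>omap N Y\<^esub> \<psi> Y x)"
    using raw_homD(4)[OF \<phi> c x] raw_homD(4)[OF \<psi> c x]
      hom_mult[OF N.act_hom[OF c] raw_homD(2)[OF \<phi> Y x] raw_homD(2)[OF \<psi> Y x]] by simp
qed

lemma raw_hom_one:
  assumes N: "raw_module V C N"
  shows "raw_hom C M N (\<lambda>X x. \<one>\<^bsub>omap N X\<^esub>)"
proof (rule raw_homI)
  interpret N: raw_module V C N by fact
  fix X assume X: "X \<in> obj C"
  interpret G: comm_group "omap N X" by (rule N.comm_grp[OF X])
  show "\<one>\<^bsub>omap N X\<^esub> \<in> carrier (omap N X)" "\<one>\<^bsub>omap N X\<^esub> = \<one>\<^bsub>omap N X\<^esub> \<otimes>\<^bsub>omap N X\<^esub> \<one>\<^bsub>omap N X\<^esub>"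
    by simp_all
next
  interpret N: raw_module V C N by fact
  fix X Y c assume c: "c \<in> Homs C X Y"
  show "\<one>\<^bsub>omap N X\<^esub> = amap N c \<one>\<^bsub>omap N Y\<^esub>"
    using hom_one[OF N.act_hom[OF c]] N.grp N.Homs_obj[OF c] by simp
qed

lemma raw_hom_one_at:
  assumes "raw_module V C M" "raw_module V C N" "raw_hom C M N \<phi>" "X \<in> obj C"
  shows "\<phi> X \<one>\<^bsub>omap M X\<^esub> = \<one>\<^bsub>omap N X\<^esub>"
  using hom_one[OF raw_homD(1)[OF assms(3,4)]] raw_module.grp[OF assms(1,4)] raw_module.grp[OF assms(2,4)] .

lemma closed_finite_coproductsD:
  assumes "closed_finite_coproducts C \<Y>" "is_coproduct C (I :: nat set) X S \<iota>" "finite I"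
    "\<And>i. i \<in> I \<Longrightarrow> X i \<in> \<Y>"
  shows "S \<in> \<Y>"
  by (rule assms(1)[unfolded closed_finite_coproducts_def, rule_format, of I X S \<iota>]) (simp add: assms)

locale AGJ_duality_pair = AGJ V T U Q Q' D D'
  for V :: "'v itself" and T :: "('o, 'm, 'z) triang_scheme" and U :: "('p, 'n, 'w) triang_scheme"
    and Q :: "('o, 'm, 'p, 'n) fctr" and Q' :: "('p, 'n, 'o, 'm) fctr"
    and D :: "('o, 'm, 'p, 'n) fctr" and D' :: "('p, 'n, 'o, 'm) fctr" +
  fixes \<X> :: "'o set" and \<Y> :: "'p set"
  assumes pair: "symmetric_duality_pair T U (omap Q) (omap Q') \<X> \<Y>"
begin

lemma pair_swap: "AGJ_duality_pair V U T Q' Q D' D \<Y> \<X>"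
  using pair by (intro AGJ_duality_pair.intro AGJ_swap AGJ_duality_pair_axioms.intro)
    (simp add: symmetric_duality_pair_def)

lemma pair_iff: "X \<in> obj T \<Longrightarrow> X \<in> \<X> \<longleftrightarrow> omap Q X \<in> \<Y>" "Y \<in> obj U \<Longrightarrow> Y \<in> \<Y> \<longleftrightarrow> omap Q' Y \<in> \<X>"
  using pair by (simp_all add: symmetric_duality_pair_def duality_pair_def)

lemma pair_obj: "X \<in> \<X> \<Longrightarrow> X \<in> obj T" "Y \<in> \<Y> \<Longrightarrow> Y \<in> obj U"
  using pair by (auto simp: symmetric_duality_pair_def duality_pair_def)

text \<open>
  A module is a retract of a represented one iff its identity factors through it.  Factorizations are
  closed under sums because \<open>\<Y>\<close> is closed under finite coproducts; so for a finite direct sum it is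
  enough to factor the summands of \<open>1 = \<Sum>\<^sub>i \<iota>\<^sub>i \<pi>\<^sub>i\<close>.
\<close>

definition factors :: "('p, 'n, 'a) rmod \<Rightarrow> ('p \<Rightarrow> 'a \<Rightarrow> 'a) \<Rightarrow> bool" where
  "factors N \<alpha> \<longleftrightarrow> (\<exists>Y \<in> \<Y>. \<exists>s r. raw_hom (compacts V U) N (hom_mod U Y) s \<and>
    raw_hom (compacts V U) (hom_mod U Y) N r \<and>
    (\<forall>K \<in> obj (compacts V U). \<forall>x \<in> carrier (omap N K). \<alpha> K x = r K (s K x)))"

lemma factors_cong:
  assumes "factors N \<alpha>"
    and eq: "\<And>K x. K \<in> obj (compacts V U) \<Longrightarrow> x \<in> carrier (omap N K) \<Longrightarrow> \<beta> K x = \<alpha> K x"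
  shows "factors N \<beta>"
proof -
  obtain Y s r where "Y \<in> \<Y>" "raw_hom (compacts V U) N (hom_mod U Y) s"
    "raw_hom (compacts V U) (hom_mod U Y) N r"
    and sr: "\<forall>K \<in> obj (compacts V U). \<forall>x \<in> carrier (omap N K). \<alpha> K x = r K (s K x)"
    using assms(1) unfolding factors_def by blast
  moreover have "\<forall>K \<in> obj (compacts V U). \<forall>x \<in> carrier (omap N K). \<beta> K x = r K (s K x)"
    using sr by (simp add: eq)
  ultimately show ?thesis unfolding factors_def by blast
qed

lemma factors_id_iff:
  "factors N (\<lambda>K x. x) \<longleftrightarrow> (\<exists>Y \<in> \<Y>. raw_retract (compacts V U) N (hom_mod U Y))"
  unfolding factors_def raw_retract_def by metis

text \<open>The empty coproduct is a zero object in \<Y>, and zero homomorphisms factor through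
  it.\<close>

lemma factors_one:
  assumes N: "raw_module V (compacts V U) N"
  shows "factors N (\<lambda>K x. \<one>\<^bsub>omap N K\<^esub>)"
proof -
  obtain S \<iota> where S: "is_coproduct U {} (\<lambda>_ :: nat. undefined) S \<iota>"
    using U.finite_coproducts[of "{}" "\<lambda>_. undefined"] by blast
  have "closed_finite_coproducts U \<Y>"
    using pair by (simp add: symmetric_duality_pair_def duality_pair_def)
  from closed_finite_coproductsD[OF this S] have "S \<in> \<Y>" by simp
  moreover note raw_hom_one[OF U.raw_module_hom_mod[OF pair_obj(2)[OF calculation]]] raw_hom_one[OF N]
  ultimately show ?thesis unfolding factors_def by blast
qed

text \<open>Both factorizations are routed through the coproduct S of Y and Y' in U, with inclusions
  on the way in and projections on the way out. The mixed terms vanish.\<close>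

lemma factors_mult:
  assumes N: "raw_module V (compacts V U) N" and \<alpha>: "factors N \<alpha>" and \<beta>: "factors N \<beta>"
  shows "factors N (\<lambda>K x. \<alpha> K x \<otimes>\<^bsub>omap N K\<^esub> \<beta> K x)"
proof -
  obtain Y s r where Y: "Y \<in> \<Y>" and s: "raw_hom (compacts V U) N (hom_mod U Y) s"
    and r: "raw_hom (compacts V U) (hom_mod U Y) N r"
    and rs: "\<forall>K \<in> obj (compacts V U). \<forall>x \<in> carrier (omap N K). \<alpha> K x = r K (s K x)"
    using \<alpha> unfolding factors_def by blast
  obtain Y' s' r' where Y': "Y' \<in> \<Y>" and s': "raw_hom (compacts V U) N (hom_mod U Y') s'"
    and r': "raw_hom (compacts V U) (hom_mod U Y') N r'"
    and rs': "\<forall>K \<in> obj (compacts V U). \<forall>x \<in> carrier (omap N K). \<beta> K x = r' K (s' K x)"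
    using \<beta> unfolding factors_def by blast
  let ?F = "\<lambda>i :: nat. if i = 0 then Y else Y'"
  have FY: "?F i \<in> \<Y>" for i using Y Y' by simp
  have FO: "?F i \<in> obj U" for i using pair_obj(2)[OF FY] .
  have YO: "Y \<in> obj U" "Y' \<in> obj U" using pair_obj(2) Y Y' by blast+
  obtain S \<iota> where cop: "is_coproduct U {0, 1} ?F S \<iota>"
    using U.finite_coproducts[of "{0, 1}" ?F] FO by blast
  have "closed_finite_coproducts U \<Y>"
    using pair by (simp add: symmetric_duality_pair_def duality_pair_def)
  from closed_finite_coproductsD[OF this cop _ FY] have SY: "S \<in> \<Y>" by simp
  note SO = pair_obj(2)[OF SY]
  have \<iota>: "\<iota> 0 \<in> Homs U Y S" "\<iota> 1 \<in> Homs U Y' S"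
    using U.coproductD(2)[OF cop, of 0] U.coproductD(2)[OF cop, of 1] by simp_all
  have "\<exists>\<pi> :: nat \<Rightarrow> 'n. \<pi> 0 \<in> Homs U S Y \<and> \<pi> 1 \<in> Homs U S Y' \<and> \<pi> 0 \<cdot>\<^bsub>U\<^esub> \<iota> 0 = ident U Y \<and> \<pi> 1 \<cdot>\<^bsub>U\<^esub> \<iota> 1 = ident U Y' \<and>
      \<pi> 0 \<cdot>\<^bsub>U\<^esub> \<iota> 1 = hom_zero U Y' Y \<and> \<pi> 1 \<cdot>\<^bsub>U\<^esub> \<iota> 0 = hom_zero U Y Y'"
  proof (rule U.coproduct_projections[OF cop FO])
    fix \<pi> assume p: "\<And>j. j \<in> {0, 1} \<Longrightarrow> \<pi> j \<in> Homs U S (?F j)"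
      "\<And>j. j \<in> {0, 1} \<Longrightarrow> \<pi> j \<cdot>\<^bsub>U\<^esub> \<iota> j = ident U (?F j)"
      "\<And>i j. i \<in> {0, 1} \<Longrightarrow> j \<in> {0, 1} \<Longrightarrow> i \<noteq> j \<Longrightarrow> \<pi> j \<cdot>\<^bsub>U\<^esub> \<iota> i = hom_zero U (?F i) (?F j)"
    show ?thesis
      using p(1)[of 0] p(1)[of 1] p(2)[of 0] p(2)[of 1] p(3)[of 0 1] p(3)[of 1 0]
      by (intro exI[of _ \<pi>]) simp
  qed
  then obtain \<pi> :: "nat \<Rightarrow> 'n" where \<pi>: "\<pi> 0 \<in> Homs U S Y" "\<pi> 1 \<in> Homs U S Y'"
    and \<pi>\<iota>: "\<pi> 0 \<cdot>\<^bsub>U\<^esub> \<iota> 0 = ident U Y" "\<pi> 1 \<cdot>\<^bsub>U\<^esub> \<iota> 1 = ident U Y'"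
      "\<pi> 0 \<cdot>\<^bsub>U\<^esub> \<iota> 1 = hom_zero U Y' Y" "\<pi> 1 \<cdot>\<^bsub>U\<^esub> \<iota> 0 = hom_zero U Y Y'"
    by blast
  let ?s = "\<lambda>K x. (\<iota> 0 \<cdot>\<^bsub>U\<^esub> s K x) \<otimes>\<^bsub>omap (hom_mod U S) K\<^esub> (\<iota> 1 \<cdot>\<^bsub>U\<^esub> s' K x)"
  let ?r = "\<lambda>K y. r K (\<pi> 0 \<cdot>\<^bsub>U\<^esub> y) \<otimes>\<^bsub>omap N K\<^esub> r' K (\<pi> 1 \<cdot>\<^bsub>U\<^esub> y)"
  have "raw_hom (compacts V U) N (hom_mod U S) ?s"
    by (rule raw_hom_mult[OF U.raw_module_hom_mod[OF SO]
          raw_hom_comp[OF U.preadditive_compacts s U.yon_hom_post[OF \<iota>(1)]]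
          raw_hom_comp[OF U.preadditive_compacts s' U.yon_hom_post[OF \<iota>(2)]]])
  moreover have "raw_hom (compacts V U) (hom_mod U S) N ?r"
    by (rule raw_hom_mult[OF N raw_hom_comp[OF U.preadditive_compacts U.yon_hom_post[OF \<pi>(1)] r]
          raw_hom_comp[OF U.preadditive_compacts U.yon_hom_post[OF \<pi>(2)] r']])
  moreover have "\<alpha> K x \<otimes>\<^bsub>omap N K\<^esub> \<beta> K x = ?r K (?s K x)"
    if K: "K \<in> obj (compacts V U)" and x: "x \<in> carrier (omap N K)" for K x
  proof -
    have a: "s K x \<in> Homs U K Y" and b: "s' K x \<in> Homs U K Y'"
      using raw_homD(2)[OF s K x] raw_homD(2)[OF s' K x] by simp_all
    have "\<pi> 0 \<cdot>\<^bsub>U\<^esub> (\<iota> 0 \<cdot>\<^bsub>U\<^esub> s K x \<uplus>\<^bsub>U\<^esub> \<iota> 1 \<cdot>\<^bsub>U\<^esub> s' K x) = s K x"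
      using U.cmp_add_right[OF U.cmp_hom[OF a \<iota>(1)] U.cmp_hom[OF b \<iota>(2)] \<pi>(1)]
        U.cmp_assoc[OF a \<iota>(1) \<pi>(1)] U.cmp_assoc[OF b \<iota>(2) \<pi>(1)] \<pi>\<iota> U.ident_left[OF a]
        U.cmp_zero_left[OF b YO(1)] U.add_zero(1)[OF a] by simp
    moreover have "\<pi> 1 \<cdot>\<^bsub>U\<^esub> (\<iota> 0 \<cdot>\<^bsub>U\<^esub> s K x \<uplus>\<^bsub>U\<^esub> \<iota> 1 \<cdot>\<^bsub>U\<^esub> s' K x) = s' K x"
      using U.cmp_add_right[OF U.cmp_hom[OF a \<iota>(1)] U.cmp_hom[OF b \<iota>(2)] \<pi>(2)]
        U.cmp_assoc[OF a \<iota>(1) \<pi>(2)] U.cmp_assoc[OF b \<iota>(2) \<pi>(2)] \<pi>\<iota> U.ident_left[OF b]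
        U.cmp_zero_left[OF a YO(2)] U.add_zero(2)[OF b] by simp
    ultimately show ?thesis using rs rs' K x by simp
  qed
  ultimately show ?thesis unfolding factors_def using SY by blast
qed

text \<open>The class \<A>. Interpreting the locale with the two sides exchanged yields
  \<B>.\<close>

definition modules :: "('o, 'm, 'v) abmod set" where
  "modules = {f \<in> obj (Mod_cat V (compacts V T)).
    \<exists>Y \<in> \<Y>. raw_retract (compacts V U) (dual_raw (compacts V U) D' (underlying f)) (hom_mod U Y)}"

lemma raw_module_of_obj:
  "f \<in> obj (Mod_cat V (compacts V T)) \<Longrightarrow> raw_module V (compacts V T) (underlying f)"
  by (rule raw_module_underlying[OF T.preadditive_compacts])

lemma D'_dualizing: "dualizing_functor V (compacts V T) (compacts V U) D'"
  using AGJ.D_dualizing[OF AGJ_swap] .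

lemma dual_mod_obj:
  assumes "f \<in> obj (Mod_cat V (compacts V T))"
  shows "dual_mod U D' f \<in> obj (Mod_cat V (compacts V U))"
  unfolding dual_mod_eq_copy_mod[of U D' f V]
  by (rule raw_module.copy_mod_obj, rule dualizing_functor.raw_module_dual[OF D'_dualizing],
      rule raw_module_of_obj[OF assms])

lemma modules_retract:
  assumes g: "g \<in> modules" and f: "f \<in> obj (Mod_cat V (compacts V T))"
    and ret: "raw_retract (compacts V T) (underlying f) (underlying g)"
  shows "f \<in> modules"
proof -
  interpret D': dualizing_functor V "compacts V T" "compacts V U" D' by (rule D'_dualizing)
  obtain Y where Y: "Y \<in> \<Y>" "raw_retract (compacts V U) (dual_raw (compacts V U) D' (underlying g)) (hom_mod U Y)"
    and gO: "g \<in> obj (Mod_cat V (compacts V T))"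
    using g by (auto simp: modules_def)
  have "raw_retract (compacts V U) (dual_raw (compacts V U) D' (underlying f)) (dual_raw (compacts V U) D' (underlying g))"
    by (rule D'.raw_retract_dual[OF raw_module_of_obj[OF f] raw_module_of_obj[OF gO] ret])
  then show ?thesis
    unfolding modules_def using f Y raw_retract_trans[OF U.preadditive_compacts] by blast
qed

lemma modules_closed_retracts: "closed_retracts (Mod_cat V (compacts V T)) modules"
  unfolding closed_retracts_def
proof (intro ballI impI)
  fix g f s r assume g: "g \<in> modules" and f: "f \<in> obj (Mod_cat V (compacts V T))"
    and s: "s \<in> Homs (Mod_cat V (compacts V T)) f g" and r: "r \<in> Homs (Mod_cat V (compacts V T)) g f"
    and rs: "r \<cdot>\<^bsub>Mod_cat V (compacts V T)\<^esub> s = ident (Mod_cat V (compacts V T)) f"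
  have "component r K (component s K x) = x" if K: "K \<in> obj (compacts V T)" and x: "x \<in> carrier (omap f K)" for K x
    using component_cmp[OF s r K x] component_ident[OF K x, of V] rs by simp
  then have "raw_retract (compacts V T) (underlying f) (underlying g)"
    unfolding raw_retract_def
    using raw_hom_component[OF T.preadditive_compacts s] raw_hom_component[OF T.preadditive_compacts r]
    by (intro exI[of _ "component s"] exI[of _ "component r"]) simp
  then show "f \<in> modules" by (rule modules_retract[OF g f])
qed

text \<open>S is known only through its universal property, which is used to construct projections
  \<pi> i. The sum of all \<iota> i \<pi> i is the identity, by uniqueness of maps out of S. Dually,
  the identity of the dual of S is a sum of endomorphisms, each of which factors through the dual of
  some F i and hence through a represented module from \<Y>.\<close>

lemma modules_closed_finite_coproducts: "closed_finite_coproducts (Mod_cat V (compacts V T)) modules"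
  unfolding closed_finite_coproducts_def
proof (intro allI impI, elim conjE)
  let ?T = "compacts V T" and ?U = "compacts V U"
  let ?M = "Mod_cat V ?T"
  fix I :: "nat set" and F S \<iota>
  assume fin: "finite I" and F: "\<forall>i\<in>I. F i \<in> modules" and cop: "is_coproduct ?M I F S \<iota>"
  interpret D': dualizing_functor V ?T ?U D' by (rule D'_dualizing)
  have SO: "S \<in> obj ?M" and \<iota>: "\<And>i. i \<in> I \<Longrightarrow> \<iota> i \<in> Homs ?M (F i) S"
    using cop by (auto simp: is_coproduct_def)
  have univ: "\<exists>!h. h \<in> Homs ?M S G \<and> (\<forall>i \<in> I. h \<cdot>\<^bsub>?M\<^esub> \<iota> i = f i)"
    if "G \<in> obj ?M" "\<forall>i \<in> I. f i \<in> Homs ?M (F i) G" for G f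
    using cop that by (simp only: is_coproduct_def)
  have FO: "F i \<in> obj ?M" if "i \<in> I" for i using F that by (simp add: modules_def)
  note TP = T.preadditive_compacts
  note Sm = raw_module_of_obj[OF SO] and Fm = raw_module_of_obj[OF FO]
  note \<iota>h = raw_hom_component[OF TP \<iota>]
  have "\<exists>\<pi>. raw_hom ?T (underlying S) (underlying (F j)) \<pi> \<and>
      (\<forall>i \<in> I. \<forall>K \<in> obj ?T. \<forall>x \<in> carrier (omap (F i) K).
        \<pi> K (component (\<iota> i) K x) = (if i = j then x else \<one>\<^bsub>omap (F j) K\<^esub>))" if j: "j \<in> I" for j
  proof -
    have "\<exists>a. a \<in> Homs ?M (F i) (F j) \<and> (\<forall>K \<in> obj ?T. \<forall>x \<in> carrier (omap (F i) K).
        component a K x = (if i = j then x else \<one>\<^bsub>omap (F j) K\<^esub>))" if i: "i \<in> I" for i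
    proof -
      have "raw_hom ?T (underlying (F i)) (underlying (F j)) (\<lambda>K x. if i = j then x else \<one>\<^bsub>omap (F j) K\<^esub>)"
      proof (cases "i = j")
        case True
        then show ?thesis using raw_hom_id[of ?T "underlying (F j)"] by simp
      next
        case False
        then show ?thesis using raw_hom_one[OF Fm[OF j], of "underlying (F i)"] by simp
      qed
      from Mod_cat_arr_exists[OF TP FO[OF i] FO[OF j] this] show ?thesis by metis
    qed
    then have "\<forall>i\<in>I. \<exists>a. a \<in> Homs ?M (F i) (F j) \<and> (\<forall>K \<in> obj ?T. \<forall>x \<in> carrier (omap (F i) K).
        component a K x = (if i = j then x else \<one>\<^bsub>omap (F j) K\<^esub>))" by blast
    from bchoice[OF this] obtain a where a: "\<forall>i\<in>I. a i \<in> Homs ?M (F i) (F j) \<and> (\<forall>K \<in> obj ?T. \<forall>x \<in> carrier (omap (F i) K).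
        component (a i) K x = (if i = j then x else \<one>\<^bsub>omap (F j) K\<^esub>))" by blast
    then have "\<exists>!h. h \<in> Homs ?M S (F j) \<and> (\<forall>i \<in> I. h \<cdot>\<^bsub>?M\<^esub> \<iota> i = a i)"
      using univ[OF FO[OF j], of a] by blast
    then obtain h where h: "h \<in> Homs ?M S (F j)" "\<forall>i \<in> I. h \<cdot>\<^bsub>?M\<^esub> \<iota> i = a i" by (elim ex1E conjE)
    have "component h K (component (\<iota> i) K x) = (if i = j then x else \<one>\<^bsub>omap (F j) K\<^esub>)"
      if "i \<in> I" "K \<in> obj ?T" "x \<in> carrier (omap (F i) K)" for i K x
      using component_cmp[OF \<iota>[OF that(1)] h(1) that(2,3)] h(2) a that by simp
    then show ?thesis using raw_hom_component[OF TP h(1)] by blast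
  qed
  then have "\<forall>j\<in>I. \<exists>\<pi>. raw_hom ?T (underlying S) (underlying (F j)) \<pi> \<and>
      (\<forall>i \<in> I. \<forall>K \<in> obj ?T. \<forall>x \<in> carrier (omap (F i) K).
        \<pi> K (component (\<iota> i) K x) = (if i = j then x else \<one>\<^bsub>omap (F j) K\<^esub>))" by blast
  from bchoice[OF this] obtain \<pi> where \<pi>0: "\<forall>j\<in>I. raw_hom ?T (underlying S) (underlying (F j)) (\<pi> j) \<and>
      (\<forall>i \<in> I. \<forall>K \<in> obj ?T. \<forall>x \<in> carrier (omap (F i) K).
        \<pi> j K (component (\<iota> i) K x) = (if i = j then x else \<one>\<^bsub>omap (F j) K\<^esub>))" by blast
  have \<pi>: "raw_hom ?T (underlying S) (underlying (F j)) (\<pi> j)" if "j \<in> I" for j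
    using \<pi>0 that by blast
  have \<pi>\<iota>: "\<pi> j K (component (\<iota> i) K x) = (if i = j then x else \<one>\<^bsub>omap (F j) K\<^esub>)"
    if "i \<in> I" "j \<in> I" "K \<in> obj ?T" "x \<in> carrier (omap (F i) K)" for i j K x
    using \<pi>0 that by blast
  let ?N = "dual_raw ?U D' (underlying S)"
  let ?d = "\<lambda>E Y \<xi>. compose (carrier (omap S (omap D' Y))) \<xi> (E (omap D' Y))"
  note N = D'.raw_module_dual[OF Sm]
  have summand: "factors ?N (?d (\<lambda>K x. component (\<iota> i) K (\<pi> i K x)))" if i: "i \<in> I" for i
  proof -
    let ?Ni = "dual_raw ?U D' (underlying (F i))"
    obtain Y s r where Y: "Y \<in> \<Y>" and s: "raw_hom ?U ?Ni (hom_mod U Y) s" and r: "raw_hom ?U (hom_mod U Y) ?Ni r"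
      and rs: "\<forall>K \<in> obj ?U. \<forall>x \<in> carrier (omap ?Ni K). r K (s K x) = x"
      using F i unfolding modules_def raw_retract_def by blast
    let ?a = "\<lambda>Y \<xi>. compose (carrier (omap (F i) (omap D' Y))) \<xi> (component (\<iota> i) (omap D' Y))"
    let ?b = "\<lambda>Y \<xi>. compose (carrier (omap S (omap D' Y))) \<xi> (\<pi> i (omap D' Y))"
    have a: "raw_hom ?U ?N ?Ni ?a" using D'.raw_hom_dual[OF Fm[OF i] \<iota>h[OF i]] by simp
    have b: "raw_hom ?U ?Ni ?N ?b" using D'.raw_hom_dual[OF Sm \<pi>[OF i]] by simp
    have "?d (\<lambda>K x. component (\<iota> i) K (\<pi> i K x)) Z \<xi> = ?b Z (r Z (s Z (?a Z \<xi>)))"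
      if Z: "Z \<in> obj ?U" and \<xi>: "\<xi> \<in> carrier (omap ?N Z)" for Z \<xi>
    proof -
      have "r Z (s Z (?a Z \<xi>)) = ?a Z \<xi>" using rs Z raw_homD(2)[OF a Z \<xi>] by blast
      moreover have "\<pi> i (omap D' Z) x \<in> carrier (omap (F i) (omap D' Z))"
        if "x \<in> carrier (omap S (omap D' Z))" for x
        using raw_homD(2)[OF \<pi>[OF i] D'.D_obj[OF Z]] that by simp
      ultimately show ?thesis by (auto simp: compose_def intro!: restrict_ext)
    qed
    then show ?thesis
      unfolding factors_def using Y raw_hom_comp[OF U.preadditive_compacts a s] raw_hom_comp[OF U.preadditive_compacts r b]
      by (intro bexI[OF _ Y] exI[of _ "\<lambda>K x. s K (?a K x)"] exI[of _ "\<lambda>K x. ?b K (r K x)"]) blast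
  qed
  \<comment> \<open>Induction over subsets J of I builds the partial sum E of the \<iota> i \<pi> i
    together with a factorization of its dual; E fixes the summands in J and kills the
    others.\<close>
  have "\<exists>E. raw_hom ?T (underlying S) (underlying S) E \<and> factors ?N (?d E) \<and>
      (\<forall>j\<in>I. \<forall>K \<in> obj ?T. \<forall>x \<in> carrier (omap (F j) K).
        E K (component (\<iota> j) K x) = (if j \<in> J then component (\<iota> j) K x else \<one>\<^bsub>omap S K\<^esub>))"
    if "finite J" "J \<subseteq> I" for J
    using that
  proof (induction J)
    case empty
    let ?E = "\<lambda>K (x :: 'v). \<one>\<^bsub>omap S K\<^esub>"
    have E: "raw_hom ?T (underlying S) (underlying S) ?E"
      using raw_hom_one[OF Sm, of "underlying S"] by simp
    have eq: "?d ?E Y \<xi> = \<one>\<^bsub>omap ?N Y\<^esub>" if Y: "Y \<in> obj ?U" and \<xi>: "\<xi> \<in> carrier (omap ?N Y)" for Y \<xi>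
    proof -
      have "group (omap S (omap D' Y))" using raw_module.grp[OF Sm D'.D_obj[OF Y]] by simp
      then have "\<xi> \<one>\<^bsub>omap S (omap D' Y)\<^esub> = \<one>\<^bsub>QZ\<^esub>"
        using \<xi> comm_group_QZ comm_group.axioms(2) by (intro hom_one) auto
      then show ?thesis by (auto simp: compose_def intro!: restrict_ext)
    qed
    have "factors ?N (?d ?E)"
      by (rule factors_cong[OF factors_one[OF N] eq])
    then show ?case using E by (intro exI[of _ ?E]) simp
  next
    case (insert i J)
    then obtain E where E: "raw_hom ?T (underlying S) (underlying S) E" and fE: "factors ?N (?d E)"
      and E\<iota>: "\<forall>j\<in>I. \<forall>K \<in> obj ?T. \<forall>x \<in> carrier (omap (F j) K).
        E K (component (\<iota> j) K x) = (if j \<in> J then component (\<iota> j) K x else \<one>\<^bsub>omap S K\<^esub>)" by blast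
    have i: "i \<in> I" using insert by blast
    let ?p = "\<lambda>K x. component (\<iota> i) K (\<pi> i K x)"
    let ?E = "\<lambda>K x. ?p K x \<otimes>\<^bsub>omap S K\<^esub> E K x"
    have p: "raw_hom ?T (underlying S) (underlying S) ?p"
      by (rule raw_hom_comp[OF TP \<pi>[OF i] \<iota>h[OF i]])
    have E': "raw_hom ?T (underlying S) (underlying S) ?E"
      using raw_hom_mult[OF Sm p E] by simp
    have eq: "?d ?E Y \<xi> = ?d ?p Y \<xi> \<otimes>\<^bsub>omap ?N Y\<^esub> ?d E Y \<xi>"
      if Y: "Y \<in> obj ?U" and \<xi>: "\<xi> \<in> carrier (omap ?N Y)" for Y \<xi>
    proof -
      note DY = D'.D_obj[OF Y]
      have \<xi>h: "\<xi> \<in> hom (omap S (omap D' Y)) QZ" using \<xi> by simp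
      show ?thesis
        using raw_homD(2)[OF p DY] raw_homD(2)[OF E DY] hom_mult[OF \<xi>h]
        by (auto simp: compose_def intro!: restrict_ext)
    qed
    have fE': "factors ?N (?d ?E)"
      by (rule factors_cong[OF factors_mult[OF N summand[OF i] fE] eq])
    have "?E K (component (\<iota> j) K x) = (if j \<in> insert i J then component (\<iota> j) K x else \<one>\<^bsub>omap S K\<^esub>)"
      if j: "j \<in> I" and K: "K \<in> obj ?T" and x: "x \<in> carrier (omap (F j) K)" for j K x
    proof -
      interpret G: comm_group "omap S K" using raw_module.comm_grp[OF Sm K] by simp
      have jx: "component (\<iota> j) K x \<in> carrier (omap S K)"
        using raw_homD(2)[OF \<iota>h[OF j] K] x by simp
      have one: "component (\<iota> i) K \<one>\<^bsub>omap (F i) K\<^esub> = \<one>\<^bsub>omap S K\<^esub>"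
        using raw_hom_one_at[OF Fm[OF i] Sm \<iota>h[OF i] K] by simp
      have e: "E K (component (\<iota> j) K x) = (if j \<in> J then component (\<iota> j) K x else \<one>\<^bsub>omap S K\<^esub>)"
        using E\<iota> j K x by blast
      show ?thesis
        unfolding \<pi>\<iota>[OF j i K x] e using one jx insert.hyps(2) by auto
    qed
    then show ?case using E' fE' by (intro exI[of _ ?E]) blast
  qed
  from this[OF fin subset_refl] obtain E where E: "raw_hom ?T (underlying S) (underlying S) E"
    and fE: "factors ?N (?d E)"
    and E\<iota>0: "\<forall>j\<in>I. \<forall>K \<in> obj ?T. \<forall>x \<in> carrier (omap (F j) K).
      E K (component (\<iota> j) K x) = (if j \<in> I then component (\<iota> j) K x else \<one>\<^bsub>omap S K\<^esub>)" by blast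
  have E\<iota>: "E K (component (\<iota> j) K x) = component (\<iota> j) K x"
    if "j \<in> I" "K \<in> obj ?T" "x \<in> carrier (omap (F j) K)" for j K x
    using E\<iota>0 that by simp
  \<comment> \<open>Uniqueness of maps out of S concerns arrows of the category of modules, so E and
    the identity are first turned into arrows \<alpha> and \<beta>.\<close>
  have Eid: "E K x = x" if K: "K \<in> obj ?T" and x: "x \<in> carrier (omap S K)" for K x
  proof (rule Mod_cat_arr_exists[OF TP SO SO E], rule Mod_cat_arr_exists[OF TP SO SO raw_hom_id])
    fix \<alpha> \<beta> assume \<alpha>: "\<alpha> \<in> Homs ?M S S" and \<alpha>c: "\<And>K x. K \<in> obj ?T \<Longrightarrow> x \<in> carrier (omap S K) \<Longrightarrow> component \<alpha> K x = E K x"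
      and \<beta>: "\<beta> \<in> Homs ?M S S" and \<beta>c: "\<And>K x. K \<in> obj ?T \<Longrightarrow> x \<in> carrier (omap S K) \<Longrightarrow> component \<beta> K x = x"
    have \<iota>cl: "component (\<iota> i) K x \<in> carrier (omap S K)"
      if "i \<in> I" "K \<in> obj ?T" "x \<in> carrier (omap (F i) K)" for i K x
      using raw_homD(2)[OF \<iota>h[OF that(1)] that(2)] that(3) by simp
    have 1: "\<alpha> \<cdot>\<^bsub>?M\<^esub> \<iota> i = \<iota> i" if i: "i \<in> I" for i
    proof (rule Mod_cat_arr_eqI[OF Mod_cat_cmp_hom[OF TP \<iota>[OF i] \<alpha>] \<iota>[OF i]])
      fix K x assume K: "K \<in> obj ?T" and x: "x \<in> carrier (omap (F i) K)"
      show "component (\<alpha> \<cdot>\<^bsub>?M\<^esub> \<iota> i) K x = component (\<iota> i) K x"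
        using component_cmp[OF \<iota>[OF i] \<alpha> K x] \<alpha>c[OF K \<iota>cl[OF i K x]] E\<iota>[OF i K x] by simp
    qed
    have 2: "\<beta> \<cdot>\<^bsub>?M\<^esub> \<iota> i = \<iota> i" if i: "i \<in> I" for i
    proof (rule Mod_cat_arr_eqI[OF Mod_cat_cmp_hom[OF TP \<iota>[OF i] \<beta>] \<iota>[OF i]])
      fix K x assume K: "K \<in> obj ?T" and x: "x \<in> carrier (omap (F i) K)"
      show "component (\<beta> \<cdot>\<^bsub>?M\<^esub> \<iota> i) K x = component (\<iota> i) K x"
        using component_cmp[OF \<iota>[OF i] \<beta> K x] \<beta>c[OF K \<iota>cl[OF i K x]] by simp
    qed
    have ex1: "\<exists>!h. h \<in> Homs ?M S S \<and> (\<forall>i \<in> I. h \<cdot>\<^bsub>?M\<^esub> \<iota> i = \<iota> i)"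
      using univ[OF SO, of \<iota>] \<iota> by blast
    have "\<alpha> = \<beta>"
      using the1_equality[OF ex1 conjI[OF \<alpha> ballI[OF 1]]] the1_equality[OF ex1 conjI[OF \<beta> ballI[OF 2]]]
      by simp
    then show ?thesis using \<alpha>c[OF K x] \<beta>c[OF K x] by simp
  qed
  have Ed: "\<xi> = ?d E Y \<xi>" if Y: "Y \<in> obj ?U" and \<xi>: "\<xi> \<in> carrier (omap ?N Y)" for Y \<xi>
  proof (rule extensionalityI[symmetric])
    show "?d E Y \<xi> \<in> extensional (carrier (omap S (omap D' Y)))" by (simp add: compose_def)
    show "\<xi> \<in> extensional (carrier (omap S (omap D' Y)))" using \<xi> by simp
    show "?d E Y \<xi> x = \<xi> x" if "x \<in> carrier (omap S (omap D' Y))" for x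
      using Eid[OF D'.D_obj[OF Y] that] that by (simp add: compose_def)
  qed
  have "factors ?N (\<lambda>K x. x)"
    by (rule factors_cong[OF fE Ed])
  then show "S \<in> modules"
    using SO by (simp only: factors_id_iff modules_def mem_Collect_eq)
qed

text \<open>Membership of yX is a statement about y(QX) by \<open>dual_represented\<close>. If it is
  a retract of yY, lifting leads to a retract of QQ'Y, which is in \<Y> by applying the pair
  condition in both directions.\<close>

lemma represented_modules: "represented_part T modules = \<X>"
proof -
  let ?T = "compacts V T" and ?U = "compacts V U"
  interpret D': dualizing_functor V ?T ?U D' by (rule D'_dualizing)
  interpret S: AGJ V U T Q' Q D' D by (rule AGJ_swap)
  have "(yon T X :: ('o, 'm, 'v) abmod) \<in> modules \<longleftrightarrow> X \<in> \<X>" if X: "X \<in> obj T" for X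
  proof -
    note hX = T.raw_module_hom_mod[OF X]
    have yO: "(yon T X :: ('o, 'm, 'v) abmod) \<in> obj (Mod_cat V ?T)"
      unfolding yon_eq_copy_mod[of T X V] by (rule raw_module.copy_mod_obj[OF hX])
    note yR = raw_module_of_obj[OF yO]
    have c: "raw_retract ?T (hom_mod T X) (underlying (yon T X :: ('o, 'm, 'v) abmod))"
      "raw_retract ?T (underlying (yon T X :: ('o, 'm, 'v) abmod)) (hom_mod T X)"
      unfolding yon_eq_copy_mod[of T X V] using raw_module.raw_retract_copy[OF hX] .
    note tr = raw_retract_trans[OF U.preadditive_compacts]
    have d1: "raw_retract ?U (dual_raw ?U D' (underlying (yon T X :: ('o, 'm, 'v) abmod))) (hom_mod U (omap Q X))"
      by (rule tr[OF D'.raw_retract_dual[OF yR hX c(2)] dual_represented(1)[OF X]])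
    have d2: "raw_retract ?U (hom_mod U (omap Q X)) (dual_raw ?U D' (underlying (yon T X :: ('o, 'm, 'v) abmod)))"
      by (rule tr[OF dual_represented(2)[OF X] D'.raw_retract_dual[OF hX yR c(1)]])
    show ?thesis
    proof
      assume "X \<in> \<X>"
      then have "omap Q X \<in> \<Y>" using pair_iff(1)[OF X] by simp
      then show "yon T X \<in> modules" using yO d1 unfolding modules_def by blast
    next
      assume "yon T X \<in> modules"
      then obtain Y where Y: "Y \<in> \<Y>"
        and ret: "raw_retract ?U (dual_raw ?U D' (underlying (yon T X :: ('o, 'm, 'v) abmod))) (hom_mod U Y)"
        by (auto simp: modules_def)
      note YO = pair_obj(2)[OF Y]
      obtain s r where sr: "s \<in> Homs U (omap Q X) (omap Q (omap Q' Y))" "r \<in> Homs U (omap Q (omap Q' Y)) (omap Q X)"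
        "r \<cdot>\<^bsub>U\<^esub> s = ident U (omap Q X)"
        by (rule retract_lift[OF X YO tr[OF d2 ret]])
      have "omap Q (omap Q' Y) \<in> \<Y>"
        using pair_iff(2)[OF YO] pair_iff(1)[OF S.Q_obj[OF YO]] Y by simp
      moreover have "closed_retracts U \<Y>"
        using pair by (simp add: symmetric_duality_pair_def duality_pair_def)
      ultimately have "omap Q X \<in> \<Y>"
        using sr Q_obj[OF X] unfolding closed_retracts_def by blast
      then show "X \<in> \<X>" using pair_iff(1)[OF X] by simp
    qed
  qed
  then show ?thesis using pair_obj(1) by (auto simp: represented_part_def)
qed

text \<open>Forwards, the retract of yY is dualized and \<partial>(yY) is y(Q'Y). Backwards, one
  more dualization leads from \<partial>\<partial>f to \<partial>\<partial>\<partial>f, of which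
  \<partial>f is a retract. The facts \<open>c\<close> exchange the labelled \<open>dual_mod\<close>
  with the unlabelled \<open>dual_raw\<close>.\<close>

lemma modules_iff_dual:
  assumes f: "f \<in> obj (Mod_cat V (compacts V T))"
  shows "f \<in> modules \<longleftrightarrow> dual_mod U D' f \<in> AGJ_duality_pair.modules V U T D \<X>"
proof -
  let ?T = "compacts V T" and ?U = "compacts V U"
  interpret S: AGJ_duality_pair V U T Q' Q D' D \<Y> \<X> by (rule pair_swap)
  interpret D': dualizing_functor V ?T ?U D' by (rule D'_dualizing)
  interpret D: dualizing_functor V ?U ?T D by (rule D_dualizing)
  note fm = raw_module_of_obj[OF f]
  note N = D'.raw_module_dual[OF fm]
  note gO = dual_mod_obj[OF f]
  note gm = S.raw_module_of_obj[OF gO]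
  have c: "raw_retract ?U (dual_raw ?U D' (underlying f)) (underlying (dual_mod U D' f))"
    "raw_retract ?U (underlying (dual_mod U D' f)) (dual_raw ?U D' (underlying f))"
    unfolding dual_mod_eq_copy_mod[of U D' f V] using raw_module.raw_retract_copy[OF N] .
  note trT = raw_retract_trans[OF T.preadditive_compacts] and trU = raw_retract_trans[OF U.preadditive_compacts]
  show ?thesis
  proof
    assume "f \<in> modules"
    then obtain Y where Y: "Y \<in> \<Y>" and ret: "raw_retract ?U (dual_raw ?U D' (underlying f)) (hom_mod U Y)"
      by (auto simp: modules_def)
    note YO = pair_obj(2)[OF Y]
    have "raw_retract ?T (dual_raw ?T D (underlying (dual_mod U D' f))) (hom_mod T (omap Q' Y))"
      by (rule trT[OF D.raw_retract_dual[OF gm U.raw_module_hom_mod[OF YO] trU[OF c(2) ret]]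
            S.dual_represented(1)[OF YO]])
    moreover have "omap Q' Y \<in> \<X>" using pair_iff(2)[OF YO] Y by simp
    ultimately show "dual_mod U D' f \<in> S.modules" using gO unfolding S.modules_def by blast
  next
    assume "dual_mod U D' f \<in> S.modules"
    then obtain X where X: "X \<in> \<X>"
      and ret: "raw_retract ?T (dual_raw ?T D (underlying (dual_mod U D' f))) (hom_mod T X)"
      by (auto simp: S.modules_def)
    note XO = pair_obj(1)[OF X]
    note DN = D.raw_module_dual[OF N]
    have "raw_retract ?T (dual_raw ?T D (dual_raw ?U D' (underlying f))) (hom_mod T X)"
      by (rule trT[OF D.raw_retract_dual[OF N gm c(1)] ret])
    from D'.raw_retract_dual[OF DN T.raw_module_hom_mod[OF XO] this]
    have "raw_retract ?U (dual_raw ?U D' (underlying f)) (hom_mod U (omap Q X))"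
      by (rule trU[OF triple_dual[OF fm] trU[OF _ dual_represented(1)[OF XO]]])
    moreover have "omap Q X \<in> \<Y>" using pair_iff(1)[OF XO] X by simp
    ultimately show "f \<in> modules" using f unfolding modules_def by blast
  qed
qed

end

theorem theorem9p3:
  fixes T :: "('o1, 'm1) triang" and U :: "('o2, 'm2) triang"
    and Q :: "('o1, 'm1, 'o2, 'm2) fctr" and Q' :: "('o2, 'm2, 'o1, 'm1) fctr"
    and D :: "('o1, 'm1, 'o2, 'm2) fctr" and D' :: "('o2, 'm2, 'o1, 'm1) fctr"
    and \<X> :: "'o1 set" and \<Y> :: "'o2 set"
  assumes "grothendieck_universe TYPE('v)"
    and "AGJ_duality_triple TYPE('v) T U Q Q' D D'"
    and "symmetric_duality_pair T U (omap Q) (omap Q') \<X> \<Y>"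
  shows "\<exists>\<A> \<B>.
    symmetric_duality_pair
      (Mod_cat TYPE('v) (compacts TYPE('v) T)) (Mod_cat TYPE('v) (compacts TYPE('v) U))
      (dual_mod U D') (dual_mod T D) \<A> \<B> \<and>
    represented_part T \<A> = \<X> \<and> represented_part U \<B> = \<Y>"
proof -
  interpret P: AGJ_duality_pair "TYPE('v)" T U Q Q' D D' \<X> \<Y>
    by (intro AGJ_duality_pair.intro AGJ.intro AGJ_duality_pair_axioms.intro assms)
  interpret S: AGJ_duality_pair "TYPE('v)" U T Q' Q D' D \<Y> \<X> by (rule P.pair_swap)
  have "P.modules \<subseteq> obj (Mod_cat TYPE('v) (compacts TYPE('v) T))"
    "S.modules \<subseteq> obj (Mod_cat TYPE('v) (compacts TYPE('v) U))"
    by (auto simp only: P.modules_def S.modules_def)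
  then have "symmetric_duality_pair
      (Mod_cat TYPE('v) (compacts TYPE('v) T)) (Mod_cat TYPE('v) (compacts TYPE('v) U))
      (dual_mod U D') (dual_mod T D) P.modules S.modules"
    unfolding symmetric_duality_pair_def duality_pair_def
    using P.modules_iff_dual S.modules_iff_dual P.modules_closed_finite_coproducts
      S.modules_closed_finite_coproducts P.modules_closed_retracts S.modules_closed_retracts
    by blast
  then show ?thesis using P.represented_modules S.represented_modules by blast
qed

end
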